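(* Let $\mu$ be a $\sigma$-finite positive measure on a $\sigma$-algebra of subsets of a non-void set $X$, let $n,m\ge1$, let $\Psi_{ij}$ for $i=1,\ldots,n$ and $j=1,\ldots,m$ be bounded sets of positive kernel operators on $L^2(X,\mu)$, and let $\rho\in\{r,\hat r,r_{ess},\hat r_{ess},\|\cdot\|,\gamma,w\}$. Define $\overline{\rho}_n:[0,1]\to[0,\infty)$ by $$\overline{\rho}_n(\alpha)=\Big(\rho\big((S_\alpha(\Psi_{11})+\cdots+S_\alpha(\Psi_{1m}))\cdots(S_\alpha(\Psi_{n1})+\cdots+S_\alpha(\Psi_{nm}))\big)\Big)^{\frac12}\times$$ $$\Big(\rho\big((S_\alpha(\Psi_{n1})+\cdots+S_\alpha(\Psi_{nm}))\cdots(S_\alpha(\Psi_{11})+\cdots+S_\alpha(\Psi_{1m}))\big)\Big)^{\frac12}.$$ Then $$\overline{\rho}_n(\alpha)\le\rho\big((\Psi_{11}+\cdots+\Psi_{1m})\cdots(\Psi_{n1}+\cdots+\Psi_{nm})\big)^{\frac12}\;\rho\big((\Psi_{n1}+\cdots+\Psi_{nm})\cdots(\Psi_{11}+\cdots+\Psi_{1m})\big)^{\frac12}$$ for each $\alpha\in[0,1]$. Moreover, $\overline{\rho}_n$ is decreasing on $[0,\tfrac12]$ and increasing on $[\tfrac12,1]$.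
   Context: $L=L^2(X,\mu)$ is the space of complex square-integrable functions (mod a.e. equality). "Decreasing" and "increasing" are meant in the weak sense (non-increasing, non-decreasing). A kernel operator $K$ on $L$ is a linear operator for which there is a $\mu\times\mu$-measurable $k:X\times X\to\mathbb C$ such that for all $f\in L$ and almost all $x$, $\int_X|k(x,y)f(y)|\,d\mu(y)<\infty$ and $(Kf)(x)=\int_X k(x,y)f(y)\,d\mu(y)$. It is positive if it maps nonnegative functions to nonnegative functions, equivalently $k\ge 0$ a.e.; positive operators are automatically bounded. A set $\Psi$ of operators is bounded if $\sup_{A\in\Psi}\|A\|<\infty$. $A^*$ denotes the adjoint of $A$; if $A$ has a nonnegative kernel $a(x,y)$, then $A^*$ has kernel $a(y,x)$. For positive kernel operators $A,B$ with kernels $a,b$ and $\alpha\in[0,1]$, $A^{(\alpha)}\circ B^{(1-\alpha)}$ is the positive kernel operator on $L$ with kernel $a(x,y)^\alpha b(x,y)^{1-\alpha}$ (with $0^0=1$). For a bounded set $\Psi$ of positive kernel operators, $S_\alpha(\Psi)=\{A^{(\alpha)}\circ(B^* )^{(1-\alpha)}:A,B\in\Psi\}$ (with $A,B$ chosen independently), which is again a bounded set of positive kernel operators. For sets of operators, $\Psi+\Sigma=\{A+B:A\in\Psi,B\in\Sigma\}$ and $\Psi\Sigma=\{AB:A\in\Psi,B\in\Sigma\}$ (similarly for several summands or factors), and $\Sigma^m=\{A_1\cdots A_m:A_i\in\Sigma\}$. For a single bounded operator $A$ on $L$: $r(A)$ is the spectral radius; $\|A\|$ the operator norm; $w(A)=\sup\{|\langle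 Af,f\rangle|:\|f\|_2=1\}$ the numerical radius; $\gamma(A)=\inf\{\delta>0:\text{there is a finite }M\subset L\text{ with }A(D_L)\subset M+\delta D_L\}$, $D_L$ the closed unit ball of $L$, the Hausdorff measure of non-compactness; $r_{ess}(A)=\lim_{j\to\infty}\gamma(A^j)^{1/j}$ the essential spectral radius (the spectral radius of the image of $A$ in the Calkin algebra). For a bounded set $\Sigma$ of bounded operators: $\|\Sigma\|=\sup_{A\in\Sigma}\|A\|$, $\gamma(\Sigma)=\sup_{A\in\Sigma}\gamma(A)$, $w(\Sigma)=\sup_{A\in\Sigma}w(A)$; the generalized spectral radius is $r(\Sigma)=\limsup_{m\to\infty}[\sup_{A\in\Sigma^m}r(A)]^{1/m}$; the joint spectral radius is $\hat r(\Sigma)=\lim_{m\to\infty}[\sup_{A\in\Sigma^m}\|A\|]^{1/m}$; the generalized essential spectral radius is $r_{ess}(\Sigma)=\limsup_{m\to\infty}[\sup_{A\in\Sigma^m}r_{ess}(A)]^{1/m}$; the joint essential spectral radius is $\hat r_{ess}(\Sigma)=\lim_{m\to\infty}[\sup_{A\in\Sigma^m}\gamma(A)]^{1/m}$. (Suprema are taken in $[0,\infty)$, so $\sup\emptyset=0$.) *)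

theory Defs
  imports "HOL-Analysis.Analysis"
begin

text \<open>
  Elements of \<open>L\<^sup>2(X, \<mu>)\<close> are represented by square-integrable functions \<open>'a \<Rightarrow> complex\<close>, where
  \<open>X = space M\<close>, and operators by maps between such functions; equality in \<open>L\<^sup>2\<close> is equality
  almost everywhere. A \<open>linear_operator\<close> respects this equality, so it is a linear map on the
  quotient. Operators are applied only to members of \<open>L2 M\<close>, and every quantity defined below
  depends only on the induced operators on the quotient.
\<close>

type_synonym 'a l2op = "('a \<Rightarrow> complex) \<Rightarrow> ('a \<Rightarrow> complex)"

definition L2 :: "'a measure \<Rightarrow> ('a \<Rightarrow> complex) set" where
  "L2 M = {f \<in> borel_measurable M. integrable M (\<lambda>x. (cmod (f x))\<^sup>2)}"

definition l2_norm :: "'a measure \<Rightarrow> ('a \<Rightarrow> complex) \<Rightarrow> real" where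
  "l2_norm M f = sqrt (LINT x|M. (cmod (f x))\<^sup>2)"

definition l2_inner :: "'a measure \<Rightarrow> ('a \<Rightarrow> complex) \<Rightarrow> ('a \<Rightarrow> complex) \<Rightarrow> complex" where
  "l2_inner M f g = (LINT x|M. f x * cnj (g x))"

definition l2_eq :: "'a measure \<Rightarrow> ('a \<Rightarrow> complex) \<Rightarrow> ('a \<Rightarrow> complex) \<Rightarrow> bool" where
  "l2_eq M f g \<longleftrightarrow> (AE x in M. f x = g x)"

definition linear_operator :: "'a measure \<Rightarrow> 'a l2op \<Rightarrow> bool" where
  "linear_operator M K \<longleftrightarrow>
     (\<forall>f\<in>L2 M. K f \<in> L2 M) \<and>
     (\<forall>f\<in>L2 M. \<forall>g\<in>L2 M. l2_eq M f g \<longrightarrow> l2_eq M (K f) (K g)) \<and>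
     (\<forall>f\<in>L2 M. \<forall>g\<in>L2 M. l2_eq M (K (\<lambda>x. f x + g x)) (\<lambda>x. K f x + K g x)) \<and>
     (\<forall>c. \<forall>f\<in>L2 M. l2_eq M (K (\<lambda>x. c * f x)) (\<lambda>x. c * K f x))"

definition bounded_operators :: "'a measure \<Rightarrow> 'a l2op set \<Rightarrow> bool" where
  "bounded_operators M \<Psi> \<longleftrightarrow> (\<exists>C. \<forall>A\<in>\<Psi>. \<forall>f\<in>L2 M. l2_norm M (A f) \<le> C * l2_norm M f)"

definition is_adjoint :: "'a measure \<Rightarrow> 'a l2op \<Rightarrow> 'a l2op \<Rightarrow> bool" where
  "is_adjoint M A B \<longleftrightarrow> linear_operator M B \<and>
     (\<forall>f\<in>L2 M. \<forall>g\<in>L2 M. l2_inner M (A f) g = l2_inner M f (B g))"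


subsection \<open>Positive kernel operators and weighted geometric means\<close>

text \<open>
  Every function measurable for the completed product \<open>\<sigma>\<close>-algebra agrees almost everywhere with a
  function measurable for \<open>M \<Otimes>\<^sub>M M\<close>, and such functions induce the same operator; so using the
  product \<open>\<sigma>\<close>-algebra itself loses no operators.
\<close>

definition has_kernel :: "'a measure \<Rightarrow> 'a l2op \<Rightarrow> ('a \<times> 'a \<Rightarrow> complex) \<Rightarrow> bool" where
  "has_kernel M K k \<longleftrightarrow>
     linear_operator M K \<and> k \<in> borel_measurable (M \<Otimes>\<^sub>M M) \<and>
     (\<forall>f\<in>L2 M. AE x in M.
        integrable M (\<lambda>y. k (x, y) * f y) \<and> K f x = (LINT y|M. k (x, y) * f y))"

definition positive_operator :: "'a measure \<Rightarrow> 'a l2op \<Rightarrow> bool" where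
  "positive_operator M K \<longleftrightarrow>
     (\<forall>f\<in>L2 M. (AE x in M. f x \<in> \<real>\<^sub>\<ge>\<^sub>0) \<longrightarrow> (AE x in M. K f x \<in> \<real>\<^sub>\<ge>\<^sub>0))"

definition positive_kernel_operator :: "'a measure \<Rightarrow> 'a l2op \<Rightarrow> bool" where
  "positive_kernel_operator M K \<longleftrightarrow> (\<exists>k. has_kernel M K k) \<and> positive_operator M K"

text \<open>The convention \<open>0\<^sup>0 = 1\<close> is needed here, whereas \<open>0 powr 0 = 0\<close>.\<close>

definition kpow :: "real \<Rightarrow> real \<Rightarrow> real" where
  "kpow t \<alpha> = (if \<alpha> = 0 then 1 else t powr \<alpha>)"

text \<open>
  \<open>C\<close> represents \<open>A\<^sup>(\<^sup>\<alpha>\<^sup>) \<circ> B\<^sup>(\<^sup>1\<^sup>-\<^sup>\<alpha>\<^sup>)\<close>. The kernel of a positive kernel operator is determined and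
  nonnegative almost everywhere, hence can be chosen nonnegative everywhere, and the operator
  represented by \<open>C\<close> does not depend on this choice.
\<close>

definition is_weighted_mean :: "'a measure \<Rightarrow> real \<Rightarrow> 'a l2op \<Rightarrow> 'a l2op \<Rightarrow> 'a l2op \<Rightarrow> bool" where
  "is_weighted_mean M \<alpha> A B C \<longleftrightarrow>
     (\<exists>a b :: 'a \<times> 'a \<Rightarrow> real. (\<forall>p. 0 \<le> a p) \<and> (\<forall>p. 0 \<le> b p) \<and>
        has_kernel M A (\<lambda>p. complex_of_real (a p)) \<and>
        has_kernel M B (\<lambda>p. complex_of_real (b p)) \<and>
        has_kernel M C (\<lambda>p. complex_of_real (kpow (a p) \<alpha> * kpow (b p) (1 - \<alpha>))))"

definition S_set :: "'a measure \<Rightarrow> real \<Rightarrow> 'a l2op set \<Rightarrow> 'a l2op set" where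
  "S_set M \<alpha> \<Psi> =
     {C. \<exists>A\<in>\<Psi>. \<exists>B\<in>\<Psi>. \<exists>B'. is_adjoint M B B' \<and> is_weighted_mean M \<alpha> A B' C}"


subsection \<open>Sums, products and powers of sets of operators\<close>

definition op_set_plus :: "'a l2op set \<Rightarrow> 'a l2op set \<Rightarrow> 'a l2op set" where
  "op_set_plus \<Psi> \<Sigma> = {(\<lambda>f x. A f x + B f x) | A B. A \<in> \<Psi> \<and> B \<in> \<Sigma>}"

definition op_set_times :: "'a l2op set \<Rightarrow> 'a l2op set \<Rightarrow> 'a l2op set" where
  "op_set_times \<Psi> \<Sigma> = {A \<circ> B | A B. A \<in> \<Psi> \<and> B \<in> \<Sigma>}"

definition op_set_sum_list :: "'a l2op set list \<Rightarrow> 'a l2op set" where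
  "op_set_sum_list \<Psi>s = foldr op_set_plus \<Psi>s {\<lambda>f x. 0}"

definition op_set_prod_list :: "'a l2op set list \<Rightarrow> 'a l2op set" where
  "op_set_prod_list \<Psi>s = foldr op_set_times \<Psi>s {id}"

definition op_set_power :: "'a l2op set \<Rightarrow> nat \<Rightarrow> 'a l2op set" where
  "op_set_power \<Sigma> m = op_set_prod_list (replicate m \<Sigma>)"


subsection \<open>Norms and radii\<close>

text \<open>The supremum in \<open>[0, \<infinity>)\<close>, so that the supremum of the empty set is \<open>0\<close>.\<close>

definition Sup0 :: "real set \<Rightarrow> real" where
  "Sup0 S = Sup (insert 0 S)"

definition op_norm :: "'a measure \<Rightarrow> 'a l2op \<Rightarrow> real" where
  "op_norm M A = Sup0 {l2_norm M (A f) | f. f \<in> L2 M \<and> l2_norm M f \<le> 1}"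

definition num_radius :: "'a measure \<Rightarrow> 'a l2op \<Rightarrow> real" where
  "num_radius M A = Sup0 {cmod (l2_inner M (A f) f) | f. f \<in> L2 M \<and> l2_norm M f = 1}"

definition meas_noncompact :: "'a measure \<Rightarrow> 'a l2op \<Rightarrow> real" where
  "meas_noncompact M A = Inf {\<delta>. \<delta> > 0 \<and>
     (\<exists>N. finite N \<and> N \<subseteq> L2 M \<and>
        (\<forall>f\<in>L2 M. l2_norm M f \<le> 1 \<longrightarrow> (\<exists>g\<in>N. l2_norm M (\<lambda>x. A f x - g x) \<le> \<delta>)))}"

definition l2_spectrum :: "'a measure \<Rightarrow> 'a l2op \<Rightarrow> complex set" where
  "l2_spectrum M A = {z. \<not> (\<exists>R. linear_operator M R \<and> bounded_operators M {R} \<and>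
     (\<forall>f\<in>L2 M. l2_eq M (R (\<lambda>x. z * f x - A f x)) f \<and>
                 l2_eq M (\<lambda>x. z * R f x - A (R f) x) f))}"

definition spec_radius :: "'a measure \<Rightarrow> 'a l2op \<Rightarrow> real" where
  "spec_radius M A = Sup0 (cmod ` l2_spectrum M A)"

definition ess_spec_radius :: "'a measure \<Rightarrow> 'a l2op \<Rightarrow> real" where
  "ess_spec_radius M A = lim (\<lambda>j. root j (meas_noncompact M (A ^^ j)))"

definition set_norm :: "'a measure \<Rightarrow> 'a l2op set \<Rightarrow> real" where
  "set_norm M \<Sigma> = Sup0 (op_norm M ` \<Sigma>)"

definition set_meas_noncompact :: "'a measure \<Rightarrow> 'a l2op set \<Rightarrow> real" where
  "set_meas_noncompact M \<Sigma> = Sup0 (meas_noncompact M ` \<Sigma>)"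

definition set_num_radius :: "'a measure \<Rightarrow> 'a l2op set \<Rightarrow> real" where
  "set_num_radius M \<Sigma> = Sup0 (num_radius M ` \<Sigma>)"

definition gen_spec_radius :: "'a measure \<Rightarrow> 'a l2op set \<Rightarrow> real" where
  "gen_spec_radius M \<Sigma> =
     real_of_ereal (limsup (\<lambda>m. ereal (root m (Sup0 (spec_radius M ` op_set_power \<Sigma> m)))))"

definition joint_spec_radius :: "'a measure \<Rightarrow> 'a l2op set \<Rightarrow> real" where
  "joint_spec_radius M \<Sigma> = lim (\<lambda>m. root m (Sup0 (op_norm M ` op_set_power \<Sigma> m)))"

definition gen_ess_spec_radius :: "'a measure \<Rightarrow> 'a l2op set \<Rightarrow> real" where
  "gen_ess_spec_radius M \<Sigma> =
     real_of_ereal (limsup (\<lambda>m. ereal (root m (Sup0 (ess_spec_radius M ` op_set_power \<Sigma> m)))))"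

definition joint_ess_spec_radius :: "'a measure \<Rightarrow> 'a l2op set \<Rightarrow> real" where
  "joint_ess_spec_radius M \<Sigma> =
     lim (\<lambda>m. root m (Sup0 (meas_noncompact M ` op_set_power \<Sigma> m)))"


subsection \<open>Products of sums of the given sets\<close>

definition prod_of_sums :: "nat \<Rightarrow> nat \<Rightarrow> (nat \<Rightarrow> nat \<Rightarrow> 'a l2op set) \<Rightarrow> 'a l2op set" where
  "prod_of_sums n m \<Psi> =
     op_set_prod_list (map (\<lambda>i. op_set_sum_list (map (\<Psi> i) [1..<Suc m])) [1..<Suc n])"

definition prod_of_sums_rev :: "nat \<Rightarrow> nat \<Rightarrow> (nat \<Rightarrow> nat \<Rightarrow> 'a l2op set) \<Rightarrow> 'a l2op set" where
  "prod_of_sums_rev n m \<Psi> =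
     op_set_prod_list (map (\<lambda>i. op_set_sum_list (map (\<Psi> i) [1..<Suc m])) (rev [1..<Suc n]))"

definition rho_bar ::
  "'a measure \<Rightarrow> ('a l2op set \<Rightarrow> real) \<Rightarrow> nat \<Rightarrow> nat \<Rightarrow> (nat \<Rightarrow> nat \<Rightarrow> 'a l2op set) \<Rightarrow> real \<Rightarrow> real" where
  "rho_bar M \<rho> n m \<Psi> \<alpha> =
     sqrt (\<rho> (prod_of_sums n m (\<lambda>i j. S_set M \<alpha> (\<Psi> i j)))) *
     sqrt (\<rho> (prod_of_sums_rev n m (\<lambda>i j. S_set M \<alpha> (\<Psi> i j))))"

end

theory Submission
  imports Defs
begin

text \<open>
  Hoelder's inequality for kernels, applied factor by factor, shows that an element of the product of
  the sums of the \<open>S\<^sub>\<alpha>(\<Psi>\<^sub>i\<^sub>j)\<close> has a kernel dominated by \<open>p\<^sup>\<alpha> q\<^sup>1\<^sup>-\<^sup>\<alpha>\<close>, where \<open>p\<close> is the kernel of an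
  element \<open>P\<close> of the product of the sums of the \<open>\<Psi>\<^sub>i\<^sub>j\<close> and \<open>q\<close> is the kernel of the adjoint of an
  element \<open>Q\<close> of the product in reverse order. This domination is stable under powers. It yields
  \<open>\<phi> C \<le> (\<phi> P)\<^sup>\<alpha> (\<phi> Q)\<^sup>1\<^sup>-\<^sup>\<alpha>\<close> for the norm and the numerical radius by testing the bilinear form on
  nonnegative functions. For the Hausdorff measure of noncompactness, \<open>C\<close> is cut off to sets \<open>D\<close>
  shrinking to a null set: outside \<open>D\<close> the kernel is bounded with support of finite measure, hence
  compact, and the norms of \<open>P\<close> and \<open>Q\<close> cut off to \<open>D\<close> are asymptotically at most their measures of
  noncompactness. The spectral radii follow from Gelfand's formula. The inequality for the reversed
  product has the roles of \<open>P\<close> and \<open>Q\<close> exchanged, so multiplying the two removes \<open>\<alpha>\<close>. Monotonicity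
  follows because \<open>S\<^sub>\<beta>(\<Psi>) \<subseteq> S\<^sub>t(S\<^sub>\<alpha>(\<Psi>))\<close> whenever \<open>\<beta> = t \<alpha> + (1 - t) (1 - \<alpha>)\<close>.
\<close>

section \<open>Square-integrable functions and bounded operators\<close>

text \<open>A composition of elements of the sets \<open>S_set\<close> is in general not a weighted
  mean itself. Hence the whole argument rests on pointwise domination of kernels, which survives
  sums, compositions and cut-offs. Composed kernels may be infinite on null sets, so kernels take
  values in \<open>ennreal\<close>. The identity has no kernel in general, so domination is claimed
  for nonempty products and positive powers only. Gelfand's formula enters asymmetrically. For the
  dominated operator the Neumann series suffices; for \<open>P\<close> and \<open>Q\<close> the
  spectral radius has to control the growth of powers, and positivity yields this from resolvents at
  real points, without complex function theory. Since \<open>lim\<close>, \<open>Sup\<close> and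
  \<open>real_of_ereal\<close> return default values where a limit or supremum fails to exist or is
  infinite, convergence and boundedness are established along with the inequalities. In the
  monotonicity argument, \<alpha> \<le> \<beta> \<le> 1/2 places \<beta> between \<alpha> and 1 -
  \<alpha>, so \<beta> is a convex combination of the two exponents that a weighted mean and the
  adjoint of the mean with exchanged operators carry.\<close>

lemma L2_iff_nn:
  "f \<in> L2 M \<longleftrightarrow> f \<in> borel_measurable M \<and> (\<integral>\<^sup>+x. (ennreal (cmod (f x)))\<^sup>2 \<partial>M) < \<infinity>"
proof -
  have "integrable M (\<lambda>x. (cmod (f x))\<^sup>2) \<longleftrightarrow> (\<integral>\<^sup>+x. (ennreal (cmod (f x)))\<^sup>2 \<partial>M) < \<infinity>"
    if [measurable]: "f \<in> borel_measurable M"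
    by (simp add: integrable_iff_bounded ennreal_power)
  then show ?thesis
    by (auto simp: L2_def)
qed

lemma l2_norm_nonneg [simp]: "0 \<le> l2_norm M f"
  by (simp add: l2_norm_def)

lemma nn_integral_L2:
  assumes "f \<in> L2 M"
  shows "(\<integral>\<^sup>+x. (ennreal (cmod (f x)))\<^sup>2 \<partial>M) = ennreal ((l2_norm M f)\<^sup>2)"
proof -
  have "integrable M (\<lambda>x. (cmod (f x))\<^sup>2)"
    using assms by (simp add: L2_def)
  then show ?thesis
    by (simp add: l2_norm_def nn_integral_eq_integral ennreal_power)
qed

lemma L2_mono:
  assumes g: "g \<in> L2 M" and f [measurable]: "f \<in> borel_measurable M"
    and le: "AE x in M. cmod (f x) \<le> cmod (g x)"
  shows "f \<in> L2 M" "l2_norm M f \<le> l2_norm M g"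
proof -
  have *: "(\<integral>\<^sup>+x. (ennreal (cmod (f x)))\<^sup>2 \<partial>M) \<le> (\<integral>\<^sup>+x. (ennreal (cmod (g x)))\<^sup>2 \<partial>M)"
    using le by (intro nn_integral_mono_AE) (auto intro!: power_mono ennreal_leI elim!: eventually_mono)
  then show fL: "f \<in> L2 M"
    using g unfolding L2_iff_nn by (auto intro: le_less_trans)
  show "l2_norm M f \<le> l2_norm M g"
    using * by (simp add: nn_integral_L2 fL g)
qed

lemma l2_norm_cong_AE:
  assumes "f \<in> borel_measurable M" "g \<in> borel_measurable M" "AE x in M. f x = g x"
  shows "l2_norm M f = l2_norm M g"
proof -
  have "(LINT x|M. (cmod (f x))\<^sup>2) = (LINT x|M. (cmod (g x))\<^sup>2)"
    using assms by (intro integral_cong_AE) (auto elim!: eventually_mono)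
  then show ?thesis
    by (simp add: l2_norm_def)
qed

lemma ennreal_power2_le_imp_le: "x\<^sup>2 \<le> y\<^sup>2 \<Longrightarrow> x \<le> (y::ennreal)"
  by (cases x; cases y) (auto simp: ennreal_power power2_le_iff_abs_le power_eq_top_ennreal top_unique)

lemma nn_integral_mult_L2:
  assumes "f \<in> L2 M" "g \<in> L2 M"
  shows "(\<integral>\<^sup>+x. ennreal (cmod (f x)) * ennreal (cmod (g x)) \<partial>M) \<le> ennreal (l2_norm M f * l2_norm M g)"
proof -
  have [measurable]: "f \<in> borel_measurable M" "g \<in> borel_measurable M"
    using assms by (auto simp: L2_def)
  have "(\<integral>\<^sup>+x. ennreal (cmod (f x)) * ennreal (cmod (g x)) \<partial>M)\<^sup>2 \<le> (ennreal (l2_norm M f * l2_norm M g))\<^sup>2"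
    using Cauchy_Schwarz_nn_integral[of "\<lambda>x. ennreal (cmod (f x))" M "\<lambda>x. ennreal (cmod (g x))"]
    unfolding nn_integral_L2[OF assms(1)] nn_integral_L2[OF assms(2)]
    by (simp add: ennreal_power ennreal_mult[symmetric] power_mult_distrib)
  then show ?thesis
    by (rule ennreal_power2_le_imp_le)
qed

text \<open>Minkowski's inequality: expand the square and bound the cross term by Cauchy-Schwarz.
  Square-integrability of the sum falls out of the same estimate, because extended integrals carry
  no integrability condition.\<close>

lemma L2_add:
  assumes "f \<in> L2 M" "g \<in> L2 M"
  shows "(\<lambda>x. f x + g x) \<in> L2 M" "l2_norm M (\<lambda>x. f x + g x) \<le> l2_norm M f + l2_norm M g"
proof -
  have [measurable]: "f \<in> borel_measurable M" "g \<in> borel_measurable M"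
    using assms by (auto simp: L2_def)
  let ?F = "\<lambda>x. ennreal (cmod (f x))" and ?G = "\<lambda>x. ennreal (cmod (g x))"
  have "(\<integral>\<^sup>+x. (ennreal (cmod (f x + g x)))\<^sup>2 \<partial>M) \<le> (\<integral>\<^sup>+x. (?F x)\<^sup>2 + (?G x)\<^sup>2 + 2 * (?F x * ?G x) \<partial>M)"
  proof (intro nn_integral_mono)
    fix x
    have "(ennreal (cmod (f x + g x)))\<^sup>2 \<le> (ennreal (cmod (f x)) + ennreal (cmod (g x)))\<^sup>2"
      by (intro power_mono) (auto simp: ennreal_plus[symmetric] norm_triangle_ineq simp del: ennreal_plus)
    also have "\<dots> = (?F x)\<^sup>2 + (?G x)\<^sup>2 + 2 * (?F x * ?G x)"
      by (simp add: power2_eq_square algebra_simps mult_2)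
    finally show "(ennreal (cmod (f x + g x)))\<^sup>2 \<le> (?F x)\<^sup>2 + (?G x)\<^sup>2 + 2 * (?F x * ?G x)" .
  qed
  also have "\<dots> = ennreal ((l2_norm M f)\<^sup>2) + ennreal ((l2_norm M g)\<^sup>2) + 2 * (\<integral>\<^sup>+x. ?F x * ?G x \<partial>M)"
    by (simp add: nn_integral_add nn_integral_cmult nn_integral_L2 assms)
  also have "\<dots> \<le> ennreal ((l2_norm M f)\<^sup>2) + ennreal ((l2_norm M g)\<^sup>2) + 2 * ennreal (l2_norm M f * l2_norm M g)"
    by (intro add_mono mult_left_mono nn_integral_mult_L2 assms) auto
  also have "\<dots> = ennreal ((l2_norm M f)\<^sup>2) + ennreal ((l2_norm M g)\<^sup>2) + ennreal (2 * (l2_norm M f * l2_norm M g))"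
    by (subst ennreal_mult') auto
  also have "\<dots> = ennreal ((l2_norm M f + l2_norm M g)\<^sup>2)"
    by (simp add: ennreal_plus[symmetric] power2_sum mult.assoc del: ennreal_plus)
  finally have *: "(\<integral>\<^sup>+x. (ennreal (cmod (f x + g x)))\<^sup>2 \<partial>M) \<le> ennreal ((l2_norm M f + l2_norm M g)\<^sup>2)" .
  then show L: "(\<lambda>x. f x + g x) \<in> L2 M"
    unfolding L2_iff_nn by (auto intro: le_less_trans)
  have "(l2_norm M (\<lambda>x. f x + g x))\<^sup>2 \<le> (l2_norm M f + l2_norm M g)\<^sup>2"
    using * by (simp add: nn_integral_L2[OF L])
  then show "l2_norm M (\<lambda>x. f x + g x) \<le> l2_norm M f + l2_norm M g"
    by (rule power2_le_imp_le) simp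
qed

lemma l2_norm_scale: "l2_norm M (\<lambda>x. c * f x) = cmod c * l2_norm M f"
  by (simp add: l2_norm_def norm_mult power_mult_distrib real_sqrt_mult)

lemma L2_scale: "f \<in> L2 M \<Longrightarrow> (\<lambda>x. c * f x) \<in> L2 M"
  by (auto simp: L2_def norm_mult power_mult_distrib)

lemma L2_uminus: "f \<in> L2 M \<Longrightarrow> (\<lambda>x. - f x) \<in> L2 M"
  using L2_scale[of f M "-1"] by simp

lemma l2_norm_uminus: "l2_norm M (\<lambda>x. - f x) = l2_norm M f"
  using l2_norm_scale[of M "-1" f] by simp

lemma L2_diff:
  assumes "f \<in> L2 M" "g \<in> L2 M"
  shows "(\<lambda>x. f x - g x) \<in> L2 M" "l2_norm M (\<lambda>x. f x - g x) \<le> l2_norm M f + l2_norm M g"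
  using L2_add[OF assms(1) L2_uminus[OF assms(2)]] by (auto simp: l2_norm_uminus)

lemma L2_0 [simp]: "(\<lambda>x. 0) \<in> L2 M"
  by (simp add: L2_def)

lemma l2_norm_0 [simp]: "l2_norm M (\<lambda>x. 0) = 0"
  by (simp add: l2_norm_def)

lemma L2_sum:
  assumes "\<And>i. i \<in> I \<Longrightarrow> f i \<in> L2 M"
  shows "(\<lambda>x. \<Sum>i\<in>I. f i x) \<in> L2 M \<and> l2_norm M (\<lambda>x. \<Sum>i\<in>I. f i x) \<le> (\<Sum>i\<in>I. l2_norm M (f i))"
  using assms
proof (induction I rule: infinite_finite_induct)
  case (insert i I)
  then show ?case
    using L2_add[of "f i" M "\<lambda>x. \<Sum>i\<in>I. f i x"] by auto
qed auto

lemma l2_norm_eq_0_iff: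
  assumes "f \<in> L2 M"
  shows "l2_norm M f = 0 \<longleftrightarrow> (AE x in M. f x = 0)"
proof -
  have "integrable M (\<lambda>x. (cmod (f x))\<^sup>2)"
    using assms by (simp add: L2_def)
  then show ?thesis
    by (simp add: l2_norm_def integral_nonneg_eq_0_iff_AE)
qed

lemma l2_norm_cmod [simp]: "l2_norm M (\<lambda>x. complex_of_real (cmod (f x))) = l2_norm M f"
  by (simp add: l2_norm_def)

lemma L2_cmod [simp]: "f \<in> L2 M \<Longrightarrow> (\<lambda>x. complex_of_real (cmod (f x))) \<in> L2 M"
  by (auto simp: L2_def)

lemma integrable_mult_L2:
  assumes "f \<in> L2 M" "g \<in> L2 M"
  shows "integrable M (\<lambda>x. f x * cnj (g x))"
proof -
  have [measurable]: "f \<in> borel_measurable M" "g \<in> borel_measurable M"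
    using assms by (auto simp: L2_def)
  have "(\<integral>\<^sup>+x. ennreal (cmod (f x)) * ennreal (cmod (g x)) \<partial>M) < \<infinity>"
    using nn_integral_mult_L2[OF assms] le_less_trans by fastforce
  moreover have "(\<lambda>x. f x * cnj (g x)) \<in> borel_measurable M"
    by (intro borel_measurable_times measurable_compose[OF _ borel_measurable_continuous_onI[of cnj]])
       (auto intro!: continuous_intros)
  ultimately show ?thesis
    by (simp add: integrable_iff_bounded norm_mult ennreal_mult)
qed

lemma cmod_l2_inner_le:
  assumes "f \<in> L2 M" "g \<in> L2 M"
  shows "cmod (l2_inner M f g) \<le> l2_norm M f * l2_norm M g"
proof -
  have "ennreal (cmod (l2_inner M f g)) \<le> (\<integral>\<^sup>+x. ennreal (cmod (f x * cnj (g x))) \<partial>M)"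
    unfolding l2_inner_def by (intro integral_norm_bound_ennreal integrable_mult_L2 assms)
  also have "\<dots> \<le> ennreal (l2_norm M f * l2_norm M g)"
    using nn_integral_mult_L2[OF assms] by (simp add: norm_mult ennreal_mult)
  finally show ?thesis by simp
qed

lemma l2_inner_self: "l2_inner M f f = complex_of_real ((l2_norm M f)\<^sup>2)"
proof -
  have "l2_inner M f f = (LINT x|M. complex_of_real ((cmod (f x))\<^sup>2))"
    unfolding l2_inner_def
    by (intro Bochner_Integration.integral_cong refl) (rule complex_norm_square[symmetric])
  also have "\<dots> = complex_of_real (LINT x|M. (cmod (f x))\<^sup>2)"
    by (rule integral_complex_of_real)
  finally show ?thesis
    by (simp add: l2_norm_def)
qed

lemma l2_inner_diff_left:
  assumes "f \<in> L2 M" "g \<in> L2 M" "h \<in> L2 M"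
  shows "l2_inner M (\<lambda>x. f x - g x) h = l2_inner M f h - l2_inner M g h"
  using integrable_mult_L2[OF assms(1,3)] integrable_mult_L2[OF assms(2,3)]
  by (simp add: l2_inner_def left_diff_distrib)

section \<open>Linear and bounded operators, operator norm\<close>

lemma Sup0_nonneg: "bdd_above S \<Longrightarrow> 0 \<le> Sup0 S"
  unfolding Sup0_def by (rule cSup_upper) auto

lemma Sup0_upper: "bdd_above S \<Longrightarrow> x \<in> S \<Longrightarrow> x \<le> Sup0 S"
  unfolding Sup0_def by (rule cSup_upper) auto

lemma Sup0_least: "0 \<le> c \<Longrightarrow> (\<And>x. x \<in> S \<Longrightarrow> x \<le> c) \<Longrightarrow> Sup0 S \<le> c"
  unfolding Sup0_def by (rule cSup_least) auto

lemma linear_operatorD: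
  assumes "linear_operator M A"
  shows "f \<in> L2 M \<Longrightarrow> A f \<in> L2 M"
    and "f \<in> L2 M \<Longrightarrow> g \<in> L2 M \<Longrightarrow> AE x in M. f x = g x \<Longrightarrow> AE x in M. A f x = A g x"
    and "f \<in> L2 M \<Longrightarrow> g \<in> L2 M \<Longrightarrow> AE x in M. A (\<lambda>x. f x + g x) x = A f x + A g x"
    and "f \<in> L2 M \<Longrightarrow> AE x in M. A (\<lambda>x. c * f x) x = c * A f x"
  using assms unfolding linear_operator_def l2_eq_def by blast+

lemma linear_operator_diff:
  assumes A: "linear_operator M A" and f: "f \<in> L2 M" and g: "g \<in> L2 M"
  shows "AE x in M. A (\<lambda>x. f x - g x) x = A f x - A g x"
  using linear_operatorD(3)[OF A f L2_scale[OF g, of "-1"]] linear_operatorD(4)[OF A g, of "-1"]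
  by eventually_elim simp

lemma linear_operator_0:
  assumes "linear_operator M A"
  shows "AE x in M. A (\<lambda>x. 0) x = 0"
  using linear_operatorD(4)[OF assms L2_0, of 0] by simp

text \<open>The bound is carried along because \<open>Sup\<close> of an unbounded set of reals is
  unspecified, so \<open>op_norm\<close> is meaningful only in its presence.\<close>

definition bounded_operator :: "'a measure \<Rightarrow> 'a l2op \<Rightarrow> bool" where
  "bounded_operator M A \<longleftrightarrow> linear_operator M A \<and> (\<exists>C. \<forall>f\<in>L2 M. l2_norm M (A f) \<le> C * l2_norm M f)"

lemma op_norm_bdd:
  assumes "bounded_operator M A"
  shows "bdd_above {l2_norm M (A f) | f. f \<in> L2 M \<and> l2_norm M f \<le> 1}"
proof -
  obtain C where C: "\<And>f. f \<in> L2 M \<Longrightarrow> l2_norm M (A f) \<le> C * l2_norm M f"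
    using assms unfolding bounded_operator_def by blast
  have "l2_norm M (A f) \<le> \<bar>C\<bar>" if "f \<in> L2 M" "l2_norm M f \<le> 1" for f
  proof -
    have "l2_norm M (A f) \<le> \<bar>C\<bar> * l2_norm M f"
      using C[OF that(1)] mult_right_mono[of C "\<bar>C\<bar>" "l2_norm M f"] by fastforce
    also have "\<dots> \<le> \<bar>C\<bar>"
      using that(2) mult_left_le by fastforce
    finally show ?thesis .
  qed
  then show ?thesis
    by (auto intro!: bdd_aboveI)
qed

lemma op_norm_nonneg: "bounded_operator M A \<Longrightarrow> 0 \<le> op_norm M A"
  unfolding op_norm_def by (intro Sup0_nonneg op_norm_bdd)

lemma op_norm_bound:
  assumes A: "bounded_operator M A" and f: "f \<in> L2 M"
  shows "l2_norm M (A f) \<le> op_norm M A * l2_norm M f"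
proof (cases "l2_norm M f = 0")
  \<comment> \<open>A null function cannot be normalized; compatibility of \<open>A\<close> with
    a.e. equality sends it to the class of zero instead.\<close>
  case True
  have lin: "linear_operator M A"
    using A by (simp add: bounded_operator_def)
  from True have "AE x in M. f x = 0"
    using f by (simp add: l2_norm_eq_0_iff)
  then have "AE x in M. A f x = A (\<lambda>x. 0) x"
    by (intro linear_operatorD(2)[OF lin f]) auto
  with linear_operator_0[OF lin] have "AE x in M. A f x = 0"
    by eventually_elim simp
  then have "l2_norm M (A f) = 0"
    using linear_operatorD(1)[OF lin f] by (simp add: l2_norm_eq_0_iff)
  with True show ?thesis by simp
next
  case False
  then have pos: "l2_norm M f > 0"
    using l2_norm_nonneg[of M f] by linarith
  have lin: "linear_operator M A"
    using A by (simp add: bounded_operator_def)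
  let ?c = "complex_of_real (1 / l2_norm M f)"
  have L: "(\<lambda>x. ?c * f x) \<in> L2 M"
    by (rule L2_scale[OF f])
  have n: "l2_norm M (\<lambda>x. ?c * f x) = 1"
    using pos by (simp only: l2_norm_scale) (simp add: norm_divide)
  have "l2_norm M (A (\<lambda>x. ?c * f x)) \<le> op_norm M A"
    unfolding op_norm_def by (intro Sup0_upper op_norm_bdd A) (use L n in auto)
  moreover have "l2_norm M (A (\<lambda>x. ?c * f x)) = l2_norm M (\<lambda>x. ?c * A f x)"
    using linear_operatorD(1)[OF lin L] linear_operatorD(1)[OF lin f]
    by (intro l2_norm_cong_AE linear_operatorD(4)[OF lin f]) (auto simp: L2_def)
  moreover have "l2_norm M (\<lambda>x. ?c * A f x) = l2_norm M (A f) / l2_norm M f"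
    using pos by (simp only: l2_norm_scale) (simp add: norm_divide)
  ultimately have "l2_norm M (A f) / l2_norm M f \<le> op_norm M A"
    by metis
  then show ?thesis
    using pos by (simp add: field_simps)
qed

lemma op_norm_least:
  assumes "0 \<le> C" "\<And>f. f \<in> L2 M \<Longrightarrow> l2_norm M f \<le> 1 \<Longrightarrow> l2_norm M (A f) \<le> C"
  shows "op_norm M A \<le> C"
  unfolding op_norm_def by (rule Sup0_least) (use assms in auto)

lemma op_norm_least':
  assumes C: "0 \<le> C" and le: "\<And>f. f \<in> L2 M \<Longrightarrow> l2_norm M (A f) \<le> C * l2_norm M f"
  shows "op_norm M A \<le> C"
  using le C by (intro op_norm_least) (force intro: order_trans mult_left_le)+

lemma linear_operator_add:
  assumes A: "linear_operator M A" and B: "linear_operator M B"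
  shows "linear_operator M (\<lambda>f x. A f x + B f x)"
  unfolding linear_operator_def l2_eq_def
proof (intro conjI ballI allI impI)
  fix f g assume f: "f \<in> L2 M" and g: "g \<in> L2 M"
  show "AE x in M. A f x + B f x = A g x + B g x" if "AE x in M. f x = g x"
    using linear_operatorD(2)[OF A f g that] linear_operatorD(2)[OF B f g that] by eventually_elim simp
  show "AE x in M. A (\<lambda>x. f x + g x) x + B (\<lambda>x. f x + g x) x = A f x + B f x + (A g x + B g x)"
    using linear_operatorD(3)[OF A f g] linear_operatorD(3)[OF B f g] by eventually_elim simp
next
  fix c f assume f: "f \<in> L2 M"
  show "AE x in M. A (\<lambda>x. c * f x) x + B (\<lambda>x. c * f x) x = c * (A f x + B f x)"
    using linear_operatorD(4)[OF A f, of c] linear_operatorD(4)[OF B f, of c]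
    by eventually_elim (simp add: algebra_simps)
qed (simp add: L2_add linear_operatorD(1) A B)

lemma linear_operator_scale:
  assumes A: "linear_operator M A"
  shows "linear_operator M (\<lambda>f x. d * A f x)"
  unfolding linear_operator_def l2_eq_def
proof (intro conjI ballI allI impI)
  fix f g assume f: "f \<in> L2 M" and g: "g \<in> L2 M"
  show "AE x in M. d * A f x = d * A g x" if "AE x in M. f x = g x"
    using linear_operatorD(2)[OF A f g that] by eventually_elim simp
  show "AE x in M. d * A (\<lambda>x. f x + g x) x = d * A f x + d * A g x"
    using linear_operatorD(3)[OF A f g] by eventually_elim (simp add: algebra_simps)
next
  fix c f assume f: "f \<in> L2 M"
  show "AE x in M. d * A (\<lambda>x. c * f x) x = c * (d * A f x)"
    using linear_operatorD(4)[OF A f, of c] by eventually_elim simp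
qed (simp add: L2_scale linear_operatorD(1) A)

lemma linear_operator_comp:
  assumes A: "linear_operator M A" and B: "linear_operator M B"
  shows "linear_operator M (A \<circ> B)"
  unfolding linear_operator_def l2_eq_def comp_def
proof (intro conjI ballI allI impI)
  fix f g assume f: "f \<in> L2 M" and g: "g \<in> L2 M"
  note Bf = linear_operatorD(1)[OF B f] and Bg = linear_operatorD(1)[OF B g]
  show "AE x in M. A (B f) x = A (B g) x" if "AE x in M. f x = g x"
    by (rule linear_operatorD(2)[OF A Bf Bg linear_operatorD(2)[OF B f g that]])
  show "AE x in M. A (B (\<lambda>x. f x + g x)) x = A (B f) x + A (B g) x"
    using linear_operatorD(2)[OF A linear_operatorD(1)[OF B L2_add(1)[OF f g]] L2_add(1)[OF Bf Bg]
        linear_operatorD(3)[OF B f g]] linear_operatorD(3)[OF A Bf Bg] by eventually_elim simp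
next
  fix c f assume f: "f \<in> L2 M"
  note Bf = linear_operatorD(1)[OF B f]
  show "AE x in M. A (B (\<lambda>x. c * f x)) x = c * A (B f) x"
    using linear_operatorD(2)[OF A linear_operatorD(1)[OF B L2_scale[OF f]] L2_scale[OF Bf]
        linear_operatorD(4)[OF B f, of c]] linear_operatorD(4)[OF A Bf, of c] by eventually_elim simp
qed (simp add: linear_operatorD(1) A B)

lemma linear_operator_id: "linear_operator M id"
  by (simp add: linear_operator_def l2_eq_def)

lemma linear_operator_zero: "linear_operator M (\<lambda>f x. 0)"
  by (simp add: linear_operator_def l2_eq_def)

lemma bounded_operator_linear: "bounded_operator M A \<Longrightarrow> linear_operator M A"
  by (simp add: bounded_operator_def)

lemma bounded_operator_L2: "bounded_operator M A \<Longrightarrow> f \<in> L2 M \<Longrightarrow> A f \<in> L2 M"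
  by (simp add: bounded_operator_def linear_operatorD(1))

lemma bounded_operatorI:
  "linear_operator M A \<Longrightarrow> (\<And>f. f \<in> L2 M \<Longrightarrow> l2_norm M (A f) \<le> C * l2_norm M f) \<Longrightarrow> bounded_operator M A"
  unfolding bounded_operator_def by blast

lemma bounded_operator_id: "bounded_operator M id"
  by (rule bounded_operatorI[of _ _ 1]) (simp_all add: linear_operator_id)

lemma op_norm_comp_bound:
  assumes A: "bounded_operator M A" and B: "bounded_operator M B" and f: "f \<in> L2 M"
  shows "l2_norm M ((A \<circ> B) f) \<le> op_norm M A * op_norm M B * l2_norm M f"
proof -
  have "l2_norm M ((A \<circ> B) f) \<le> op_norm M A * l2_norm M (B f)"
    using op_norm_bound[OF A bounded_operator_L2[OF B f]] by simp
  also have "\<dots> \<le> op_norm M A * (op_norm M B * l2_norm M f)"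
    by (intro mult_left_mono op_norm_bound op_norm_nonneg A B f)
  finally show ?thesis by (simp add: mult.assoc)
qed

lemma bounded_operator_comp:
  assumes A: "bounded_operator M A" and B: "bounded_operator M B"
  shows "bounded_operator M (A \<circ> B)"
  by (rule bounded_operatorI[OF linear_operator_comp op_norm_comp_bound[OF A B]])
     (use A B in \<open>auto simp: bounded_operator_linear\<close>)

lemma op_norm_comp:
  assumes A: "bounded_operator M A" and B: "bounded_operator M B"
  shows "op_norm M (A \<circ> B) \<le> op_norm M A * op_norm M B"
  by (intro op_norm_least' op_norm_comp_bound A B mult_nonneg_nonneg op_norm_nonneg)

lemma op_norm_add_bound:
  assumes A: "bounded_operator M A" and B: "bounded_operator M B" and f: "f \<in> L2 M"
  shows "l2_norm M (\<lambda>x. A f x + B f x) \<le> (op_norm M A + op_norm M B) * l2_norm M f"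
  using L2_add(2)[OF bounded_operator_L2[OF A f] bounded_operator_L2[OF B f]]
    op_norm_bound[OF A f] op_norm_bound[OF B f]
  by (simp add: algebra_simps)

lemma bounded_operator_add:
  assumes A: "bounded_operator M A" and B: "bounded_operator M B"
  shows "bounded_operator M (\<lambda>f x. A f x + B f x)"
  by (rule bounded_operatorI[OF linear_operator_add op_norm_add_bound[OF A B]])
     (use A B in \<open>auto simp: bounded_operator_linear\<close>)

lemma bounded_operator_scale:
  assumes A: "bounded_operator M A"
  shows "bounded_operator M (\<lambda>f x. c * A f x)"
proof (rule bounded_operatorI[OF linear_operator_scale])
  fix f assume "f \<in> L2 M"
  then show "l2_norm M (\<lambda>x. c * A f x) \<le> (cmod c * op_norm M A) * l2_norm M f"
    using op_norm_bound[OF A] by (simp add: l2_norm_scale mult.assoc mult_left_mono)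
qed (use A in \<open>simp add: bounded_operator_linear\<close>)

lemma bounded_operator_diff:
  assumes A: "bounded_operator M A" and B: "bounded_operator M B"
  shows "bounded_operator M (\<lambda>f x. A f x - B f x)"
  using bounded_operator_add[OF A bounded_operator_scale[OF B, of "-1"]] by simp

lemma bounded_operator_funpow: "bounded_operator M A \<Longrightarrow> bounded_operator M (A ^^ n)"
  by (induction n) (simp_all add: bounded_operator_id bounded_operator_comp)

section \<open>Neumann series\<close>

lemma linear_operator_sum:
  assumes A: "linear_operator M A" and f: "\<And>i. i < (n::nat) \<Longrightarrow> f i \<in> L2 M"
  shows "AE x in M. A (\<lambda>x. \<Sum>i<n. c i * f i x) x = (\<Sum>i<n. c i * A (f i) x)"
  using f
proof (induction n)
  case 0
  then show ?case using linear_operator_0[OF A] by simp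
next
  case (Suc n)
  have 1: "(\<lambda>x. \<Sum>i<n. c i * f i x) \<in> L2 M" "(\<lambda>x. c n * f n x) \<in> L2 M"
    using L2_sum[of "{..<n}" "\<lambda>i x. c i * f i x" M] Suc.prems by (simp_all add: L2_scale)
  have "AE x in M. A (\<lambda>x. \<Sum>i<n. c i * f i x) x = (\<Sum>i<n. c i * A (f i) x)"
    using Suc by simp
  with linear_operatorD(3)[OF A 1] linear_operatorD(4)[OF A Suc.prems[of n, simplified], of "c n"]
  show ?case
    by eventually_elim simp
qed

text \<open>The argument behind completeness of the space: Minkowski bounds the partial sums of the
  moduli, monotone convergence applied to their squares makes the supremum \<open>H\<close>
  integrable, and where \<open>H\<close> is finite the series converges absolutely with its squared
  sum below \<open>H\<close>.\<close>

lemma L2_series: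
  assumes f: "\<And>n. f n \<in> L2 M" and sm: "summable (\<lambda>n. l2_norm M (f n))"
  shows "AE x in M. summable (\<lambda>n. cmod (f n x))"
    and "(\<lambda>x. \<Sum>n. f n x) \<in> L2 M"
    and "l2_norm M (\<lambda>x. \<Sum>n. f n x) \<le> (\<Sum>n. l2_norm M (f n))"
proof -
  have [measurable]: "\<And>n. f n \<in> borel_measurable M"
    using f by (simp add: L2_def)
  define C where "C = (\<Sum>n. l2_norm M (f n))"
  have C0: "0 \<le> C"
    unfolding C_def by (intro suminf_nonneg sm) auto
  define S where "S N x = (\<Sum>n<N. cmod (f n x))" for N x
  have S0: "0 \<le> S N x" for N x
    unfolding S_def by (intro sum_nonneg) auto
  have [measurable]: "S N \<in> borel_measurable M" for N
    unfolding S_def by measurable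
  define H where "H x = (SUP N. ennreal ((S N x)\<^sup>2))" for x
  have [measurable]: "H \<in> borel_measurable M"
    unfolding H_def by measurable
  have Sle: "(\<integral>\<^sup>+x. ennreal ((S N x)\<^sup>2) \<partial>M) \<le> ennreal (C\<^sup>2)" for N
  proof -
    have *: "(\<lambda>x. \<Sum>n<N. complex_of_real (cmod (f n x))) \<in> L2 M"
      "l2_norm M (\<lambda>x. \<Sum>n<N. complex_of_real (cmod (f n x))) \<le> (\<Sum>n<N. l2_norm M (f n))"
      using L2_sum[of "{..<N}" "\<lambda>n x. complex_of_real (cmod (f n x))" M] f by auto
    have eq: "cmod (\<Sum>n<N. complex_of_real (cmod (f n x))) = S N x" for x
      unfolding of_real_sum[symmetric] norm_of_real S_def[symmetric] using S0 by simp
    have "(\<Sum>n<N. l2_norm M (f n)) \<le> C"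
      unfolding C_def by (intro sum_le_suminf sm) auto
    then have "(l2_norm M (\<lambda>x. \<Sum>n<N. complex_of_real (cmod (f n x))))\<^sup>2 \<le> C\<^sup>2"
      using * by (intro power_mono) auto
    then show ?thesis
      using nn_integral_L2[OF *(1)] by (simp add: eq ennreal_power S0 ennreal_leI)
  qed
  have incS: "S N x \<le> S N' x" if "N \<le> N'" for N N' x
    unfolding S_def using that by (intro sum_mono2) auto
  have "(\<integral>\<^sup>+x. H x \<partial>M) = (SUP N. \<integral>\<^sup>+x. ennreal ((S N x)\<^sup>2) \<partial>M)"
    unfolding H_def
    by (intro nn_integral_monotone_convergence_SUP)
       (auto simp: incseq_def le_fun_def intro!: ennreal_leI power_mono incS S0)
  also have "\<dots> \<le> ennreal (C\<^sup>2)"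
    by (intro SUP_least Sle)
  finally have H: "(\<integral>\<^sup>+x. H x \<partial>M) \<le> ennreal (C\<^sup>2)" .
  then have "(\<integral>\<^sup>+x. H x \<partial>M) \<noteq> \<infinity>"
    by (auto simp: top_unique)
  then have AEH: "AE x in M. H x \<noteq> \<infinity>"
    by (intro nn_integral_noteq_infinite) auto
  have key: "summable (\<lambda>n. cmod (f n x)) \<and> ennreal ((cmod (\<Sum>n. f n x))\<^sup>2) \<le> H x" if fin: "H x \<noteq> \<infinity>" for x
  proof -
    obtain h where h: "0 \<le> h" "H x = ennreal h"
      using fin by (cases "H x") auto
    have le: "(S N x)\<^sup>2 \<le> h" for N
    proof -
      have "ennreal ((S N x)\<^sup>2) \<le> H x"
        unfolding H_def by (rule SUP_upper) simp
      then show ?thesis using h by simp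
    qed
    then have "S N x \<le> sqrt h" for N
      using S0 real_le_rsqrt by blast
    then have s: "summable (\<lambda>n. cmod (f n x))"
      unfolding S_def by (intro summableI_nonneg_bounded[of _ "sqrt h"]) simp_all
    have "(\<lambda>N. (cmod (\<Sum>n<N. f n x))\<^sup>2) \<longlonglongrightarrow> (cmod (\<Sum>n. f n x))\<^sup>2"
      by (intro tendsto_intros summable_LIMSEQ summable_norm_cancel[OF s])
    moreover have "(cmod (\<Sum>n<N. f n x))\<^sup>2 \<le> h" for N
    proof -
      have "cmod (\<Sum>n<N. f n x) \<le> S N x"
        unfolding S_def by (rule norm_sum)
      then have "(cmod (\<Sum>n<N. f n x))\<^sup>2 \<le> (S N x)\<^sup>2"
        by (intro power_mono) auto
      then show ?thesis using le[of N] by linarith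
    qed
    ultimately have "(cmod (\<Sum>n. f n x))\<^sup>2 \<le> h"
      by (intro LIMSEQ_le_const2) auto
    then show ?thesis using s h by (simp add: ennreal_leI)
  qed
  show "AE x in M. summable (\<lambda>n. cmod (f n x))"
    using AEH by eventually_elim (use key in blast)
  have "(\<integral>\<^sup>+x. (ennreal (cmod (\<Sum>n. f n x)))\<^sup>2 \<partial>M) \<le> (\<integral>\<^sup>+x. H x \<partial>M)"
    using AEH by (intro nn_integral_mono_AE) (auto simp: ennreal_power key elim!: eventually_mono)
  with H have le: "(\<integral>\<^sup>+x. (ennreal (cmod (\<Sum>n. f n x)))\<^sup>2 \<partial>M) \<le> ennreal (C\<^sup>2)"
    by simp
  then show L: "(\<lambda>x. \<Sum>n. f n x) \<in> L2 M"
    unfolding L2_iff_nn by (auto intro: le_less_trans)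
  have "(l2_norm M (\<lambda>x. \<Sum>n. f n x))\<^sup>2 \<le> C\<^sup>2"
    using le by (simp add: nn_integral_L2[OF L])
  then show "l2_norm M (\<lambda>x. \<Sum>n. f n x) \<le> (\<Sum>n. l2_norm M (f n))"
    using C0 unfolding C_def by (rule power2_le_imp_le)
qed

text \<open>\<open>R\<close> is the inverse of z - A on the quotient space, on both sides and up to
  null sets.\<close>

definition resolvent_at :: "'a measure \<Rightarrow> 'a l2op \<Rightarrow> complex \<Rightarrow> 'a l2op \<Rightarrow> bool" where
  "resolvent_at M A z R \<longleftrightarrow> bounded_operator M R \<and>
     (\<forall>f\<in>L2 M. (AE x in M. R (\<lambda>x. z * f x - A f x) x = f x) \<and> (AE x in M. z * R f x - A (R f) x = f x))"

lemma not_in_l2_spectrum_iff: "z \<notin> l2_spectrum M A \<longleftrightarrow> (\<exists>R. resolvent_at M A z R)"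
  by (simp add: l2_spectrum_def resolvent_at_def bounded_operator_def bounded_operators_def l2_eq_def)

text \<open>The inverse is the pointwise sum of the terms \<open>A ^^ n\<close> applied to
  \<open>f\<close> and divided by z^(n+1). As a left inverse it telescopes termwise almost
  everywhere. As a right inverse it cannot be treated so, since \<open>A\<close> acts on classes of
  functions and need not commute with a pointwise infinite sum; there the defect is estimated in
  norm.\<close>

lemma neumann_series:
  assumes A: "bounded_operator M A" and z: "z \<noteq> 0"
    and sm: "summable (\<lambda>n. op_norm M (A ^^ n) / cmod z ^ Suc n)"
  shows "z \<notin> l2_spectrum M A"
proof -
  note An = bounded_operator_funpow[OF A]
  note lin = bounded_operator_linear[OF A] and linn = bounded_operator_linear[OF An]
  define a where "a n f x = inverse (z ^ Suc n) * (A ^^ n) f x" for n f x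
  define c where "c n = op_norm M (A ^^ n) / cmod z ^ Suc n" for n
  have smc: "summable c"
    using sm by (simp add: c_def[abs_def])
  have aL: "a n f \<in> L2 M" if "f \<in> L2 M" for n f
    unfolding a_def by (rule L2_scale[OF bounded_operator_L2[OF An that]])
  have an: "l2_norm M (a n f) \<le> c n * l2_norm M f" if "f \<in> L2 M" for n f
  proof -
    have "l2_norm M (a n f) = l2_norm M ((A ^^ n) f) / cmod z ^ Suc n"
      unfolding a_def[abs_def] l2_norm_scale norm_inverse norm_power by (simp add: divide_inverse mult.commute)
    also have "\<dots> \<le> op_norm M (A ^^ n) * l2_norm M f / cmod z ^ Suc n"
      by (intro divide_right_mono op_norm_bound An that) simp
    finally show ?thesis by (simp add: c_def)
  qed
  have sm1: "summable (\<lambda>n. c n * l2_norm M f)" for f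
    using sm unfolding c_def by (rule summable_mult2)
  have sm2: "summable (\<lambda>n. l2_norm M (a n f))" if "f \<in> L2 M" for f
    by (rule summable_comparison_test[OF _ sm1[of f]]) (use an that in auto)
  define R where "R f x = (\<Sum>n. a n f x)" for f x
  have RL: "R f \<in> L2 M" if "f \<in> L2 M" for f
    unfolding R_def by (rule L2_series(2)[OF aL[OF that] sm2[OF that]])
  have Rs: "AE x in M. summable (\<lambda>n. a n f x)" if "f \<in> L2 M" for f
    using L2_series(1)[OF aL[OF that] sm2[OF that]] by eventually_elim (rule summable_norm_cancel)
  have Rb: "l2_norm M (R f) \<le> (\<Sum>n. c n) * l2_norm M f" if "f \<in> L2 M" for f
  proof -
    have "l2_norm M (R f) \<le> (\<Sum>n. l2_norm M (a n f))"
      unfolding R_def by (rule L2_series(3)[OF aL[OF that] sm2[OF that]])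
    also have "\<dots> \<le> (\<Sum>n. c n * l2_norm M f)"
      using that by (intro suminf_le an sm1 sm2) auto
    also have "\<dots> = (\<Sum>n. c n) * l2_norm M f"
      using sm by (intro suminf_mult2[symmetric]) (simp add: c_def)
    finally show ?thesis .
  qed
  have linR: "linear_operator M R"
    unfolding linear_operator_def l2_eq_def
  proof (intro conjI ballI allI impI)
    fix f g assume f: "f \<in> L2 M" and g: "g \<in> L2 M"
    show "AE x in M. R f x = R g x" if "AE x in M. f x = g x"
    proof -
      have "AE x in M. \<forall>n. (A ^^ n) f x = (A ^^ n) g x"
        using linear_operatorD(2)[OF linn f g that] by (simp add: AE_all_countable)
      then show ?thesis
        by eventually_elim (simp add: R_def a_def)
    qed
    have "AE x in M. \<forall>n. (A ^^ n) (\<lambda>x. f x + g x) x = (A ^^ n) f x + (A ^^ n) g x"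
      using linear_operatorD(3)[OF linn f g] by (simp add: AE_all_countable)
    then show "AE x in M. R (\<lambda>x. f x + g x) x = R f x + R g x"
      using Rs[OF f] Rs[OF g]
      by eventually_elim (simp add: R_def a_def distrib_left suminf_add)
  next
    fix w f assume f: "f \<in> L2 M"
    have "AE x in M. \<forall>n. (A ^^ n) (\<lambda>x. w * f x) x = w * (A ^^ n) f x"
      using linear_operatorD(4)[OF linn f, where c = w] by (simp add: AE_all_countable)
    then show "AE x in M. R (\<lambda>x. w * f x) x = w * R f x"
      using Rs[OF f]
    proof eventually_elim
      case (elim x)
      then show ?case
        using suminf_mult[of "\<lambda>n. a n f x" w] by (simp add: R_def a_def mult.left_commute)
    qed
  qed (rule RL)
  have bR: "bounded_operator M R"
    by (rule bounded_operatorI[OF linR Rb])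
  have left: "AE x in M. R (\<lambda>x. z * f x - A f x) x = f x" if f: "f \<in> L2 M" for f
  proof -
    have Af: "A f \<in> L2 M"
      by (rule bounded_operator_L2[OF A f])
    have "AE x in M. \<forall>n. (A ^^ n) (\<lambda>x. z * f x - A f x) x = z * (A ^^ n) f x - (A ^^ n) (A f) x"
      unfolding AE_all_countable
    proof
      fix n
      show "AE x in M. (A ^^ n) (\<lambda>x. z * f x - A f x) x = z * (A ^^ n) f x - (A ^^ n) (A f) x"
        using linear_operator_diff[OF linn L2_scale[OF f] Af, of n z] linear_operatorD(4)[OF linn f, of n z]
        by eventually_elim simp
    qed
    then show ?thesis
      using Rs[OF f]
    proof eventually_elim
      case (elim x)
      let ?b = "\<lambda>n. z * a n f x"
      have "?b \<longlonglongrightarrow> z * 0"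
        by (intro tendsto_mult tendsto_const summable_LIMSEQ_zero elim)
      then have "(\<lambda>n. ?b n - ?b (Suc n)) sums (?b 0 - z * 0)"
        by (rule telescope_sums')
      moreover have "?b n - ?b (Suc n) = a n (\<lambda>x. z * f x - A f x) x" for n
        using z elim(1)[rule_format, of n]
        by (simp add: a_def field_simps funpow_swap1[of A n f])
      moreover have "?b 0 = f x"
        using z by (simp add: a_def)
      ultimately show ?case
        by (simp add: R_def sums_iff)
    qed
  qed
  have right: "AE x in M. z * R f x - A (R f) x = f x" if f: "f \<in> L2 M" for f
  proof -
    define S where "S N x = (\<Sum>n<N. a n f x)" for N x
    have SL: "S N \<in> L2 M" for N
      unfolding S_def using L2_sum[of "{..<N}" "\<lambda>n. a n f" M] aL[OF f] by simp
    define h where "h x = z * R f x - A (R f) x - f x" for x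
    have ARL: "A (R f) \<in> L2 M" and hL: "h \<in> L2 M"
      unfolding h_def by (intro L2_diff L2_scale RL f bounded_operator_L2[OF A])+
    define t where "t N = (\<Sum>n. c (n + N)) * l2_norm M f" for N
    have tail: "l2_norm M (\<lambda>x. R f x - S N x) \<le> t N" for N
    proof -
      have "AE x in M. R f x - S N x = (\<Sum>n. a (n + N) f x)"
        using Rs[OF f]
      proof eventually_elim
        case (elim x)
        then show ?case
          using suminf_minus_initial_segment[of "\<lambda>n. a n f x" N] by (simp add: R_def S_def)
      qed
      moreover have sN: "summable (\<lambda>n. l2_norm M (a (n + N) f))"
        using sm2[OF f] by (simp add: summable_iff_shift[of "\<lambda>n. l2_norm M (a n f)"])
      moreover have "(\<lambda>x. (\<Sum>n. a (n + N) f x)) \<in> L2 M"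
        by (rule L2_series(2)[OF aL[OF f] sN])
      ultimately have "l2_norm M (\<lambda>x. R f x - S N x) = l2_norm M (\<lambda>x. \<Sum>n. a (n + N) f x)"
        using L2_diff(1)[OF RL[OF f] SL] by (intro l2_norm_cong_AE) (auto simp: L2_def)
      also have "\<dots> \<le> (\<Sum>n. l2_norm M (a (n + N) f))"
        by (rule L2_series(3)[OF aL[OF f] sN])
      also have "\<dots> \<le> (\<Sum>n. c (n + N) * l2_norm M f)"
        using sm1[of f] by (intro suminf_le an f sN) (simp add: summable_iff_shift[of "\<lambda>n. c n * l2_norm M f"])
      also have "\<dots> = t N"
        unfolding t_def using smc by (intro suminf_mult2[symmetric]) (simp add: summable_iff_shift[of c])
      finally show ?thesis .
    qed
    have hb: "l2_norm M h \<le> cmod z * t N + op_norm M A * t N + cmod z * (c N * l2_norm M f)" for N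
    proof -
      have AS: "A (S N) \<in> L2 M"
        by (rule bounded_operator_L2[OF A SL])
      have "AE x in M. A (S N) x = (\<Sum>n<N. inverse (z ^ Suc n) * A ((A ^^ n) f) x)"
        using linear_operator_sum[OF lin, of N "\<lambda>n. (A ^^ n) f" "\<lambda>n. inverse (z ^ Suc n)"]
          bounded_operator_L2[OF An f] by (simp add: S_def[abs_def] a_def)
      \<comment> \<open>The defect \<open>h\<close> splits into the tail of the series, the image of
        the tail under \<open>A\<close>, and the last term left by telescoping the finite sum. All
        three tend to zero in norm, while \<open>h\<close> does not depend on
        \<open>N\<close>.\<close>
      then have "AE x in M. h x = (z * (R f x - S N x) + - (A (R f) x - A (S N) x)) + - (z * a N f x)"
      proof eventually_elim
        case (elim x)
        have tel: "z * S k x - (\<Sum>n<k. inverse (z ^ Suc n) * A ((A ^^ n) f) x) = f x - z * a k f x" for k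
        proof (induction k)
          case 0
          then show ?case using z by (simp add: S_def a_def)
        next
          case (Suc k)
          have "z * S (Suc k) x - (\<Sum>n<Suc k. inverse (z ^ Suc n) * A ((A ^^ n) f) x)
              = (f x - z * a k f x) + z * a k f x - inverse (z ^ Suc k) * A ((A ^^ k) f) x"
            using Suc by (simp add: S_def algebra_simps)
          also have "\<dots> = f x - z * a (Suc k) f x"
            using z by (simp add: a_def)
          finally show ?case .
        qed
        show ?case
          using tel[of N] elim by (simp add: h_def algebra_simps)
      qed
      then have "l2_norm M h = l2_norm M (\<lambda>x. (z * (R f x - S N x) + - (A (R f) x - A (S N) x)) + - (z * a N f x))"
        by (intro l2_norm_cong_AE)
           (use hL L2_add(1)[OF L2_add(1)[OF L2_scale[OF L2_diff(1)[OF RL[OF f] SL], of z N] L2_uminus[OF L2_diff(1)[OF ARL AS]]]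
              L2_uminus[OF L2_scale[OF aL[OF f], of z N]]] in \<open>simp_all add: L2_def\<close>)
      also have "\<dots> \<le> l2_norm M (\<lambda>x. z * (R f x - S N x) + - (A (R f) x - A (S N) x)) + l2_norm M (\<lambda>x. - (z * a N f x))"
        by (intro L2_add L2_uminus L2_scale L2_diff RL ARL AS SL aL f)
      also have "l2_norm M (\<lambda>x. z * (R f x - S N x) + - (A (R f) x - A (S N) x))
          \<le> l2_norm M (\<lambda>x. z * (R f x - S N x)) + l2_norm M (\<lambda>x. - (A (R f) x - A (S N) x))"
        by (intro L2_add L2_uminus L2_scale L2_diff RL ARL AS SL f)
      also have "l2_norm M (\<lambda>x. - (A (R f) x - A (S N) x)) = l2_norm M (A (\<lambda>x. R f x - S N x))"
        unfolding l2_norm_uminus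
        using linear_operator_diff[OF lin RL[OF f] SL[of N]] L2_diff(1)[OF ARL AS]
          bounded_operator_L2[OF A L2_diff(1)[OF RL[OF f] SL[of N]]]
        by (intro l2_norm_cong_AE) (auto simp: L2_def elim!: eventually_mono)
      also have "\<dots> \<le> op_norm M A * l2_norm M (\<lambda>x. R f x - S N x)"
        by (intro op_norm_bound A L2_diff RL SL f)
      also have "\<dots> \<le> op_norm M A * t N"
        by (intro mult_left_mono tail op_norm_nonneg A)
      also have "l2_norm M (\<lambda>x. z * (R f x - S N x)) \<le> cmod z * t N"
        unfolding l2_norm_scale by (intro mult_left_mono tail) simp
      also have "l2_norm M (\<lambda>x. - (z * a N f x)) \<le> cmod z * (c N * l2_norm M f)"
        unfolding l2_norm_uminus l2_norm_scale by (intro mult_left_mono an f) simp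
      finally show ?thesis by simp
    qed
    have "(\<lambda>N. cmod z * t N + op_norm M A * t N + cmod z * (c N * l2_norm M f))
        \<longlonglongrightarrow> cmod z * (0 * l2_norm M f) + op_norm M A * (0 * l2_norm M f) + cmod z * (0 * l2_norm M f)"
      unfolding t_def by (intro tendsto_intros suminf_exist_split2 summable_LIMSEQ_zero smc)
    then have "l2_norm M h \<le> cmod z * (0 * l2_norm M f) + op_norm M A * (0 * l2_norm M f) + cmod z * (0 * l2_norm M f)"
      by (rule LIMSEQ_le_const) (use hb in auto)
    then have "l2_norm M h = 0"
      using l2_norm_nonneg[of M h] by simp
    then have "AE x in M. h x = 0"
      using l2_norm_eq_0_iff[OF hL] by simp
    then show ?thesis
      by eventually_elim (simp add: h_def)
  qed
  show ?thesis
    unfolding not_in_l2_spectrum_iff resolvent_at_def using bR left right by blast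
qed

section \<open>Joint radii and the measure of noncompactness\<close>

text \<open>Fekete's lemma in multiplicative form; the limit is the infimum over positive indices.
  Roots in place of logarithms admit sequences with zero entries.\<close>

lemma fekete_root:
  fixes a :: "nat \<Rightarrow> real"
  assumes nonneg: "\<And>n. 0 \<le> a n" and sub: "\<And>m n. a (m + n) \<le> a m * a n"
  shows "convergent (\<lambda>n. root n (a n))"
proof -
  \<comment> \<open>Index 0 is left out: \<open>root 0\<close> is constantly 0 and would falsify the
    infimum.\<close>
  define S where "S = (\<lambda>n. root n (a n)) ` {1..}"
  have bdd: "bdd_below S"
    unfolding S_def by (rule bdd_belowI[of _ 0]) (use nonneg in auto)
  have ne: "S \<noteq> {}"
    by (auto simp: S_def)
  define L where "L = Inf S"
  have low: "L \<le> root n (a n)" if "n \<ge> 1" for n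
    unfolding L_def using that by (intro cInf_lower bdd) (auto simp: S_def)
  have "0 \<le> L"
    unfolding L_def using ne by (rule cInf_greatest) (use nonneg in \<open>auto simp: S_def\<close>)
  have "(\<lambda>n. root n (a n)) \<longlonglongrightarrow> L"
  proof (rule LIMSEQ_I)
    fix e :: real assume e: "0 < e"
    have "Inf S < L + e / 2"
      using e by (simp add: L_def)
    then obtain m where m: "m \<ge> 1" "root m (a m) < L + e / 2"
      using ne bdd by (auto simp: cInf_less_iff S_def)
    define b where "b = L + e / 2"
    have b: "0 < b"
      using e \<open>0 \<le> L\<close> by (simp add: b_def)
    have am: "a m \<le> b ^ m"
    proof -
      have "root m (a m) ^ m \<le> b ^ m"
        using m nonneg by (intro power_mono) (auto simp: b_def)
      then show ?thesis
        using m nonneg by (simp add: real_root_pow_pos2)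
    qed
    \<comment> \<open>\<open>K\<close> absorbs the factor left by any remainder \<open>r\<close> of
      the division by \<open>m\<close>. The summand 1 keeps it positive, so that its n-th root tends
      to 1.\<close>
    define K where "K = 1 + (\<Sum>r<m. a r / b ^ r)"
    have K1: "K \<ge> 1"
      unfolding K_def using nonneg b by (simp add: sum_nonneg)
    have amq: "a (q * m + r) \<le> b ^ (q * m) * a r" for q r
    proof (induction q)
      case (Suc q)
      have "a (Suc q * m + r) \<le> a m * a (q * m + r)"
        using sub[of m "q * m + r"] by (simp add: add.assoc)
      also have "\<dots> \<le> b ^ m * (b ^ (q * m) * a r)"
        using am Suc nonneg b by (intro mult_mono) auto
      finally show ?case by (simp add: power_add mult.assoc)
    qed simp
    have an: "a n \<le> K * b ^ n" for n
    proof -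
      define q r where "q = n div m" and "r = n mod m"
      have r: "r < m" and n: "n = q * m + r"
        using m by (auto simp: q_def r_def)
      have "a n \<le> b ^ (q * m) * a r"
        unfolding n by (rule amq)
      also have "\<dots> = (a r / b ^ r) * b ^ n"
        unfolding n using b by (simp add: power_add)
      also have "\<dots> \<le> K * b ^ n"
      proof (rule mult_right_mono)
        have "a r / b ^ r \<le> (\<Sum>r<m. a r / b ^ r)"
          using r nonneg b by (intro member_le_sum) auto
        then show "a r / b ^ r \<le> K"
          by (simp add: K_def)
      qed (use b in auto)
      finally show ?thesis .
    qed
    have rn: "root n (a n) \<le> root n K * b" if "n \<ge> 1" for n
    proof -
      have "root n (a n) \<le> root n (K * b ^ n)"
        using that an by (intro real_root_le_mono) auto
      then show ?thesis
        using that b by (simp add: real_root_mult real_root_power_cancel)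
    qed
    have "(\<lambda>n. root n K * b) \<longlonglongrightarrow> 1 * b"
      using K1 by (intro tendsto_intros LIMSEQ_root_const) auto
    then have "\<forall>\<^sub>F n in sequentially. root n K * b < L + e"
      using e by (intro order_tendstoD(2)) (auto simp: b_def)
    then obtain N where N: "\<And>n. n \<ge> N \<Longrightarrow> root n K * b < L + e"
      by (auto simp: eventually_sequentially)
    show "\<exists>no. \<forall>n\<ge>no. norm (root n (a n) - L) < e"
    proof (intro exI allI impI)
      fix n assume n: "n \<ge> max N 1"
      then have "root n (a n) < L + e"
        using rn[of n] N[of n] by simp
      moreover have "L \<le> root n (a n)"
        using n by (intro low) auto
      ultimately show "norm (root n (a n) - L) < e"
        using e by simp
    qed
  qed
  then show ?thesis
    by (auto simp: convergent_def)
qed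

section \<open>Products, powers and bounds of sets of operators; existence of the joint
  radii\<close>

lemma op_set_times_assoc: "op_set_times \<Phi> (op_set_times \<Psi> \<Sigma>) = op_set_times (op_set_times \<Phi> \<Psi>) \<Sigma>"
  unfolding op_set_times_def by (auto; metis comp_assoc)

lemma op_set_times_id [simp]: "op_set_times \<Psi> {id} = \<Psi>" "op_set_times {id} \<Psi> = \<Psi>"
  by (auto simp: op_set_times_def)

lemma op_set_prod_list_Nil: "op_set_prod_list [] = {id}"
  by (simp add: op_set_prod_list_def)

lemma op_set_prod_list_Cons: "op_set_prod_list (\<Psi> # \<Psi>s) = op_set_times \<Psi> (op_set_prod_list \<Psi>s)"
  by (simp add: op_set_prod_list_def)

lemma op_set_prod_list_append:
  "op_set_prod_list (\<Psi>s @ \<Phi>s) = op_set_times (op_set_prod_list \<Psi>s) (op_set_prod_list \<Phi>s)"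
  by (induction \<Psi>s) (simp_all add: op_set_prod_list_Nil op_set_prod_list_Cons op_set_times_assoc)

lemma op_set_power_0: "op_set_power \<Sigma> 0 = {id}"
  by (simp add: op_set_power_def op_set_prod_list_Nil)

lemma op_set_power_Suc: "op_set_power \<Sigma> (Suc n) = op_set_times \<Sigma> (op_set_power \<Sigma> n)"
  by (simp add: op_set_power_def op_set_prod_list_Cons)

lemma op_set_power_add: "op_set_power \<Sigma> (m + n) = op_set_times (op_set_power \<Sigma> m) (op_set_power \<Sigma> n)"
  by (simp add: op_set_power_def replicate_add op_set_prod_list_append)

text \<open>Through singletons, results about joint radii specialize to the powers of one
  operator.\<close>

lemma op_set_power_singleton: "op_set_power {A} n = {A ^^ n}"
  by (induction n) (auto simp: op_set_power_0 op_set_power_Suc op_set_times_def)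

definition bounded_set :: "'a measure \<Rightarrow> 'a l2op set \<Rightarrow> bool" where
  "bounded_set M \<Sigma> \<longleftrightarrow> (\<exists>C. \<forall>A\<in>\<Sigma>. bounded_operator M A \<and> op_norm M A \<le> C)"

lemma bounded_setD: "bounded_set M \<Sigma> \<Longrightarrow> A \<in> \<Sigma> \<Longrightarrow> bounded_operator M A"
  by (auto simp: bounded_set_def)

lemma bounded_setI:
  assumes "\<And>A. A \<in> \<Sigma> \<Longrightarrow> linear_operator M A" "bounded_operators M \<Sigma>"
  shows "bounded_set M \<Sigma>"
proof -
  obtain C where C: "\<And>A f. A \<in> \<Sigma> \<Longrightarrow> f \<in> L2 M \<Longrightarrow> l2_norm M (A f) \<le> C * l2_norm M f"
    using assms(2) unfolding bounded_operators_def by blast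
  have C': "l2_norm M (A f) \<le> \<bar>C\<bar> * l2_norm M f" if "A \<in> \<Sigma>" "f \<in> L2 M" for A f
    using C[OF that] mult_right_mono[of C "\<bar>C\<bar>" "l2_norm M f"] by fastforce
  have "bounded_operator M A \<and> op_norm M A \<le> \<bar>C\<bar>" if "A \<in> \<Sigma>" for A
    using that assms(1) C' by (auto intro!: bounded_operatorI op_norm_least')
  then show ?thesis
    unfolding bounded_set_def by blast
qed

lemma bounded_set_singleton: "bounded_operator M A \<Longrightarrow> bounded_set M {A}"
  by (auto simp: bounded_set_def)

lemma bounded_set_times:
  assumes "bounded_set M \<Phi>" "bounded_set M \<Psi>"
  shows "bounded_set M (op_set_times \<Phi> \<Psi>)"
proof -
  obtain C D where C: "\<And>A. A \<in> \<Phi> \<Longrightarrow> bounded_operator M A \<and> op_norm M A \<le> C"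
    and D: "\<And>A. A \<in> \<Psi> \<Longrightarrow> bounded_operator M A \<and> op_norm M A \<le> D"
    using assms unfolding bounded_set_def by blast
  have "bounded_operator M (A \<circ> B) \<and> op_norm M (A \<circ> B) \<le> \<bar>C\<bar> * \<bar>D\<bar>" if "A \<in> \<Phi>" "B \<in> \<Psi>" for A B
  proof -
    have "op_norm M (A \<circ> B) \<le> op_norm M A * op_norm M B"
      using that C D by (intro op_norm_comp) auto
    also have "\<dots> \<le> \<bar>C\<bar> * \<bar>D\<bar>"
      using C[OF that(1)] D[OF that(2)] by (intro mult_mono op_norm_nonneg) auto
    finally show ?thesis using that C D by (auto intro: bounded_operator_comp)
  qed
  then show ?thesis
    unfolding bounded_set_def op_set_times_def by blast
qed

lemma bounded_set_plus:
  assumes "bounded_set M \<Phi>" "bounded_set M \<Psi>"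
  shows "bounded_set M (op_set_plus \<Phi> \<Psi>)"
proof -
  obtain C D where C: "\<And>A. A \<in> \<Phi> \<Longrightarrow> bounded_operator M A \<and> op_norm M A \<le> C"
    and D: "\<And>A. A \<in> \<Psi> \<Longrightarrow> bounded_operator M A \<and> op_norm M A \<le> D"
    using assms unfolding bounded_set_def by blast
  have "bounded_operator M (\<lambda>f x. A f x + B f x) \<and> op_norm M (\<lambda>f x. A f x + B f x) \<le> C + D"
    if "A \<in> \<Phi>" "B \<in> \<Psi>" for A B
  proof -
    have A: "bounded_operator M A" and B: "bounded_operator M B"
      using that C D by auto
    have "op_norm M (\<lambda>f x. A f x + B f x) \<le> op_norm M A + op_norm M B"
      by (intro op_norm_least' op_norm_add_bound A B add_nonneg_nonneg op_norm_nonneg)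
    then show ?thesis
      using C[OF that(1)] D[OF that(2)] bounded_operator_add[OF A B] by linarith
  qed
  then show ?thesis
    unfolding bounded_set_def op_set_plus_def by blast
qed

lemma bounded_set_zero: "bounded_set M {\<lambda>f x. 0}"
  by (intro bounded_set_singleton bounded_operatorI[of _ _ 0] linear_operator_zero) simp

lemma bounded_set_id: "bounded_set M {id}"
  by (intro bounded_set_singleton bounded_operator_id)

lemma bounded_set_prod_list: "(\<And>\<Psi>. \<Psi> \<in> set \<Psi>s \<Longrightarrow> bounded_set M \<Psi>) \<Longrightarrow> bounded_set M (op_set_prod_list \<Psi>s)"
  by (induction \<Psi>s) (auto simp: op_set_prod_list_Nil op_set_prod_list_Cons bounded_set_id intro: bounded_set_times)

lemma bounded_set_sum_list: "(\<And>\<Psi>. \<Psi> \<in> set \<Psi>s \<Longrightarrow> bounded_set M \<Psi>) \<Longrightarrow> bounded_set M (op_set_sum_list \<Psi>s)"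
  by (induction \<Psi>s) (auto simp: op_set_sum_list_def bounded_set_zero intro: bounded_set_plus)

lemma bounded_set_power: "bounded_set M \<Sigma> \<Longrightarrow> bounded_set M (op_set_power \<Sigma> n)"
  unfolding op_set_power_def by (intro bounded_set_prod_list) (auto split: if_splits)

text \<open>Common ground of \<open>op_norm\<close> and \<open>meas_noncompact\<close>, so that the
  joint radii and their essential versions are treated together.\<close>

definition submultiplicative :: "'a measure \<Rightarrow> ('a l2op \<Rightarrow> real) \<Rightarrow> bool" where
  "submultiplicative M \<phi> \<longleftrightarrow>
     (\<forall>A. bounded_operator M A \<longrightarrow> 0 \<le> \<phi> A \<and> \<phi> A \<le> op_norm M A) \<and>
     (\<forall>A B. bounded_operator M A \<longrightarrow> bounded_operator M B \<longrightarrow> \<phi> (A \<circ> B) \<le> \<phi> A * \<phi> B)"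

lemma submultiplicative_op_norm: "submultiplicative M (op_norm M)"
  by (simp add: submultiplicative_def op_norm_nonneg op_norm_comp)

lemma bdd_above_image_op_norm:
  assumes "bounded_set M \<Sigma>" "\<And>A. bounded_operator M A \<Longrightarrow> \<phi> A \<le> op_norm M A"
  shows "bdd_above (\<phi> ` \<Sigma>)"
proof -
  obtain C where C: "\<And>A. A \<in> \<Sigma> \<Longrightarrow> bounded_operator M A \<and> op_norm M A \<le> C"
    using assms(1) unfolding bounded_set_def by blast
  show ?thesis
    by (rule bdd_aboveI[of _ C]) (use C assms(2) order_trans in blast)
qed

text \<open>Without convergence the value of \<open>lim\<close> would be arbitrary. Fekete's lemma
  applies because an element of the power m + n splits into a composition of elements of the powers
  m and n.\<close>

lemma convergent_joint:
  assumes \<phi>: "submultiplicative M \<phi>" and \<Sigma>: "bounded_set M \<Sigma>"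
  shows "convergent (\<lambda>n. root n (Sup0 (\<phi> ` op_set_power \<Sigma> n)))"
proof (rule fekete_root)
  have bdd: "bdd_above (\<phi> ` op_set_power \<Sigma> n)" for n
    using \<phi> by (intro bdd_above_image_op_norm[where M = M] bounded_set_power \<Sigma>) (simp add: submultiplicative_def)
  show nn: "0 \<le> Sup0 (\<phi> ` op_set_power \<Sigma> n)" for n
    by (intro Sup0_nonneg bdd)
  show "Sup0 (\<phi> ` op_set_power \<Sigma> (m + n)) \<le> Sup0 (\<phi> ` op_set_power \<Sigma> m) * Sup0 (\<phi> ` op_set_power \<Sigma> n)" for m n
  proof (rule Sup0_least)
    fix x assume "x \<in> \<phi> ` op_set_power \<Sigma> (m + n)"
    then obtain A B where AB: "A \<in> op_set_power \<Sigma> m" "B \<in> op_set_power \<Sigma> n" "x = \<phi> (A \<circ> B)"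
      by (auto simp: op_set_power_add op_set_times_def)
    have bA: "bounded_operator M A" and bB: "bounded_operator M B"
      using AB bounded_setD[OF bounded_set_power[OF \<Sigma>]] by blast+
    have "x \<le> \<phi> A * \<phi> B"
      using \<phi> AB bA bB by (simp add: submultiplicative_def)
    also have "\<dots> \<le> Sup0 (\<phi> ` op_set_power \<Sigma> m) * Sup0 (\<phi> ` op_set_power \<Sigma> n)"
      using \<phi> bA bB AB by (intro mult_mono Sup0_upper bdd nn) (auto simp: submultiplicative_def)
    finally show "x \<le> Sup0 (\<phi> ` op_set_power \<Sigma> m) * Sup0 (\<phi> ` op_set_power \<Sigma> n)" .
  qed (intro mult_nonneg_nonneg nn)
qed

lemma Sup0_singleton: "0 \<le> x \<Longrightarrow> Sup0 {x} = x"
  by (intro antisym Sup0_least Sup0_upper) auto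

lemma convergent_root_funpow:
  assumes "submultiplicative M \<phi>" "bounded_operator M A"
  shows "convergent (\<lambda>n. root n (\<phi> (A ^^ n)))"
proof -
  have "Sup0 (\<phi> ` op_set_power {A} n) = \<phi> (A ^^ n)" for n
    using assms bounded_operator_funpow[OF assms(2), of n]
    by (simp add: op_set_power_singleton Sup0_singleton submultiplicative_def)
  then show ?thesis
    using convergent_joint[OF assms(1) bounded_set_singleton[OF assms(2)]] by simp
qed

section \<open>Finite nets and the measure of noncompactness\<close>

definition noncompact_bounds :: "'a measure \<Rightarrow> 'a l2op \<Rightarrow> real set" where
  "noncompact_bounds M A = {\<delta>. \<delta> > 0 \<and>
     (\<exists>N. finite N \<and> N \<subseteq> L2 M \<and>
        (\<forall>f\<in>L2 M. l2_norm M f \<le> 1 \<longrightarrow> (\<exists>g\<in>N. l2_norm M (\<lambda>x. A f x - g x) \<le> \<delta>)))}"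

lemma meas_noncompact_eq: "meas_noncompact M A = Inf (noncompact_bounds M A)"
  by (simp add: meas_noncompact_def noncompact_bounds_def)

lemma noncompact_bounds_bdd: "bdd_below (noncompact_bounds M A)"
  by (rule bdd_belowI[of _ 0]) (simp add: noncompact_bounds_def)

lemma noncompact_bounds_op_norm:
  assumes A: "bounded_operator M A" and d: "op_norm M A < d"
  shows "d \<in> noncompact_bounds M A"
proof -
  have "0 < d"
    using op_norm_nonneg[OF A] d by linarith
  moreover have "l2_norm M (\<lambda>x. A f x - 0) \<le> d" if "f \<in> L2 M" "l2_norm M f \<le> 1" for f
  proof -
    have "l2_norm M (A f) \<le> op_norm M A * l2_norm M f"
      by (rule op_norm_bound[OF A that(1)])
    also have "\<dots> \<le> op_norm M A"
      using that op_norm_nonneg[OF A] by (simp add: mult_left_le)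
    finally show ?thesis using d by simp
  qed
  ultimately show ?thesis
    unfolding noncompact_bounds_def by (auto intro!: exI[of _ "{\<lambda>x. 0}"])
qed

lemma meas_noncompact_nonneg:
  assumes "bounded_operator M A"
  shows "0 \<le> meas_noncompact M A"
proof -
  have "op_norm M A + 1 \<in> noncompact_bounds M A"
    by (rule noncompact_bounds_op_norm[OF assms]) simp
  then show ?thesis
    unfolding meas_noncompact_eq by (intro cInf_greatest) (auto simp: noncompact_bounds_def)
qed

lemma meas_noncompact_upper: "d \<in> noncompact_bounds M A \<Longrightarrow> meas_noncompact M A \<le> d"
  unfolding meas_noncompact_eq by (intro cInf_lower noncompact_bounds_bdd)

lemma meas_noncompact_le_op_norm:
  assumes "bounded_operator M A"
  shows "meas_noncompact M A \<le> op_norm M A"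
  by (rule dense_ge) (intro meas_noncompact_upper noncompact_bounds_op_norm assms)

text \<open>The infimum need not be attained, so a finite net is certain only for radii strictly
  above it; increasing the radius of a net is harmless.\<close>

lemma meas_noncompact_less:
  assumes A: "bounded_operator M A" and less: "meas_noncompact M A < d"
  shows "d \<in> noncompact_bounds M A"
proof -
  have "noncompact_bounds M A \<noteq> {}"
    using noncompact_bounds_op_norm[OF A, of "op_norm M A + 1"] by auto
  then obtain e where e: "e \<in> noncompact_bounds M A" "e < d"
    using less unfolding meas_noncompact_eq by (auto simp: cInf_less_iff noncompact_bounds_bdd)
  then have "e > 0"
    by (auto simp: noncompact_bounds_def)
  obtain N where N: "finite N" "N \<subseteq> L2 M"
    "\<And>f. f \<in> L2 M \<Longrightarrow> l2_norm M f \<le> 1 \<Longrightarrow> \<exists>g\<in>N. l2_norm M (\<lambda>x. A f x - g x) \<le> e"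
    using e(1) unfolding noncompact_bounds_def by blast
  have "\<exists>g\<in>N. l2_norm M (\<lambda>x. A f x - g x) \<le> d" if "f \<in> L2 M" "l2_norm M f \<le> 1" for f
    using N(3)[OF that] e(2) by (meson less_imp_le order_trans)
  then show ?thesis
    unfolding noncompact_bounds_def using N(1,2) \<open>e > 0\<close> e(2) by auto
qed

text \<open>If \<open>B f\<close> is within \<open>e\<close> of the net point \<open>g\<close>, then
  (B f - g)/e lies in the unit ball, and its image under \<open>A\<close> is within \<open>d\<close>
  of some net point \<open>h\<close>. Hence \<open>A (B f)\<close> is within d e of
  \<open>A g\<close> + e \<open>h\<close>, and finitely many such functions occur.\<close>

lemma noncompact_bounds_comp:
  assumes A: "bounded_operator M A" and B: "bounded_operator M B"
    and d: "d \<in> noncompact_bounds M A" and e: "e \<in> noncompact_bounds M B"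
  shows "d * e \<in> noncompact_bounds M (A \<circ> B)"
proof -
  obtain N where d0: "d > 0" and N: "finite N" "N \<subseteq> L2 M"
    "\<And>f. f \<in> L2 M \<Longrightarrow> l2_norm M f \<le> 1 \<Longrightarrow> \<exists>g\<in>N. l2_norm M (\<lambda>x. A f x - g x) \<le> d"
    using d unfolding noncompact_bounds_def by blast
  obtain N' where e0: "e > 0" and N': "finite N'" "N' \<subseteq> L2 M"
    "\<And>f. f \<in> L2 M \<Longrightarrow> l2_norm M f \<le> 1 \<Longrightarrow> \<exists>g\<in>N'. l2_norm M (\<lambda>x. B f x - g x) \<le> e"
    using e unfolding noncompact_bounds_def by blast
  define Q where "Q = (\<lambda>(g, h). (\<lambda>x. A g x + complex_of_real e * h x)) ` (N' \<times> N)"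
  have "finite Q"
    using N N' by (simp add: Q_def)
  moreover have "Q \<subseteq> L2 M"
  proof
    fix q assume "q \<in> Q"
    then obtain g h where "g \<in> N'" "h \<in> N" "q = (\<lambda>x. A g x + complex_of_real e * h x)"
      by (auto simp: Q_def)
    moreover from this have "A g \<in> L2 M" "h \<in> L2 M"
      using N(2) N'(2) bounded_operator_L2[OF A] by auto
    ultimately show "q \<in> L2 M"
      by (simp add: L2_add(1) L2_scale)
  qed
  moreover have "\<exists>q\<in>Q. l2_norm M (\<lambda>x. (A \<circ> B) f x - q x) \<le> d * e" if f: "f \<in> L2 M" "l2_norm M f \<le> 1" for f
  proof -
    obtain g where g: "g \<in> N'" "l2_norm M (\<lambda>x. B f x - g x) \<le> e"
      using N'(3)[OF f] by blast
    have gL: "g \<in> L2 M" and BL: "B f \<in> L2 M"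
      using g N' bounded_operator_L2[OF B f(1)] by auto
    define k where "k x = complex_of_real (1 / e) * (B f x - g x)" for x
    have kL: "k \<in> L2 M"
      unfolding k_def by (intro L2_scale L2_diff BL gL)
    have "l2_norm M k \<le> 1"
      unfolding k_def[abs_def] l2_norm_scale norm_of_real using g(2) e0 by simp
    then obtain h where h: "h \<in> N" "l2_norm M (\<lambda>x. A k x - h x) \<le> d"
      using N(3)[OF kL] by blast
    have hL: "h \<in> L2 M"
      using h N by auto
    let ?q = "\<lambda>x. A g x + complex_of_real e * h x"
    have lin: "linear_operator M A"
      by (rule bounded_operator_linear[OF A])
    have "AE x in M. A k x = complex_of_real (1 / e) * A (\<lambda>x. B f x - g x) x"
      unfolding k_def by (rule linear_operatorD(4)[OF lin L2_diff(1)[OF BL gL]])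
    moreover have "AE x in M. A (\<lambda>x. B f x - g x) x = A (B f) x - A g x"
      by (rule linear_operator_diff[OF lin BL gL])
    ultimately have "AE x in M. (A \<circ> B) f x - ?q x = complex_of_real e * (A k x - h x)"
      by eventually_elim (use e0 in \<open>simp add: field_simps\<close>)
    then have "l2_norm M (\<lambda>x. (A \<circ> B) f x - ?q x) = l2_norm M (\<lambda>x. complex_of_real e * (A k x - h x))"
      using bounded_operator_L2[OF A kL] bounded_operator_L2[OF A BL] bounded_operator_L2[OF A gL] hL
      by (intro l2_norm_cong_AE) (auto simp: L2_def)
    also have "\<dots> \<le> d * e"
      unfolding l2_norm_scale using h e0 by (simp add: mult.commute)
    finally have "l2_norm M (\<lambda>x. (A \<circ> B) f x - ?q x) \<le> d * e" .
    moreover have "?q \<in> Q"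
      unfolding Q_def using g h by (intro image_eqI[of _ _ "(g, h)"]) auto
    ultimately show ?thesis
      by (rule bexI[where x = ?q])
  qed
  ultimately show ?thesis
    unfolding noncompact_bounds_def using d0 e0 by auto
qed

lemma meas_noncompact_comp:
  assumes A: "bounded_operator M A" and B: "bounded_operator M B"
  shows "meas_noncompact M (A \<circ> B) \<le> meas_noncompact M A * meas_noncompact M B"
proof -
  let ?a = "meas_noncompact M A" and ?b = "meas_noncompact M B"
  have "(\<lambda>n. (?a + 1 / real (Suc n)) * (?b + 1 / real (Suc n))) \<longlonglongrightarrow> (?a + 0) * (?b + 0)"
    by (intro tendsto_intros LIMSEQ_Suc[OF lim_1_over_n])
  moreover have "meas_noncompact M (A \<circ> B) \<le> (?a + 1 / real (Suc n)) * (?b + 1 / real (Suc n))" for n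
    by (intro meas_noncompact_upper noncompact_bounds_comp meas_noncompact_less A B) auto
  ultimately show ?thesis
    by (intro LIMSEQ_le_const) auto
qed

lemma submultiplicative_meas_noncompact: "submultiplicative M (meas_noncompact M)"
  by (simp add: submultiplicative_def meas_noncompact_nonneg meas_noncompact_le_op_norm meas_noncompact_comp)

section \<open>Gelfand's formula for positive operators\<close>

lemma gelfand_limit_nonneg:
  assumes A: "bounded_operator M A" and lim: "(\<lambda>n. root n (op_norm M (A ^^ n))) \<longlonglongrightarrow> L"
  shows "0 \<le> L"
proof -
  have "0 \<le> root n (op_norm M (A ^^ n))" for n
    by (cases "n = 0") (simp_all add: op_norm_nonneg bounded_operator_funpow A)
  then show ?thesis
    by (intro LIMSEQ_le_const[OF lim]) auto
qed

text \<open>The elementary half of Gelfand's formula: for \<open>L\<close> < s < |z| the terms of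
  the Neumann series are eventually below those of a geometric series with ratio s/|z|.\<close>

lemma spectrum_cmod_le:
  assumes A: "bounded_operator M A" and lim: "(\<lambda>n. root n (op_norm M (A ^^ n))) \<longlonglongrightarrow> L"
    and z: "z \<in> l2_spectrum M A"
  shows "cmod z \<le> L"
proof (rule ccontr)
  assume "\<not> cmod z \<le> L"
  moreover have "0 \<le> L"
    by (rule gelfand_limit_nonneg[OF A lim])
  ultimately obtain s where s: "L < s" "s < cmod z" "0 < s"
    using dense[of L "cmod z"] by force
  have "\<forall>\<^sub>F n in sequentially. root n (op_norm M (A ^^ n)) < s"
    using lim s(1) by (rule order_tendstoD)
  then have ev: "\<forall>\<^sub>F n in sequentially. op_norm M (A ^^ n) \<le> s ^ n"
    using eventually_gt_at_top[of 0]
  proof eventually_elim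
    case (elim n)
    have nn: "0 \<le> op_norm M (A ^^ n)"
      by (intro op_norm_nonneg bounded_operator_funpow A)
    have "root n (op_norm M (A ^^ n)) ^ n \<le> s ^ n"
      using elim nn by (intro power_mono) auto
    then show ?case
      using elim nn by simp
  qed
  have "summable (\<lambda>n. op_norm M (A ^^ n) / cmod z ^ Suc n)"
  proof (rule summable_comparison_test_ev)
    show "summable (\<lambda>n. (1 / cmod z) * (s / cmod z) ^ n)"
      using s by (intro summable_mult summable_geometric) (simp add: divide_less_eq)
    show "\<forall>\<^sub>F n in sequentially. norm (op_norm M (A ^^ n) / cmod z ^ Suc n) \<le> (1 / cmod z) * (s / cmod z) ^ n"
      using ev
    proof eventually_elim
      case (elim n)
      have "norm (op_norm M (A ^^ n) / cmod z ^ Suc n) = op_norm M (A ^^ n) / cmod z ^ Suc n"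
        using op_norm_nonneg[OF bounded_operator_funpow[OF A, of n]] by simp
      also have "\<dots> \<le> s ^ n / cmod z ^ Suc n"
        using elim by (intro divide_right_mono) auto
      finally show ?case by (simp add: power_divide)
    qed
  qed
  then have "z \<notin> l2_spectrum M A"
    using s by (intro neumann_series A) auto
  with z show False by simp
qed

lemma spec_radius_le:
  assumes A: "bounded_operator M A" and lim: "(\<lambda>n. root n (op_norm M (A ^^ n))) \<longlonglongrightarrow> L"
  shows "spec_radius M A \<le> L" "bdd_above (cmod ` l2_spectrum M A)"
proof -
  have "0 \<le> L"
    by (rule gelfand_limit_nonneg[OF A lim])
  then show "spec_radius M A \<le> L"
    unfolding spec_radius_def by (intro Sup0_least) (auto intro: spectrum_cmod_le[OF assms])
  show "bdd_above (cmod ` l2_spectrum M A)"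
    by (rule bdd_aboveI[of _ L]) (auto intro: spectrum_cmod_le[OF assms])
qed

lemma op_norm_funpow_le:
  assumes "bounded_operator M A"
  shows "op_norm M (A ^^ Suc n) \<le> op_norm M A ^ Suc n"
proof (induction n)
  case (Suc n)
  have "op_norm M (A ^^ Suc (Suc n)) \<le> op_norm M A * op_norm M (A ^^ Suc n)"
    by (subst funpow.simps(2)) (rule op_norm_comp[OF assms bounded_operator_funpow[OF assms]])
  also have "\<dots> \<le> op_norm M A * op_norm M A ^ Suc n"
    by (intro mult_left_mono Suc op_norm_nonneg assms)
  also have "\<dots> = op_norm M A ^ Suc (Suc n)"
    by simp
  finally show ?case .
qed simp

lemma spec_radius_nonneg_le_op_norm:
  assumes A: "bounded_operator M A"
  shows "0 \<le> spec_radius M A" "spec_radius M A \<le> op_norm M A"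
proof -
  obtain L where lim: "(\<lambda>n. root n (op_norm M (A ^^ n))) \<longlonglongrightarrow> L"
    using convergent_root_funpow[OF submultiplicative_op_norm A] by (auto simp: convergent_def)
  show "0 \<le> spec_radius M A"
    unfolding spec_radius_def by (intro Sup0_nonneg spec_radius_le[OF A lim])
  have "root n (op_norm M (A ^^ n)) \<le> op_norm M A" if n1: "n \<ge> 1" for n
  proof -
    obtain k where n: "n = Suc k"
      using n1 by (cases n) auto
    have "root n (op_norm M (A ^^ n)) \<le> root n (op_norm M A ^ n)"
      unfolding n by (intro real_root_le_mono op_norm_funpow_le A) auto
    then show ?thesis
      using n1 op_norm_nonneg[OF A] by (simp add: real_root_power_cancel)
  qed
  then have "L \<le> op_norm M A"
    by (intro LIMSEQ_le_const2[OF lim]) auto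
  then show "spec_radius M A \<le> op_norm M A"
    using spec_radius_le(1)[OF A lim] by linarith
qed

section \<open>The cone of nonnegative functions and operators that preserve it\<close>

definition nonneg_fun :: "'a measure \<Rightarrow> ('a \<Rightarrow> complex) \<Rightarrow> bool" where
  "nonneg_fun M f \<longleftrightarrow> (AE x in M. f x \<in> \<real>\<^sub>\<ge>\<^sub>0)"

lemma complex_nonneg_distance:
  assumes "t \<in> \<real>\<^sub>\<ge>\<^sub>0"
  shows "cmod (w - complex_of_real (max 0 (Re w))) \<le> cmod (w - t)"
proof -
  obtain r where r: "t = complex_of_real r" "0 \<le> r"
    using assms by (auto simp: nonneg_Reals_def)
  have "\<bar>Re w - max 0 (Re w)\<bar> \<le> \<bar>Re w - r\<bar>"
    using r by (auto simp: max_def)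
  then have "(Re w - max 0 (Re w))\<^sup>2 \<le> (Re w - r)\<^sup>2"
    by (rule iffD1[OF abs_le_square_iff])
  then show ?thesis
    by (simp add: r cmod_def)
qed

text \<open>Projecting the values of \<open>h\<close> to the half line moves \<open>h\<close> no
  farther than its distance to any nonnegative function. That distance is arbitrarily small, so
  \<open>h\<close> equals its projection; no a.e. convergent subsequence has to be
  extracted.\<close>

lemma nonneg_fun_limit:
  assumes h: "h \<in> L2 M" and s: "\<And>n. s n \<in> L2 M" "\<And>n. nonneg_fun M (s n)"
    and lim: "(\<lambda>n. l2_norm M (\<lambda>x. h x - s n x)) \<longlonglongrightarrow> 0"
  shows "nonneg_fun M h"
proof -
  have [measurable]: "h \<in> borel_measurable M"
    using h by (simp add: L2_def)
  define d where "d x = h x - complex_of_real (max 0 (Re (h x)))" for x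
  have [measurable]: "d \<in> borel_measurable M"
    unfolding d_def by measurable
  have le_AE: "AE x in M. cmod (d x) \<le> cmod (h x - s n x)" for n
    using s(2)[of n] unfolding nonneg_fun_def
    by eventually_elim (simp only: d_def complex_nonneg_distance)
  have le: "l2_norm M d \<le> l2_norm M (\<lambda>x. h x - s n x)" and dL: "d \<in> L2 M" for n
    using L2_mono[OF L2_diff(1)[OF h s(1)[of n]] _ le_AE] by auto
  have "l2_norm M d \<le> 0"
    using lim le by (intro LIMSEQ_le_const) auto
  then have "l2_norm M d = 0"
    using l2_norm_nonneg[of M d] by linarith
  then have "AE x in M. d x = 0"
    by (simp add: l2_norm_eq_0_iff dL)
  then show ?thesis
    unfolding nonneg_fun_def
    by eventually_elim (simp add: d_def complex_nonneg_Reals_iff complex_eq_iff, linarith)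
qed

lemma nonneg_fun_add: "nonneg_fun M f \<Longrightarrow> nonneg_fun M g \<Longrightarrow> nonneg_fun M (\<lambda>x. f x + g x)"
  unfolding nonneg_fun_def by (auto elim!: eventually_elim2)

lemma nonneg_fun_0: "nonneg_fun M (\<lambda>x. 0)"
  by (simp add: nonneg_fun_def)

lemma nonneg_fun_scale: "0 \<le> c \<Longrightarrow> nonneg_fun M f \<Longrightarrow> nonneg_fun M (\<lambda>x. complex_of_real c * f x)"
  unfolding nonneg_fun_def by (auto elim!: eventually_mono)

lemma nonneg_fun_cong:
  assumes "AE x in M. f x = g x" "nonneg_fun M g"
  shows "nonneg_fun M f"
  using assms unfolding nonneg_fun_def by (auto elim!: eventually_elim2)

lemma cmod_le_nonneg_Reals:
  assumes "a \<in> \<real>\<^sub>\<ge>\<^sub>0" "b - a \<in> \<real>\<^sub>\<ge>\<^sub>0"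
  shows "cmod a \<le> cmod b"
proof -
  obtain r s where "a = complex_of_real r" "0 \<le> r" "b - a = complex_of_real s" "0 \<le> s"
    using assms by (auto simp: nonneg_Reals_def)
  then have "b = complex_of_real (r + s)" "0 \<le> r" "0 \<le> s" "a = complex_of_real r"
    by (auto simp: algebra_simps)
  then show ?thesis
    by (simp only: norm_of_real)
qed

definition positivity_preserving :: "'a measure \<Rightarrow> 'a l2op \<Rightarrow> bool" where
  "positivity_preserving M A \<longleftrightarrow> (\<forall>f\<in>L2 M. nonneg_fun M f \<longrightarrow> nonneg_fun M (A f))"

lemma positivity_preserving_funpow:
  assumes "bounded_operator M A" "positivity_preserving M A" "f \<in> L2 M" "nonneg_fun M f"
  shows "nonneg_fun M ((A ^^ n) f)"
proof (induction n)
  case (Suc n)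
  then show ?case
    using assms(2) bounded_operator_L2[OF bounded_operator_funpow[OF assms(1)] assms(3)]
    by (simp add: positivity_preserving_def)
qed (use assms in simp)

text \<open>Iterating \<open>h = g + X h\<close> exhibits \<open>h\<close> as the limit of the nonnegative sums
  \<open>g + X g + \<dots> + X\<^sup>n g\<close>.\<close>

lemma nonneg_fun_fixed_point:
  assumes X: "bounded_operator M X" "positivity_preserving M X" and g: "g \<in> L2 M" "nonneg_fun M g"
    and h: "h \<in> L2 M" "AE x in M. h x = g x + X h x"
    and lim: "(\<lambda>n. l2_norm M ((X ^^ n) h)) \<longlonglongrightarrow> 0"
  shows "nonneg_fun M h"
proof -
  define s where "s n x = (\<Sum>k<n. (X ^^ k) g x)" for n x
  note Xn = bounded_operator_funpow[OF X(1)]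
  note Xg = bounded_operator_L2[OF Xn g(1)] and Xh = bounded_operator_L2[OF Xn h(1)]
  have sL: "s n \<in> L2 M" for n
    unfolding s_def using L2_sum[of "{..<n}" "\<lambda>k. (X ^^ k) g" M] Xg by simp
  have sn: "nonneg_fun M (s n)" for n
  proof (induction n)
    case (Suc n)
    then show ?case
      using nonneg_fun_add[of M "s n" "(X ^^ n) g"] positivity_preserving_funpow[OF X g]
      by (simp add: s_def[abs_def])
  qed (simp add: s_def[abs_def] nonneg_fun_0)
  have step: "AE x in M. (X ^^ n) h x = (X ^^ n) g x + (X ^^ Suc n) h x" for n
  proof -
    have "AE x in M. (X ^^ n) h x = (X ^^ n) (\<lambda>x. g x + X h x) x"
      by (rule linear_operatorD(2)[OF bounded_operator_linear[OF Xn] h(1)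
            L2_add(1)[OF g(1) bounded_operator_L2[OF X(1) h(1)]] h(2)])
    moreover have "AE x in M. (X ^^ n) (\<lambda>x. g x + X h x) x = (X ^^ n) g x + (X ^^ n) (X h) x"
      by (rule linear_operatorD(3)[OF bounded_operator_linear[OF Xn] g(1) bounded_operator_L2[OF X(1) h(1)]])
    ultimately show ?thesis
      by eventually_elim (simp add: funpow_swap1)
  qed
  have "AE x in M. h x - s n x = (X ^^ n) h x" for n
  proof (induction n)
    case (Suc n)
    then show ?case
      using step[of n] by eventually_elim (simp add: s_def algebra_simps)
  qed (simp add: s_def)
  then have "l2_norm M (\<lambda>x. h x - s n x) = l2_norm M ((X ^^ n) h)" for n
    using L2_diff(1)[OF h(1) sL] Xh by (intro l2_norm_cong_AE) (auto simp: L2_def)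
  then show ?thesis
    using lim by (intro nonneg_fun_limit[OF h(1) sL sn]) simp
qed

lemma l2_norm_funpow_le:
  assumes X: "bounded_operator M X" and q: "\<And>f. f \<in> L2 M \<Longrightarrow> l2_norm M (X f) \<le> q * l2_norm M f"
    and "0 \<le> q" "f \<in> L2 M"
  shows "l2_norm M ((X ^^ n) f) \<le> q ^ n * l2_norm M f"
proof (induction n)
  case (Suc n)
  have "l2_norm M ((X ^^ Suc n) f) \<le> q * l2_norm M ((X ^^ n) f)"
    using q[OF bounded_operator_L2[OF bounded_operator_funpow[OF X] assms(4)]] by simp
  also have "\<dots> \<le> q * (q ^ n * l2_norm M f)"
    using Suc assms by (intro mult_left_mono) auto
  finally show ?case by (simp add: mult.assoc)
qed simp

lemma linear_operator_funpow_scale: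
  assumes A: "bounded_operator M A" and f: "f \<in> L2 M"
  shows "AE x in M. ((\<lambda>f x. c * A f x) ^^ n) f x = c ^ n * (A ^^ n) f x"
proof (induction n)
  case (Suc n)
  let ?X = "\<lambda>f x. c * A f x"
  have 1: "(?X ^^ n) f \<in> L2 M" and 2: "(A ^^ n) f \<in> L2 M"
    by (rule bounded_operator_L2[OF bounded_operator_funpow[OF bounded_operator_scale[OF A]] f])
      (rule bounded_operator_L2[OF bounded_operator_funpow[OF A] f])
  have lin: "linear_operator M A"
    by (rule bounded_operator_linear[OF A])
  have "AE x in M. A ((?X ^^ n) f) x = A (\<lambda>x. c ^ n * (A ^^ n) f x) x"
    by (rule linear_operatorD(2)[OF lin 1 L2_scale[OF 2] Suc])
  moreover have "AE x in M. A (\<lambda>x. c ^ n * (A ^^ n) f x) x = c ^ n * A ((A ^^ n) f) x"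
    by (rule linear_operatorD(4)[OF lin 2])
  ultimately show ?case
    by eventually_elim simp
qed simp

text \<open>Only real points outside the spectrum are used: if the limit \<open>L\<close> exceeded the spectral radius,
  then the resolvent would be positive slightly to the right of \<open>L\<close>, hence, by its Neumann expansion,
  also at some \<open>\<mu> < L\<close>, and positivity at \<open>\<mu>\<close> gives \<open>P\<^sup>m f \<le> \<mu>\<^sup>m\<^sup>+\<^sup>1 (\<mu> - P)\<^sup>-\<^sup>1 f\<close> for \<open>f \<ge> 0\<close>.\<close>

lemma positive_gelfand:
  assumes P: "bounded_operator M P" "positivity_preserving M P"
    and dom: "\<And>f. f \<in> L2 M \<Longrightarrow> nonneg_fun M (\<lambda>x. P (\<lambda>x. complex_of_real (cmod (f x))) x - complex_of_real (cmod (P f x)))"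
    and lim: "(\<lambda>n. root n (op_norm M (P ^^ n))) \<longlonglongrightarrow> L"
  shows "L \<le> spec_radius M P"
proof (rule ccontr)
  define r where "r = spec_radius M P"
  assume "\<not> L \<le> spec_radius M P"
  then have rL: "r < L" by (simp add: r_def)
  have r0: "0 \<le> r"
    unfolding r_def by (rule spec_radius_nonneg_le_op_norm[OF P(1)])
  note lin = bounded_operator_linear[OF P(1)] and Pn = bounded_operator_funpow[OF P(1)]
  have res: "\<exists>R. resolvent_at M P (complex_of_real l) R" if "r < l" for l
  proof -
    have "complex_of_real l \<notin> l2_spectrum M P"
    proof
      assume "complex_of_real l \<in> l2_spectrum M P"
      then have "cmod (complex_of_real l) \<le> r"
        unfolding r_def spec_radius_def by (intro Sup0_upper spec_radius_le(2)[OF P(1) lim] imageI)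
      then show False using that r0 by simp
    qed
    then show ?thesis by (simp add: not_in_l2_spectrum_iff)
  qed
  \<comment> \<open>Powers of \<open>P\<close> need to be bounded on nonnegative functions only:
    |P^m f| \<le> P^m |f|, by induction from \<open>dom\<close> and positivity.\<close>
  have absP: "l2_norm M ((P ^^ m) f) \<le> l2_norm M ((P ^^ m) (\<lambda>x. complex_of_real (cmod (f x))))"
    if f: "f \<in> L2 M" for m f
  proof -
    let ?a = "\<lambda>x. complex_of_real (cmod (f x))"
    have ab: "nonneg_fun M ?a"
      by (simp add: nonneg_fun_def)
    have "nonneg_fun M (\<lambda>x. (P ^^ m) ?a x - complex_of_real (cmod ((P ^^ m) f x)))"
    proof (induction m)
      case (Suc m)
      let ?u = "(P ^^ m) ?a" and ?v = "\<lambda>x. complex_of_real (cmod ((P ^^ m) f x))"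
      have u: "?u \<in> L2 M" and v: "?v \<in> L2 M" and w: "(P ^^ m) f \<in> L2 M"
        using bounded_operator_L2[OF Pn] f by auto
      have "nonneg_fun M (P (\<lambda>x. ?u x - ?v x))"
        using P(2) Suc L2_diff(1)[OF u v] by (simp add: positivity_preserving_def)
      then have "nonneg_fun M (\<lambda>x. P (\<lambda>x. ?u x - ?v x) x + (P ?v x - complex_of_real (cmod (P ((P ^^ m) f) x))))"
        by (intro nonneg_fun_add dom w)
      moreover have "AE x in M. (P ^^ Suc m) ?a x - complex_of_real (cmod ((P ^^ Suc m) f x))
          = P (\<lambda>x. ?u x - ?v x) x + (P ?v x - complex_of_real (cmod (P ((P ^^ m) f) x)))"
        using linear_operator_diff[OF lin u v] by eventually_elim simp
      ultimately show ?case
        by (rule nonneg_fun_cong[rotated])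
    qed (simp add: nonneg_fun_def)
    then have "AE x in M. cmod ((P ^^ m) f x) \<le> cmod ((P ^^ m) ?a x)"
      unfolding nonneg_fun_def
    proof eventually_elim
      case (elim x)
      then show ?case
        using cmod_le_nonneg_Reals[OF _ elim] by simp
    qed
    then show ?thesis
      using bounded_operator_L2[OF Pn] f by (intro L2_mono(2)) (auto simp: L2_def)
  qed
  have dominate: "L \<le> \<mu>" if mu: "0 < \<mu>" and S: "resolvent_at M P (complex_of_real \<mu>) S" "positivity_preserving M S" for \<mu> S
  proof -
    have bS: "bounded_operator M S"
      using S by (simp add: resolvent_at_def)
    have pw: "nonneg_fun M (\<lambda>x. complex_of_real (\<mu> ^ Suc m) * S f x - (P ^^ m) f x)"
      if f: "f \<in> L2 M" "nonneg_fun M f" for f m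
    proof -
      have Sf: "S f \<in> L2 M" by (rule bounded_operator_L2[OF bS f(1)])
      have Sp: "nonneg_fun M (S f)"
        using S(2) f by (simp add: positivity_preserving_def)
      have PSf: "nonneg_fun M (P (S f))"
        using P(2) Sf Sp by (simp add: positivity_preserving_def)
      have eq: "AE x in M. complex_of_real \<mu> * S f x - P (S f) x = f x"
        using S(1) f by (simp add: resolvent_at_def)
      show ?thesis
      \<comment> \<open>Each step applies \<open>P\<close> to the inequality and replaces
        \<open>P (S f)\<close> by \<mu> \<open>S f\<close> - \<open>f\<close>; the nonnegative
        function \<open>f\<close> is left over.\<close>
      proof (induction m)
        case 0
        show ?case
          by (rule nonneg_fun_cong[OF _ PSf]) (use eq in eventually_elim, simp add: algebra_simps)
      next
        case (Suc m)
        let ?d = "\<lambda>x. complex_of_real (\<mu> ^ Suc m) * S f x - (P ^^ m) f x"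
        have Pm: "(P ^^ m) f \<in> L2 M"
          by (rule bounded_operator_L2[OF Pn f(1)])
        have "?d \<in> L2 M"
          by (intro L2_diff(1) L2_scale Sf Pm)
        then have "nonneg_fun M (P ?d)"
          using P(2) Suc by (simp add: positivity_preserving_def)
        then have "nonneg_fun M (\<lambda>x. P ?d x + complex_of_real (\<mu> ^ Suc m) * f x)"
          using f mu by (intro nonneg_fun_add nonneg_fun_scale) auto
        moreover have "AE x in M. complex_of_real (\<mu> ^ Suc (Suc m)) * S f x - (P ^^ Suc m) f x
            = P ?d x + complex_of_real (\<mu> ^ Suc m) * f x"
          using linear_operator_diff[OF lin L2_scale[OF Sf, of "complex_of_real (\<mu> ^ Suc m)"] Pm]
            linear_operatorD(4)[OF lin Sf, of "complex_of_real (\<mu> ^ Suc m)"] eq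
        proof eventually_elim
          case (elim x)
          have "P ?d x = complex_of_real (\<mu> ^ Suc m) * P (S f) x - P ((P ^^ m) f) x"
            using elim(1,2) by (simp only:)
          moreover have "complex_of_real (\<mu> ^ Suc m) * f x
              = complex_of_real (\<mu> ^ Suc m) * (complex_of_real \<mu> * S f x - P (S f) x)"
            using elim(3) by (simp only:)
          ultimately show ?case
            by (simp only: funpow.simps comp_def) (simp add: algebra_simps)
        qed
        ultimately show ?case
          by (rule nonneg_fun_cong[rotated])
      qed
    qed
    have "l2_norm M ((P ^^ m) f) \<le> (\<mu> ^ Suc m * op_norm M S) * l2_norm M f" if f: "f \<in> L2 M" for f m
    proof -
      let ?a = "\<lambda>x. complex_of_real (cmod (f x))"
      have a: "?a \<in> L2 M" "nonneg_fun M ?a"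
        using f by (auto simp: nonneg_fun_def)
      note Sa = bounded_operator_L2[OF bS a(1)] and Pa = bounded_operator_L2[OF Pn a(1)]
      have "l2_norm M ((P ^^ m) f) \<le> l2_norm M ((P ^^ m) ?a)"
        by (rule absP[OF f])
      also have "\<dots> \<le> l2_norm M (\<lambda>x. complex_of_real (\<mu> ^ Suc m) * S ?a x)"
      proof (rule L2_mono(2)[OF L2_scale[OF Sa]])
        show "(P ^^ m) ?a \<in> borel_measurable M"
          using Pa by (simp add: L2_def)
        show "AE x in M. cmod ((P ^^ m) ?a x) \<le> cmod (complex_of_real (\<mu> ^ Suc m) * S ?a x)"
          using positivity_preserving_funpow[OF P a, of m] pw[OF a, of m] unfolding nonneg_fun_def
          by eventually_elim (rule cmod_le_nonneg_Reals)
      qed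
      also have "\<dots> = \<mu> ^ Suc m * l2_norm M (S ?a)"
        using mu by (simp only: l2_norm_scale norm_of_real) simp
      also have "\<dots> \<le> \<mu> ^ Suc m * (op_norm M S * l2_norm M ?a)"
        using mu by (intro mult_left_mono op_norm_bound bS a) auto
      finally show ?thesis by (simp add: mult.assoc)
    qed
    then have op: "op_norm M (P ^^ m) \<le> \<mu> ^ Suc m * op_norm M S" for m
      using mu op_norm_nonneg[OF bS] by (intro op_norm_least') auto
    \<comment> \<open>The added 1 makes the constant under the root positive, as needed for its m-th
      root to tend to 1.\<close>
    have "root m (op_norm M (P ^^ m)) \<le> \<mu> * root m (\<mu> * (op_norm M S + 1))" if "m \<ge> 1" for m
    proof -
      have "root m (op_norm M (P ^^ m)) \<le> root m (\<mu> ^ m * (\<mu> * (op_norm M S + 1)))"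
        using that mu op[of m] by (intro real_root_le_mono) (auto simp: algebra_simps intro: order_trans)
      also have "\<dots> = \<mu> * root m (\<mu> * (op_norm M S + 1))"
        using that mu by (simp add: real_root_mult real_root_power_cancel)
      finally show ?thesis .
    qed
    moreover have "(\<lambda>m. \<mu> * root m (\<mu> * (op_norm M S + 1))) \<longlonglongrightarrow> \<mu> * 1"
      using mu op_norm_nonneg[OF bS] by (intro tendsto_intros LIMSEQ_root_const) auto
    ultimately have "L \<le> \<mu> * 1"
      by (intro LIMSEQ_le[OF lim]) auto
    then show ?thesis by simp
  qed
  obtain R where R: "resolvent_at M P (complex_of_real L) R"
    using res[OF rL] by blast
  then have bR: "bounded_operator M R"
    by (simp add: resolvent_at_def)
  define K where "K = op_norm M R + 1"
  have K: "0 < K"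
    using op_norm_nonneg[OF bR] by (simp add: K_def)
  \<comment> \<open>The first bound keeps \<mu> = L - \<eta> above \<open>r\<close>. The second,
    through \<eta> K \<le> 1/8, gives the resolvent \<open>T\<close> at L + \<eta> norm at most 2 K
    and makes 2 \<eta> T a contraction with factor 1/2.\<close>
  define \<eta> where "\<eta> = min ((L - r) / 2) (1 / (8 * K))"
  have eta: "0 < \<eta>" "\<eta> \<le> (L - r) / 2" "\<eta> * K \<le> 1 / 8"
    using rL K by (auto simp: \<eta>_def min_def field_simps)
  define l \<mu> where "l = L + \<eta>" and "\<mu> = L - \<eta>"
  have l: "r < l" "0 < l" and mu: "r < \<mu>" "0 < \<mu>" "\<mu> < L"
    using eta r0 rL by (auto simp: l_def \<mu>_def field_simps)
  obtain T where T: "resolvent_at M P (complex_of_real l) T"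
    using res[OF l(1)] by blast
  then have bT: "bounded_operator M T"
    by (simp add: resolvent_at_def)
  \<comment> \<open>The resolvent identity T f = R (f - \<eta> T f) is solved for the norm of T f.
    Starting from the resolvent at \<open>L\<close> itself gives a bound chosen before
    \<eta>.\<close>
  have Tn: "l2_norm M (T f) \<le> 2 * K * l2_norm M f" if f: "f \<in> L2 M" for f
  proof -
    have Tf: "T f \<in> L2 M"
      by (rule bounded_operator_L2[OF bT f])
    have PTf: "P (T f) \<in> L2 M"
      by (rule bounded_operator_L2[OF P(1) Tf])
    let ?g = "\<lambda>x. complex_of_real L * T f x - P (T f) x"
    let ?h = "\<lambda>x. f x - complex_of_real \<eta> * T f x"
    have g: "?g \<in> L2 M" and h: "?h \<in> L2 M"
      by (intro L2_diff L2_scale Tf PTf f)+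
    have "AE x in M. R ?g x = T f x"
      using R Tf by (simp add: resolvent_at_def)
    moreover have "AE x in M. ?g x = ?h x"
    proof -
      have "AE x in M. complex_of_real l * T f x - P (T f) x = f x"
        using T f by (simp add: resolvent_at_def)
      then show ?thesis
        by eventually_elim (simp add: l_def algebra_simps)
    qed
    then have "AE x in M. R ?g x = R ?h x"
      by (rule linear_operatorD(2)[OF bounded_operator_linear[OF bR] g h])
    ultimately have "AE x in M. T f x = R ?h x"
      by eventually_elim simp
    then have "l2_norm M (T f) = l2_norm M (R ?h)"
      using Tf bounded_operator_L2[OF bR h] by (intro l2_norm_cong_AE) (auto simp: L2_def)
    also have "\<dots> \<le> op_norm M R * l2_norm M ?h"
      by (rule op_norm_bound[OF bR h])
    also have "\<dots> \<le> K * (l2_norm M f + \<eta> * l2_norm M (T f))"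
    proof (intro mult_mono)
      have "l2_norm M ?h \<le> l2_norm M f + l2_norm M (\<lambda>x. complex_of_real \<eta> * T f x)"
        by (intro L2_diff f L2_scale Tf)
      then show "l2_norm M ?h \<le> l2_norm M f + \<eta> * l2_norm M (T f)"
        using eta by (simp add: l2_norm_scale)
    qed (use K in \<open>auto simp: K_def\<close>)
    also have "\<dots> = K * l2_norm M f + (\<eta> * K) * l2_norm M (T f)"
      by (simp add: algebra_simps)
    also have "\<dots> \<le> K * l2_norm M f + 1 / 8 * l2_norm M (T f)"
      using eta by (intro add_left_mono mult_right_mono) auto
    finally have "7 / 8 * l2_norm M (T f) \<le> K * l2_norm M f"
      by simp
    moreover have "0 \<le> K * l2_norm M f"
      using K by simp
    ultimately show ?thesis
      by linarith
  qed
  \<comment> \<open>Since l > L, the powers of P/l tend to zero, and T f = f/l + (P/l) (T f) has the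
    shape required by \<open>nonneg_fun_fixed_point\<close>.\<close>
  have Tpos: "positivity_preserving M T"
    unfolding positivity_preserving_def
  proof (intro ballI impI)
    fix f assume f: "f \<in> L2 M" "nonneg_fun M f"
    let ?X = "\<lambda>f x. complex_of_real (1 / l) * P f x"
    have bX: "bounded_operator M ?X"
      by (rule bounded_operator_scale[OF P(1)])
    have Tf: "T f \<in> L2 M"
      by (rule bounded_operator_L2[OF bT f(1)])
    show "nonneg_fun M (T f)"
    proof (rule nonneg_fun_fixed_point[OF bX])
      show "positivity_preserving M ?X"
        unfolding positivity_preserving_def
      proof (intro ballI impI)
        fix h assume "h \<in> L2 M" "nonneg_fun M h"
        then show "nonneg_fun M (?X h)"
          using P(2) l by (intro nonneg_fun_scale) (auto simp: positivity_preserving_def)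
      qed
      show "(\<lambda>x. complex_of_real (1 / l) * f x) \<in> L2 M"
        by (rule L2_scale[OF f(1)])
      show "nonneg_fun M (\<lambda>x. complex_of_real (1 / l) * f x)"
        using f l by (intro nonneg_fun_scale) auto
      have "AE x in M. complex_of_real l * T f x - P (T f) x = f x"
        using T f by (simp add: resolvent_at_def)
      then show "AE x in M. T f x = complex_of_real (1 / l) * f x + ?X (T f) x"
      proof eventually_elim
        case (elim x)
        have "complex_of_real (1 / l) * f x + ?X (T f) x = complex_of_real (1 / l) * (f x + P (T f) x)"
          by (simp add: algebra_simps)
        also have "f x + P (T f) x = complex_of_real l * T f x"
          using elim by (simp add: algebra_simps)
        finally show ?case
          using l by simp
      qed
      have nX: "l2_norm M ((?X ^^ n) (T f)) = (1 / l) ^ n * l2_norm M ((P ^^ n) (T f))" for n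
      proof -
        have "l2_norm M ((?X ^^ n) (T f)) = l2_norm M (\<lambda>x. complex_of_real (1 / l) ^ n * (P ^^ n) (T f) x)"
          using bounded_operator_L2[OF bounded_operator_funpow[OF bX] Tf, of n]
            L2_scale[OF bounded_operator_L2[OF Pn Tf], of _ n]
          by (intro l2_norm_cong_AE linear_operator_funpow_scale P Tf) (auto simp: L2_def)
        then show ?thesis
          unfolding l2_norm_scale norm_power norm_of_real using l by simp
      qed
      obtain s where s: "L < s" "s < l"
        using dense[of L l] eta by (auto simp: l_def)
      have s0: "0 < s" using s rL r0 by linarith
      have "\<forall>\<^sub>F n in sequentially. root n (op_norm M (P ^^ n)) < s"
        using lim s(1) by (rule order_tendstoD)
      then have ev: "\<forall>\<^sub>F n in sequentially. l2_norm M ((?X ^^ n) (T f)) \<le> (s / l) ^ n * l2_norm M (T f)"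
        using eventually_gt_at_top[of 0]
      proof eventually_elim
        case (elim n)
        have nn: "0 \<le> op_norm M (P ^^ n)"
          by (intro op_norm_nonneg Pn)
        have "root n (op_norm M (P ^^ n)) ^ n \<le> s ^ n"
          using elim nn by (intro power_mono) auto
        then have "op_norm M (P ^^ n) \<le> s ^ n"
          using elim nn by simp
        then have "op_norm M (P ^^ n) * l2_norm M (T f) \<le> s ^ n * l2_norm M (T f)"
          by (intro mult_right_mono) auto
        then have "l2_norm M ((P ^^ n) (T f)) \<le> s ^ n * l2_norm M (T f)"
          using op_norm_bound[OF Pn Tf, of n] by linarith
        then have "(1 / l) ^ n * l2_norm M ((P ^^ n) (T f)) \<le> (1 / l) ^ n * (s ^ n * l2_norm M (T f))"
          using l by (intro mult_left_mono) auto
        then show ?case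
          unfolding nX by (simp add: power_divide)
      qed
      have "(\<lambda>n. (s / l) ^ n * l2_norm M (T f)) \<longlonglongrightarrow> 0 * l2_norm M (T f)"
        using s s0 l by (intro tendsto_intros LIMSEQ_realpow_zero) auto
      then show "(\<lambda>n. l2_norm M ((?X ^^ n) (T f))) \<longlonglongrightarrow> 0"
        by (intro tendsto_sandwich[OF _ ev tendsto_const]) auto
    qed (rule Tf)
  qed
  obtain S where S: "resolvent_at M P (complex_of_real \<mu>) S"
    using res[OF mu(1)] by blast
  then have bS: "bounded_operator M S"
    by (simp add: resolvent_at_def)
  have "positivity_preserving M S"
    unfolding positivity_preserving_def
  proof (intro ballI impI)
    fix f assume f: "f \<in> L2 M" "nonneg_fun M f"
    \<comment> \<open>\<open>t\<close> is l - \<mu>, so the resolvent identity reads S f = T f + t T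
      (S f), again a fixed point equation, now driven by the positive operator t T.\<close>
    define t where "t = 2 * \<eta>"
    let ?X = "\<lambda>f x. complex_of_real t * T f x"
    have bX: "bounded_operator M ?X"
      by (rule bounded_operator_scale[OF bT])
    have Sf: "S f \<in> L2 M"
      by (rule bounded_operator_L2[OF bS f(1)])
    have PSf: "P (S f) \<in> L2 M"
      by (rule bounded_operator_L2[OF P(1) Sf])
    have t: "0 \<le> t" "t * (2 * K) \<le> 1 / 2"
      using eta by (auto simp: t_def)
    show "nonneg_fun M (S f)"
    proof (rule nonneg_fun_fixed_point[OF bX])
      show "positivity_preserving M ?X"
        unfolding positivity_preserving_def
      proof (intro ballI impI)
        fix h assume "h \<in> L2 M" "nonneg_fun M h"
        then show "nonneg_fun M (?X h)"
          using Tpos t by (intro nonneg_fun_scale) (auto simp: positivity_preserving_def)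
      qed
      show "T f \<in> L2 M"
        by (rule bounded_operator_L2[OF bT f(1)])
      show "nonneg_fun M (T f)"
        using Tpos f by (simp add: positivity_preserving_def)
      let ?g = "\<lambda>x. complex_of_real l * S f x - P (S f) x"
      let ?h = "\<lambda>x. f x + complex_of_real t * S f x"
      have "AE x in M. T ?g x = S f x"
        using T Sf by (simp add: resolvent_at_def)
      moreover have "AE x in M. ?g x = ?h x"
      proof -
        have "AE x in M. complex_of_real \<mu> * S f x - P (S f) x = f x"
          using S f by (simp add: resolvent_at_def)
        then show ?thesis
          by eventually_elim (simp add: l_def \<mu>_def t_def algebra_simps)
      qed
      then have "AE x in M. T ?g x = T ?h x"
        by (intro linear_operatorD(2)[OF bounded_operator_linear[OF bT]] L2_diff L2_add L2_scale f Sf PSf)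
      moreover have "AE x in M. T ?h x = T f x + T (\<lambda>x. complex_of_real t * S f x) x"
        by (intro linear_operatorD(3)[OF bounded_operator_linear[OF bT]] L2_scale f Sf)
      moreover have "AE x in M. T (\<lambda>x. complex_of_real t * S f x) x = complex_of_real t * T (S f) x"
        by (intro linear_operatorD(4)[OF bounded_operator_linear[OF bT]] Sf)
      ultimately show "AE x in M. S f x = T f x + ?X (S f) x"
        by eventually_elim simp
      have "l2_norm M (?X h) \<le> (1 / 2) * l2_norm M h" if "h \<in> L2 M" for h
      proof -
        have "l2_norm M (?X h) = t * l2_norm M (T h)"
          using t by (simp add: l2_norm_scale)
        also have "\<dots> \<le> t * (2 * K * l2_norm M h)"
          using t by (intro mult_left_mono Tn that) auto
        also have "\<dots> = (t * (2 * K)) * l2_norm M h"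
          by simp
        also have "\<dots> \<le> (1 / 2) * l2_norm M h"
          using t by (intro mult_right_mono) auto
        finally show ?thesis .
      qed
      then have le: "l2_norm M ((?X ^^ n) (S f)) \<le> (1 / 2) ^ n * l2_norm M (S f)" for n
        by (intro l2_norm_funpow_le bX Sf) auto
      have "(\<lambda>n. (1 / 2) ^ n * l2_norm M (S f)) \<longlonglongrightarrow> 0 * l2_norm M (S f)"
        by (intro tendsto_intros LIMSEQ_realpow_zero) auto
      then have lim0: "(\<lambda>n. (1 / 2) ^ n * l2_norm M (S f)) \<longlonglongrightarrow> 0"
        by simp
      show "(\<lambda>n. l2_norm M ((?X ^^ n) (S f))) \<longlonglongrightarrow> 0"
        by (rule tendsto_sandwich[OF always_eventually always_eventually tendsto_const lim0])
           (use le in auto)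
    qed (rule Sf)
  qed
  then have "L \<le> \<mu>"
    by (rule dominate[OF mu(2) S])
  with mu(3) show False by simp
qed

section \<open>Weighted geometric means of radii\<close>

text \<open>Through \<open>kpow\<close> the endpoints are exact: for nonnegative arguments the mean
  is \<open>y\<close> at \<alpha> = 0 and \<open>x\<close> at \<alpha> = 1, even if the other
  argument vanishes.\<close>

definition gmean :: "real \<Rightarrow> real \<Rightarrow> real \<Rightarrow> real" where
  "gmean \<alpha> x y = kpow x \<alpha> * kpow y (1 - \<alpha>)"

lemma kpow_nonneg [simp]: "0 \<le> kpow x \<alpha>"
  by (simp add: kpow_def)

lemma kpow_mono: "0 \<le> x \<Longrightarrow> x \<le> y \<Longrightarrow> 0 \<le> \<alpha> \<Longrightarrow> kpow x \<alpha> \<le> kpow y \<alpha>"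
  by (auto simp: kpow_def intro: powr_mono2)

lemma kpow_mult: "0 \<le> x \<Longrightarrow> 0 \<le> y \<Longrightarrow> kpow (x * y) \<alpha> = kpow x \<alpha> * kpow y \<alpha>"
  by (simp add: kpow_def powr_mult)

text \<open>Nonnegative exponents cannot cancel to exponent 0, where \<open>kpow\<close> jumps at
  base 0.\<close>

lemma kpow_add: "0 \<le> a \<Longrightarrow> 0 \<le> b \<Longrightarrow> kpow x (a + b) = kpow x a * kpow x b"
  by (auto simp: kpow_def powr_add)

lemma kpow_kpow: "kpow (kpow x a) b = kpow x (a * b)"
  by (simp add: kpow_def powr_powr)

lemma kpow_1 [simp]: "0 \<le> x \<Longrightarrow> kpow x 1 = x"
  by (simp add: kpow_def)

lemma kpow_power: "0 \<le> x \<Longrightarrow> kpow (x ^ n) \<alpha> = kpow x \<alpha> ^ n"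
  by (induction n) (simp_all add: kpow_mult, simp add: kpow_def)

lemma root_kpow:
  assumes "0 < n" "0 \<le> x"
  shows "root n (kpow x \<alpha>) = kpow (root n x) \<alpha>"
  using assms by (intro real_root_pos_unique) (auto simp: kpow_power[symmetric])

lemma tendsto_kpow:
  assumes "(f \<longlongrightarrow> a) F" "\<forall>\<^sub>F x in F. 0 \<le> f x" "0 \<le> \<alpha>"
  shows "((\<lambda>x. kpow (f x) \<alpha>) \<longlongrightarrow> kpow a \<alpha>) F"
  using assms by (cases "\<alpha> = 0") (auto simp: kpow_def intro!: tendsto_powr2)

lemma gmean_nonneg [simp]: "0 \<le> gmean \<alpha> x y"
  by (simp add: gmean_def)

lemma gmean_mono:
  "\<alpha> \<in> {0..1} \<Longrightarrow> 0 \<le> x \<Longrightarrow> x \<le> x' \<Longrightarrow> 0 \<le> y \<Longrightarrow> y \<le> y' \<Longrightarrow> gmean \<alpha> x y \<le> gmean \<alpha> x' y'"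
  unfolding gmean_def by (intro mult_mono kpow_mono) auto

lemma gmean_mult:
  "0 \<le> x \<Longrightarrow> 0 \<le> x' \<Longrightarrow> 0 \<le> y \<Longrightarrow> 0 \<le> y' \<Longrightarrow> gmean \<alpha> (x * x') (y * y') = gmean \<alpha> x y * gmean \<alpha> x' y'"
  by (simp add: gmean_def kpow_mult)

lemma gmean_swap_mult:
  assumes "\<alpha> \<in> {0..1}" "0 \<le> x" "0 \<le> y"
  shows "gmean \<alpha> x y * gmean \<alpha> y x = x * y"
proof -
  have "gmean \<alpha> x y * gmean \<alpha> y x = (kpow x \<alpha> * kpow x (1 - \<alpha>)) * (kpow y \<alpha> * kpow y (1 - \<alpha>))"
    by (simp add: gmean_def)
  then show ?thesis
    using assms by (simp add: kpow_add[symmetric])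
qed

lemma gmean_self: "\<alpha> \<in> {0..1} \<Longrightarrow> 0 \<le> x \<Longrightarrow> gmean \<alpha> x x = x"
  by (simp add: gmean_def kpow_add[symmetric])

text \<open>Collecting exponents of \<open>x\<close> gives t \<alpha> + (1 - t) (1 - \<alpha>), and
  those of \<open>y\<close> the complement to 1. This identity is what makes a mean with one
  parameter a mean of two means with another.\<close>

lemma gmean_gmean:
  assumes "\<alpha> \<in> {0..1}" "t \<in> {0..1}" "0 \<le> x" "0 \<le> y"
  shows "gmean t (gmean \<alpha> x y) (gmean \<alpha> y x) = gmean (t * \<alpha> + (1 - t) * (1 - \<alpha>)) x y"
proof -
  let ?b = "t * \<alpha> + (1 - t) * (1 - \<alpha>)"
  have b: "1 - ?b = (1 - \<alpha>) * t + \<alpha> * (1 - t)"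
    by (simp add: algebra_simps)
  have "gmean t (gmean \<alpha> x y) (gmean \<alpha> y x)
      = (kpow x (\<alpha> * t) * kpow x ((1 - \<alpha>) * (1 - t))) * (kpow y ((1 - \<alpha>) * t) * kpow y (\<alpha> * (1 - t)))"
    by (simp add: gmean_def kpow_mult kpow_kpow)
  also have "\<dots> = kpow x (\<alpha> * t + (1 - \<alpha>) * (1 - t)) * kpow y ((1 - \<alpha>) * t + \<alpha> * (1 - t))"
    using assms by (simp add: kpow_add)
  also have "\<dots> = gmean ?b x y"
    unfolding gmean_def b by (simp add: mult.commute)
  finally show ?thesis .
qed

lemma root_gmean: "0 < n \<Longrightarrow> 0 \<le> x \<Longrightarrow> 0 \<le> y \<Longrightarrow> root n (gmean \<alpha> x y) = gmean \<alpha> (root n x) (root n y)"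
  by (simp add: gmean_def real_root_mult root_kpow)

lemma tendsto_gmean:
  assumes "(f \<longlongrightarrow> a) F" "(g \<longlongrightarrow> b) F" "\<forall>\<^sub>F x in F. 0 \<le> f x" "\<forall>\<^sub>F x in F. 0 \<le> g x" "\<alpha> \<in> {0..1}"
  shows "((\<lambda>x. gmean \<alpha> (f x) (g x)) \<longlongrightarrow> gmean \<alpha> a b) F"
  unfolding gmean_def using assms by (intro tendsto_mult tendsto_kpow) auto

text \<open>Measures of noncompactness and upper limits are reached only from strictly above;
  continuity of the mean in both arguments, also at the endpoints of \<alpha>, closes the
  gap.\<close>

lemma le_gmean_limit:
  assumes "\<And>d e. a < d \<Longrightarrow> b < e \<Longrightarrow> c \<le> gmean \<alpha> d e" "0 \<le> a" "0 \<le> b" "\<alpha> \<in> {0..1}"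
  shows "c \<le> gmean \<alpha> a b"
proof -
  have "(\<lambda>n. gmean \<alpha> (a + 1 / real (Suc n)) (b + 1 / real (Suc n))) \<longlonglongrightarrow> gmean \<alpha> (a + 0) (b + 0)"
    using assms by (intro tendsto_gmean tendsto_intros LIMSEQ_Suc[OF lim_1_over_n]) auto
  then show ?thesis
    using assms(1)[of "a + 1 / real (Suc _)" "b + 1 / real (Suc _)"] by (intro LIMSEQ_le_const[of _ "gmean \<alpha> a b"]) auto
qed

lemma Sup0_gmean:
  assumes "\<alpha> \<in> {0..1}" "bdd_above (\<phi> ` \<Gamma>)" "bdd_above (\<phi> ` \<Theta>)"
    and nonneg: "\<And>A. A \<in> \<Gamma> \<union> \<Theta> \<Longrightarrow> 0 \<le> \<phi> A"
    and le: "\<And>C. C \<in> \<Sigma> \<Longrightarrow> \<exists>P\<in>\<Gamma>. \<exists>Q\<in>\<Theta>. \<phi> C \<le> gmean \<alpha> (\<phi> P) (\<phi> Q)"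
  shows "Sup0 (\<phi> ` \<Sigma>) \<le> gmean \<alpha> (Sup0 (\<phi> ` \<Gamma>)) (Sup0 (\<phi> ` \<Theta>))"
proof (rule Sup0_least)
  fix x assume "x \<in> \<phi> ` \<Sigma>"
  then obtain P Q where "P \<in> \<Gamma>" "Q \<in> \<Theta>" "x \<le> gmean \<alpha> (\<phi> P) (\<phi> Q)"
    using le by blast
  moreover from this have "gmean \<alpha> (\<phi> P) (\<phi> Q) \<le> gmean \<alpha> (Sup0 (\<phi> ` \<Gamma>)) (Sup0 (\<phi> ` \<Theta>))"
    using assms by (intro gmean_mono Sup0_upper) auto
  ultimately show "x \<le> gmean \<alpha> (Sup0 (\<phi> ` \<Gamma>)) (Sup0 (\<phi> ` \<Theta>))"
    by linarith
qed simp

text \<open>\<open>real_of_ereal\<close> sends infinite values to 0, so the two upper limits on the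
  right must first be shown finite; the bound \<open>B\<close> serves that end. Index 0 is exempt
  from the comparison because \<open>root 0\<close> is constantly 0.\<close>

lemma limsup_gmean:
  fixes c x y :: "nat \<Rightarrow> real"
  assumes \<alpha>: "\<alpha> \<in> {0..1}" and c: "\<And>n. 0 \<le> c n" "\<And>n. 0 < n \<Longrightarrow> c n \<le> gmean \<alpha> (x n) (y n)"
    and x: "\<And>n. 0 \<le> x n" "\<And>n. x n \<le> B" and y: "\<And>n. 0 \<le> y n" "\<And>n. y n \<le> B"
  shows "real_of_ereal (limsup (\<lambda>n. ereal (c n)))
    \<le> gmean \<alpha> (real_of_ereal (limsup (\<lambda>n. ereal (x n)))) (real_of_ereal (limsup (\<lambda>n. ereal (y n))))"
proof -
  have fin: "\<exists>X\<ge>0. limsup (\<lambda>n. ereal (z n)) = ereal X" if z: "\<And>n. 0 \<le> z n" "\<And>n. z n \<le> B" for z :: "nat \<Rightarrow> real"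
  proof -
    have "limsup (\<lambda>n. ereal (z n)) \<le> ereal B"
      by (rule Limsup_bounded) (use z in auto)
    moreover have "0 \<le> limsup (\<lambda>n. ereal (z n))"
      by (rule order_trans[OF _ Liminf_le_Limsup]) (use z in \<open>auto intro!: Liminf_bounded\<close>)
    ultimately show ?thesis
      by (cases "limsup (\<lambda>n. ereal (z n))") auto
  qed
  obtain X where X: "0 \<le> X" "limsup (\<lambda>n. ereal (x n)) = ereal X"
    using fin[of x] x by blast
  obtain Y where Y: "0 \<le> Y" "limsup (\<lambda>n. ereal (y n)) = ereal Y"
    using fin[of y] y by blast
  have "real_of_ereal (limsup (\<lambda>n. ereal (c n))) \<le> gmean \<alpha> X Y"
  proof (rule le_gmean_limit)
    fix d e assume d: "X < d" and e: "Y < e"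
    have "\<forall>\<^sub>F n in sequentially. ereal (x n) < ereal d"
      by (rule Limsup_lessD) (use X d in simp)
    moreover have "\<forall>\<^sub>F n in sequentially. ereal (y n) < ereal e"
      by (rule Limsup_lessD) (use Y e in simp)
    ultimately have "\<forall>\<^sub>F n in sequentially. ereal (c n) \<le> ereal (gmean \<alpha> d e)"
      using eventually_gt_at_top[of 0]
    proof eventually_elim
      case (elim n)
      then have "gmean \<alpha> (x n) (y n) \<le> gmean \<alpha> d e"
        using x y by (intro gmean_mono \<alpha>) auto
      then show ?case
        using c(2)[of n] elim by simp
    qed
    then have "limsup (\<lambda>n. ereal (c n)) \<le> ereal (gmean \<alpha> d e)"
      by (rule Limsup_bounded)
    moreover have "0 \<le> limsup (\<lambda>n. ereal (c n))"
      by (rule order_trans[OF _ Liminf_le_Limsup]) (use c in \<open>auto intro!: Liminf_bounded\<close>)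
    ultimately show "real_of_ereal (limsup (\<lambda>n. ereal (c n))) \<le> gmean \<alpha> d e"
      by (cases "limsup (\<lambda>n. ereal (c n))") auto
  qed (use X Y \<alpha> in auto)
  then show ?thesis
    by (simp add: X Y)
qed

lemma Sup0_op_set_power:
  assumes "submultiplicative M \<phi>" "bounded_set M \<Sigma>"
  shows "bdd_above (\<phi> ` op_set_power \<Sigma> n)" "0 \<le> Sup0 (\<phi> ` op_set_power \<Sigma> n)"
    "A \<in> op_set_power \<Sigma> n \<Longrightarrow> 0 \<le> \<phi> A"
proof -
  show *: "bdd_above (\<phi> ` op_set_power \<Sigma> n)"
    using assms by (intro bdd_above_image_op_norm[where M = M] bounded_set_power) (auto simp: submultiplicative_def)
  then show "0 \<le> Sup0 (\<phi> ` op_set_power \<Sigma> n)"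
    by (rule Sup0_nonneg)
  show "0 \<le> \<phi> A" if "A \<in> op_set_power \<Sigma> n"
    using assms(1) bounded_setD[OF bounded_set_power[OF assms(2)] that] by (simp add: submultiplicative_def)
qed

text \<open>The comparison is demanded for positive powers only: the power 0 consists of
  \<open>id\<close>, for which no kernel is available.\<close>

lemma lim_gmean:
  assumes \<alpha>: "\<alpha> \<in> {0..1}" and \<phi>: "submultiplicative M \<phi>"
    and b: "bounded_set M \<Sigma>" "bounded_set M \<Gamma>" "bounded_set M \<Theta>"
    and le: "\<And>n C. 0 < n \<Longrightarrow> C \<in> op_set_power \<Sigma> n \<Longrightarrow>
      \<exists>P\<in>op_set_power \<Gamma> n. \<exists>Q\<in>op_set_power \<Theta> n. \<phi> C \<le> gmean \<alpha> (\<phi> P) (\<phi> Q)"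
  shows "lim (\<lambda>n. root n (Sup0 (\<phi> ` op_set_power \<Sigma> n)))
    \<le> gmean \<alpha> (lim (\<lambda>n. root n (Sup0 (\<phi> ` op_set_power \<Gamma> n)))) (lim (\<lambda>n. root n (Sup0 (\<phi> ` op_set_power \<Theta> n))))"
proof (rule LIMSEQ_le)
  show "(\<lambda>n. root n (Sup0 (\<phi> ` op_set_power \<Sigma> n))) \<longlonglongrightarrow> lim (\<lambda>n. root n (Sup0 (\<phi> ` op_set_power \<Sigma> n)))"
    using convergent_joint[OF \<phi> b(1)] by (simp add: convergent_LIMSEQ_iff)
  show "(\<lambda>n. gmean \<alpha> (root n (Sup0 (\<phi> ` op_set_power \<Gamma> n))) (root n (Sup0 (\<phi> ` op_set_power \<Theta> n))))
      \<longlonglongrightarrow> gmean \<alpha> (lim (\<lambda>n. root n (Sup0 (\<phi> ` op_set_power \<Gamma> n)))) (lim (\<lambda>n. root n (Sup0 (\<phi> ` op_set_power \<Theta> n))))"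
    using convergent_joint[OF \<phi> b(2)] convergent_joint[OF \<phi> b(3)] Sup0_op_set_power(2)[OF \<phi> b(2)]
      Sup0_op_set_power(2)[OF \<phi> b(3)] \<alpha>
    by (intro tendsto_gmean) (auto simp: convergent_LIMSEQ_iff intro!: always_eventually real_root_ge_zero)
  have "root n (Sup0 (\<phi> ` op_set_power \<Sigma> n))
      \<le> gmean \<alpha> (root n (Sup0 (\<phi> ` op_set_power \<Gamma> n))) (root n (Sup0 (\<phi> ` op_set_power \<Theta> n)))" if "0 < n" for n
  proof -
    have "Sup0 (\<phi> ` op_set_power \<Sigma> n) \<le> gmean \<alpha> (Sup0 (\<phi> ` op_set_power \<Gamma> n)) (Sup0 (\<phi> ` op_set_power \<Theta> n))"
      using Sup0_op_set_power[OF \<phi> b(2)] Sup0_op_set_power[OF \<phi> b(3)] le[OF that] by (intro Sup0_gmean \<alpha>) auto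
    then show ?thesis
      using that Sup0_op_set_power(2)[OF \<phi> b(2)] Sup0_op_set_power(2)[OF \<phi> b(3)]
      by (simp add: root_gmean[symmetric])
  qed
  then show "\<exists>N. \<forall>n\<ge>N. root n (Sup0 (\<phi> ` op_set_power \<Sigma> n))
      \<le> gmean \<alpha> (root n (Sup0 (\<phi> ` op_set_power \<Gamma> n))) (root n (Sup0 (\<phi> ` op_set_power \<Theta> n)))"
    by (intro exI[of _ 1]) auto
qed

lemma limsup_root_gmean:
  assumes \<alpha>: "\<alpha> \<in> {0..1}" and \<phi>: "\<And>A. bounded_operator M A \<Longrightarrow> 0 \<le> \<phi> A \<and> \<phi> A \<le> op_norm M A"
    and b: "bounded_set M \<Sigma>" "bounded_set M \<Gamma>" "bounded_set M \<Theta>"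
    and le: "\<And>n C. 0 < n \<Longrightarrow> C \<in> op_set_power \<Sigma> n \<Longrightarrow>
      \<exists>P\<in>op_set_power \<Gamma> n. \<exists>Q\<in>op_set_power \<Theta> n. \<phi> C \<le> gmean \<alpha> (\<phi> P) (\<phi> Q)"
  shows "real_of_ereal (limsup (\<lambda>n. ereal (root n (Sup0 (\<phi> ` op_set_power \<Sigma> n)))))
    \<le> gmean \<alpha> (real_of_ereal (limsup (\<lambda>n. ereal (root n (Sup0 (\<phi> ` op_set_power \<Gamma> n))))))
        (real_of_ereal (limsup (\<lambda>n. ereal (root n (Sup0 (\<phi> ` op_set_power \<Theta> n))))))"
proof -
  have bd: "bdd_above (\<phi> ` op_set_power \<Phi> n)" if "bounded_set M \<Phi>" for \<Phi> n
    using \<phi> that by (intro bdd_above_image_op_norm[where M = M] bounded_set_power) auto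
  have nn: "0 \<le> Sup0 (\<phi> ` op_set_power \<Phi> n)" if "bounded_set M \<Phi>" for \<Phi> n
    by (intro Sup0_nonneg bd that)
  have nn': "0 \<le> \<phi> A" if "bounded_set M \<Phi>" "A \<in> op_set_power \<Phi> n" for \<Phi> A n
    using \<phi> bounded_setD[OF bounded_set_power[OF that(1)] that(2)] by blast
  \<comment> \<open>The corresponding roots for \<open>op_norm\<close> converge by
    \<open>convergent_joint\<close>, hence are bounded, and they majorize the roots for
    \<phi>.\<close>
  have Bex: "\<exists>B. \<forall>n. root n (Sup0 (\<phi> ` op_set_power \<Phi> n)) \<le> B" if \<Phi>: "bounded_set M \<Phi>" for \<Phi>
  proof -
    have "Bseq (\<lambda>n. root n (Sup0 (op_norm M ` op_set_power \<Phi> n)))"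
      by (rule convergent_imp_Bseq[OF convergent_joint[OF submultiplicative_op_norm \<Phi>]])
    then obtain B where B: "\<And>n. norm (root n (Sup0 (op_norm M ` op_set_power \<Phi> n))) \<le> B"
      by (auto simp: Bseq_def)
    have "root n (Sup0 (\<phi> ` op_set_power \<Phi> n)) \<le> B" for n
    proof (cases "n = 0")
      case True
      then show ?thesis using B[of 0] by simp
    next
      case False
      have "Sup0 (\<phi> ` op_set_power \<Phi> n) \<le> Sup0 (op_norm M ` op_set_power \<Phi> n)"
      proof (rule Sup0_least[OF Sup0_op_set_power(2)[OF submultiplicative_op_norm \<Phi>]])
        fix x assume "x \<in> \<phi> ` op_set_power \<Phi> n"
        then obtain A where A: "A \<in> op_set_power \<Phi> n" "x = \<phi> A" by blast
        then have "x \<le> op_norm M A"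
          using \<phi> bounded_setD[OF bounded_set_power[OF \<Phi>]] by blast
        also have "\<dots> \<le> Sup0 (op_norm M ` op_set_power \<Phi> n)"
          using A by (intro Sup0_upper Sup0_op_set_power(1)[OF submultiplicative_op_norm \<Phi>]) auto
        finally show "x \<le> Sup0 (op_norm M ` op_set_power \<Phi> n)" .
      qed
      then have "root n (Sup0 (\<phi> ` op_set_power \<Phi> n)) \<le> root n (Sup0 (op_norm M ` op_set_power \<Phi> n))"
        using False by simp
      then show ?thesis
        using B[of n] by simp
    qed
    then show ?thesis by blast
  qed
  obtain B1 where B1: "\<And>n. root n (Sup0 (\<phi> ` op_set_power \<Gamma> n)) \<le> B1"
    using Bex[OF b(2)] by blast
  obtain B2 where B2: "\<And>n. root n (Sup0 (\<phi> ` op_set_power \<Theta> n)) \<le> B2"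
    using Bex[OF b(3)] by blast
  show ?thesis
  proof (rule limsup_gmean[OF \<alpha>, of _ _ _ "max B1 B2"])
    fix n :: nat assume n: "0 < n"
    have "Sup0 (\<phi> ` op_set_power \<Sigma> n) \<le> gmean \<alpha> (Sup0 (\<phi> ` op_set_power \<Gamma> n)) (Sup0 (\<phi> ` op_set_power \<Theta> n))"
      using nn' b le[OF n] by (intro Sup0_gmean \<alpha> bd) auto
    then show "root n (Sup0 (\<phi> ` op_set_power \<Sigma> n))
      \<le> gmean \<alpha> (root n (Sup0 (\<phi> ` op_set_power \<Gamma> n))) (root n (Sup0 (\<phi> ` op_set_power \<Theta> n)))"
      using n nn b by (simp add: root_gmean[symmetric])
  qed (use nn b B1 B2 in \<open>auto simp: le_max_iff_disj real_root_ge_zero\<close>)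
qed

section \<open>Kernels of positive operators\<close>

definition epow :: "ennreal \<Rightarrow> real \<Rightarrow> ennreal" where
  "epow x \<alpha> = (if \<alpha> = 0 then 1 else if x = top then top else ennreal (enn2real x powr \<alpha>))"

text \<open>Composed kernels are integrals and may take the value \<open>top\<close>. The convention
  0 times \<open>top\<close> = 0 keeps this extension of \<open>gmean\<close>
  multiplicative.\<close>

definition egmean :: "real \<Rightarrow> ennreal \<Rightarrow> ennreal \<Rightarrow> ennreal" where
  "egmean \<alpha> x y = epow x \<alpha> * epow y (1 - \<alpha>)"

lemma epow_ennreal: "0 \<le> x \<Longrightarrow> epow (ennreal x) \<alpha> = ennreal (kpow x \<alpha>)"
  by (simp add: epow_def kpow_def)

lemma egmean_ennreal: "0 \<le> x \<Longrightarrow> 0 \<le> y \<Longrightarrow> egmean \<alpha> (ennreal x) (ennreal y) = ennreal (gmean \<alpha> x y)"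
  by (simp add: egmean_def gmean_def epow_ennreal ennreal_mult)

lemma epow_mono: "x \<le> y \<Longrightarrow> 0 \<le> \<alpha> \<Longrightarrow> epow x \<alpha> \<le> epow y \<alpha>"
  by (cases "\<alpha> = 0"; cases x; cases y)
     (auto simp: epow_def top_unique intro!: ennreal_leI powr_mono2)

lemma epow_eq_0_iff: "0 < \<alpha> \<Longrightarrow> epow x \<alpha> = 0 \<longleftrightarrow> x = 0"
  by (cases x) (auto simp: epow_def ennreal_eq_0_iff)

lemma epow_mult:
  assumes "0 \<le> \<alpha>"
  shows "epow (x * y) \<alpha> = epow x \<alpha> * epow y \<alpha>"
proof (cases "\<alpha> = 0")
  case False
  with assms have \<alpha>: "0 < \<alpha>" by simp
  have top: "epow (top * z) \<alpha> = epow top \<alpha> * epow z \<alpha>" for z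
  proof (cases "z = 0")
    case True
    then show ?thesis using \<alpha> by (simp add: epow_def)
  next
    case False
    then have "epow z \<alpha> \<noteq> 0"
      using \<alpha> by (simp add: epow_eq_0_iff)
    with False \<alpha> show ?thesis
      by (simp add: ennreal_top_mult) (simp add: epow_def ennreal_top_mult)
  qed
  show ?thesis
  proof (cases "x = top \<or> y = top")
    case True
    then show ?thesis
      using top[of x] top[of y] by (auto simp: mult.commute)
  next
    case False
    then obtain r s where "x = ennreal r" "0 \<le> r" "y = ennreal s" "0 \<le> s"
      by (metis ennreal_cases)
    then show ?thesis
      by (simp add: ennreal_mult[symmetric] epow_ennreal kpow_mult)
  qed
qed (simp add: epow_def)

lemma epow_1: "epow x 1 = x"
  by (cases x) (auto simp: epow_def)

lemma epow_0_left: "0 < \<alpha> \<Longrightarrow> epow 0 \<alpha> = 0"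
  by (simp add: epow_def)

lemma epow_top: "0 < \<alpha> \<Longrightarrow> epow top \<alpha> = top"
  by (simp add: epow_def)

lemma measurable_epow [measurable]:
  assumes [measurable]: "f \<in> borel_measurable M"
  shows "(\<lambda>x. epow (f x) \<alpha>) \<in> borel_measurable M"
  unfolding epow_def by measurable

lemma measurable_egmean [measurable]:
  assumes [measurable]: "f \<in> borel_measurable M" "g \<in> borel_measurable M"
  shows "(\<lambda>x. egmean \<alpha> (f x) (g x)) \<in> borel_measurable M"
  unfolding egmean_def by measurable

lemma egmean_mono:
  "\<alpha> \<in> {0..1} \<Longrightarrow> x \<le> x' \<Longrightarrow> y \<le> y' \<Longrightarrow> egmean \<alpha> x y \<le> egmean \<alpha> x' y'"
  unfolding egmean_def by (intro mult_mono epow_mono) auto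

lemma egmean_mult: "\<alpha> \<in> {0..1} \<Longrightarrow> egmean \<alpha> (x * x') (y * y') = egmean \<alpha> x y * egmean \<alpha> x' y'"
  by (simp add: egmean_def epow_mult ac_simps)

lemma egmean_self: "\<alpha> \<in> {0..1} \<Longrightarrow> egmean \<alpha> x x = x"
proof (cases x)
  case (real r)
  assume "\<alpha> \<in> {0..1}"
  with real show ?thesis
    by (simp add: egmean_ennreal gmean_self)
next
  case top
  then show ?thesis
    by (auto simp: egmean_def epow_def)
qed

text \<open>The right side is the tangent plane of the concave, homogeneous mean at (F, G). Being
  linear in \<open>a\<close> and \<open>b\<close>, it can be integrated.\<close>

lemma gmean_young:
  assumes \<alpha>: "0 < \<alpha>" "\<alpha> < 1" and a: "0 \<le> a" "0 \<le> b" "0 < F" "0 < G"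
  shows "gmean \<alpha> a b \<le> gmean \<alpha> F G * (\<alpha> * (a / F) + (1 - \<alpha>) * (b / G))"
proof (cases "a = 0 \<or> b = 0")
  case True
  then have "gmean \<alpha> a b = 0"
    using \<alpha> by (auto simp: gmean_def kpow_def)
  moreover have "0 \<le> gmean \<alpha> F G * (\<alpha> * (a / F) + (1 - \<alpha>) * (b / G))"
    using \<alpha> a by (intro mult_nonneg_nonneg add_nonneg_nonneg divide_nonneg_nonneg) auto
  ultimately show ?thesis by simp
next
  case False
  have "gmean \<alpha> a b = gmean \<alpha> (F * (a / F)) (G * (b / G))"
    using a by simp
  also have "\<dots> = gmean \<alpha> F G * gmean \<alpha> (a / F) (b / G)"
    using a by (intro gmean_mult) auto
  also have "gmean \<alpha> (a / F) (b / G) \<le> \<alpha> * (a / F) + (1 - \<alpha>) * (b / G)"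
    using Youngs_inequality_0[of \<alpha> "1 - \<alpha>" "a / F" "b / G"] False a \<alpha> by (simp add: gmean_def kpow_def)
  finally show ?thesis
    by (simp add: mult_left_mono)
qed

text \<open>Hoelder's inequality for the exponents 1/\<alpha> and 1/(1 - \<alpha>). The linear bound
  of \<open>gmean_young\<close> is taken at the two integrals themselves, so that integrating it
  returns exactly their mean. Vanishing and infinite integrals admit no such normalization and are
  treated apart.\<close>

lemma nn_integral_egmean_le:
  assumes \<alpha>: "\<alpha> \<in> {0..1}" and [measurable]: "f \<in> borel_measurable M" "g \<in> borel_measurable M"
  shows "(\<integral>\<^sup>+x. egmean \<alpha> (f x) (g x) \<partial>M) \<le> egmean \<alpha> (\<integral>\<^sup>+x. f x \<partial>M) (\<integral>\<^sup>+x. g x \<partial>M)"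
proof -
  consider "\<alpha> = 0" | "\<alpha> = 1" | "0 < \<alpha>" "\<alpha> < 1"
    using \<alpha> by force
  then show ?thesis
  proof cases
    case 1
    then show ?thesis by (simp add: egmean_def epow_1) (simp add: epow_def)
  next
    case 2
    then show ?thesis by (simp add: egmean_def epow_1) (simp add: epow_def)
  next
    case 3
    let ?F = "\<integral>\<^sup>+x. f x \<partial>M" and ?G = "\<integral>\<^sup>+x. g x \<partial>M"
    show ?thesis
    proof (cases "?F = 0 \<or> ?G = 0")
      case True
      then have "(AE x in M. f x = 0) \<or> (AE x in M. g x = 0)"
        by (simp add: nn_integral_0_iff_AE)
      then have "AE x in M. egmean \<alpha> (f x) (g x) = 0"
        using 3 by (auto simp: egmean_def epow_0_left elim!: eventually_mono)
      then have "(\<integral>\<^sup>+x. egmean \<alpha> (f x) (g x) \<partial>M) = 0"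
        by (simp add: nn_integral_0_iff_AE)
      then show ?thesis by simp
    next
      case False
      show ?thesis
      proof (cases "?F = top \<or> ?G = top")
        case True
        have "epow ?F \<alpha> \<noteq> 0" "epow ?G (1 - \<alpha>) \<noteq> 0"
          using False 3 by (auto simp: epow_def enn2real_eq_0_iff)
        with True have "egmean \<alpha> ?F ?G = top"
          using 3 by (auto simp: egmean_def epow_top ennreal_mult_eq_top_iff)
        then show ?thesis by simp
      next
        case fin: False
        obtain F G where FG: "?F = ennreal F" "0 \<le> F" "?G = ennreal G" "0 \<le> G"
          using fin by (metis ennreal_cases)
        with False have pos: "0 < F" "0 < G"
          by auto
        let ?c = "gmean \<alpha> F G"
        have "AE x in M. f x \<noteq> \<infinity>" "AE x in M. g x \<noteq> \<infinity>"
          using fin by (intro nn_integral_noteq_infinite; simp)+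
        then have "AE x in M. egmean \<alpha> (f x) (g x) \<le> ennreal (?c * \<alpha> / F) * f x + ennreal (?c * (1 - \<alpha>) / G) * g x"
        proof eventually_elim
          case (elim x)
          obtain a b where ab: "f x = ennreal a" "0 \<le> a" "g x = ennreal b" "0 \<le> b"
            using elim by (metis ennreal_cases infinity_ennreal_def)
          have nn: "0 \<le> ?c * \<alpha> / F" "0 \<le> ?c * (1 - \<alpha>) / G"
            using pos 3 by auto
          have "egmean \<alpha> (f x) (g x) = ennreal (gmean \<alpha> a b)"
            using ab by (simp add: egmean_ennreal)
          also have "\<dots> \<le> ennreal (?c * (\<alpha> * (a / F) + (1 - \<alpha>) * (b / G)))"
            using 3 ab pos by (intro ennreal_leI gmean_young) auto
          also have "?c * (\<alpha> * (a / F) + (1 - \<alpha>) * (b / G)) = ?c * \<alpha> / F * a + ?c * (1 - \<alpha>) / G * b"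
            by (simp add: algebra_simps)
          also have "ennreal \<dots> = ennreal (?c * \<alpha> / F) * f x + ennreal (?c * (1 - \<alpha>) / G) * g x"
            using ab nn by (simp only: ennreal_plus ennreal_mult mult_nonneg_nonneg)
          finally show ?case .
        qed
        then have "(\<integral>\<^sup>+x. egmean \<alpha> (f x) (g x) \<partial>M)
            \<le> (\<integral>\<^sup>+x. ennreal (?c * \<alpha> / F) * f x + ennreal (?c * (1 - \<alpha>) / G) * g x \<partial>M)"
          by (rule nn_integral_mono_AE)
        also have "\<dots> = ennreal (?c * \<alpha> / F) * ennreal F + ennreal (?c * (1 - \<alpha>) / G) * ennreal G"
          by (simp add: nn_integral_add nn_integral_cmult FG)
        also have "\<dots> = ennreal (?c * \<alpha> / F * F + ?c * (1 - \<alpha>) / G * G)"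
          using pos 3 by (simp add: ennreal_mult[symmetric] ennreal_plus[symmetric] del: ennreal_plus)
        also have "?c * \<alpha> / F * F + ?c * (1 - \<alpha>) / G * G = ?c"
          using pos by (simp add: field_simps)
        also have "ennreal ?c = egmean \<alpha> ?F ?G"
          using FG by (simp add: egmean_ennreal)
        finally show ?thesis .
      qed
    qed
  qed
qed

section \<open>Kernels, their bilinear forms and the operators they represent\<close>

abbreviation enorm :: "('a \<Rightarrow> complex) \<Rightarrow> 'a \<Rightarrow> ennreal" where
  "enorm f \<equiv> \<lambda>x. ennreal (cmod (f x))"

abbreviation cabs :: "('a \<Rightarrow> complex) \<Rightarrow> 'a \<Rightarrow> complex" where
  "cabs f \<equiv> \<lambda>x. complex_of_real (cmod (f x))"

definition kapp :: "'a measure \<Rightarrow> ('a \<times> 'a \<Rightarrow> ennreal) \<Rightarrow> ('a \<Rightarrow> ennreal) \<Rightarrow> 'a \<Rightarrow> ennreal" where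
  "kapp M k u x = (\<integral>\<^sup>+y. k (x, y) * u y \<partial>M)"

definition kform :: "'a measure \<Rightarrow> ('a \<times> 'a \<Rightarrow> ennreal) \<Rightarrow> ('a \<Rightarrow> ennreal) \<Rightarrow> ('a \<Rightarrow> ennreal) \<Rightarrow> ennreal" where
  "kform M k u v = (\<integral>\<^sup>+x. kapp M k u x * v x \<partial>M)"

definition kadj :: "('a \<times> 'a \<Rightarrow> 'b) \<Rightarrow> 'a \<times> 'a \<Rightarrow> 'b" where
  "kadj k = (\<lambda>(x, y). k (y, x))"

definition kcomp :: "'a measure \<Rightarrow> ('a \<times> 'a \<Rightarrow> ennreal) \<Rightarrow> ('a \<times> 'a \<Rightarrow> ennreal) \<Rightarrow> 'a \<times> 'a \<Rightarrow> ennreal" where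
  "kcomp M k l = (\<lambda>(x, z). \<integral>\<^sup>+y. k (x, y) * l (y, z) \<partial>M)"

definition unit_ball :: "'a measure \<Rightarrow> ('a \<Rightarrow> complex) set" where
  "unit_ball M = {f \<in> L2 M. l2_norm M f \<le> 1}"

text \<open>A norm read off the kernel alone, hence available for transposed or cut-off kernels
  before an operator is known to exist; for kernels of operators it is the operator norm.\<close>

definition knorm :: "'a measure \<Rightarrow> ('a \<times> 'a \<Rightarrow> ennreal) \<Rightarrow> ennreal" where
  "knorm M k = (SUP f\<in>unit_ball M. SUP g\<in>unit_ball M. kform M k (enorm f) (enorm g))"

text \<open>Membership of \<open>K\<close> in this relation is tested on nonnegative functions only, which makes it stable
  under composition by Tonelli's theorem; the action of \<open>K\<close> on other functions is controlled by
  positivity.\<close>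

definition is_kernel :: "'a measure \<Rightarrow> 'a l2op \<Rightarrow> ('a \<times> 'a \<Rightarrow> ennreal) \<Rightarrow> bool" where
  "is_kernel M K k \<longleftrightarrow> bounded_operator M K \<and> k \<in> borel_measurable (M \<Otimes>\<^sub>M M) \<and>
     (\<forall>f\<in>L2 M. AE x in M. K (cabs f) x \<in> \<real>\<^sub>\<ge>\<^sub>0 \<and> ennreal (Re (K (cabs f) x)) = kapp M k (enorm f) x)"

lemma kadj_kadj [simp]: "kadj (kadj k) = k"
  by (auto simp: kadj_def)

lemma kadj_apply [simp]: "kadj k (x, y) = k (y, x)"
  by (simp add: kadj_def)

lemma measurable_kadj [measurable]: "k \<in> measurable (M \<Otimes>\<^sub>M M) N \<Longrightarrow> kadj k \<in> measurable (M \<Otimes>\<^sub>M M) N"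
  unfolding kadj_def case_prod_beta
  by (rule measurable_compose[of "\<lambda>p. (snd p, fst p)" _ "M \<Otimes>\<^sub>M M"]) auto

lemma kform_le_knorm_ball:
  "f \<in> unit_ball M \<Longrightarrow> g \<in> unit_ball M \<Longrightarrow> kform M k (enorm f) (enorm g) \<le> knorm M k"
  unfolding knorm_def by (rule SUP_upper2[of f], assumption, rule SUP_upper2[of g], assumption, rule order_refl)

lemma kapp_cong_AE: "AE x in M. u x = v x \<Longrightarrow> kapp M k u x = kapp M k v x"
  unfolding kapp_def by (intro nn_integral_cong_AE) (auto elim!: eventually_mono)

lemma kapp_mono: "(\<And>p. k p \<le> l p) \<Longrightarrow> kapp M k u x \<le> kapp M l u x"
  unfolding kapp_def by (intro nn_integral_mono mult_right_mono) auto

lemma is_kernelD: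
  assumes "is_kernel M K k"
  shows "bounded_operator M K" "k \<in> borel_measurable (M \<Otimes>\<^sub>M M)"
    "f \<in> L2 M \<Longrightarrow> AE x in M. K (cabs f) x \<in> \<real>\<^sub>\<ge>\<^sub>0 \<and> ennreal (Re (K (cabs f) x)) = kapp M k (enorm f) x"
  using assms by (auto simp: is_kernel_def)

lemma cabs_nonneg:
  assumes "nonneg_fun M f"
  shows "AE x in M. f x = cabs f x"
  using assms unfolding nonneg_fun_def by eventually_elim (auto simp: nonneg_Reals_def)

lemma cabs_diff_nonneg:
  assumes "AE x in M. cmod (f x) \<le> cmod (g x)"
  shows "nonneg_fun M (\<lambda>x. cabs g x - cabs f x)"
  using assms unfolding nonneg_fun_def
  by eventually_elim (simp add: of_real_diff[symmetric] del: of_real_diff)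

lemma is_kernel_positive:
  assumes K: "is_kernel M K k"
  shows "positivity_preserving M K"
  unfolding positivity_preserving_def
proof (intro ballI impI)
  fix f assume f: "f \<in> L2 M" "nonneg_fun M f"
  have "AE x in M. K f x = K (cabs f) x"
    by (rule linear_operatorD(2)[OF bounded_operator_linear[OF is_kernelD(1)[OF K]] f(1) L2_cmod[OF f(1)]
          cabs_nonneg[OF f(2)]])
  with is_kernelD(3)[OF K f(1)] show "nonneg_fun M (K f)"
    unfolding nonneg_fun_def by eventually_elim simp
qed

lemma is_kernel_nonneg_eq:
  assumes K: "is_kernel M K k" and f: "f \<in> L2 M" "nonneg_fun M f"
  shows "AE x in M. enorm (K f) x = kapp M k (enorm f) x"
proof -
  have "AE x in M. K f x = K (cabs f) x"
    by (rule linear_operatorD(2)[OF bounded_operator_linear[OF is_kernelD(1)[OF K]] f(1) L2_cmod[OF f(1)]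
          cabs_nonneg[OF f(2)]])
  with is_kernelD(3)[OF K f(1)] show ?thesis
  proof eventually_elim
    case (elim x)
    then obtain r where "K (cabs f) x = complex_of_real r" "0 \<le> r"
      by (auto simp: nonneg_Reals_def)
    with elim show ?case by simp
  qed
qed

lemma is_kernel_mono:
  assumes K: "is_kernel M K k" and f: "f \<in> L2 M" and g: "g \<in> L2 M" and le: "AE x in M. cmod (f x) \<le> cmod (g x)"
  shows "AE x in M. Re (K (cabs f) x) \<le> Re (K (cabs g) x)"
proof -
  have "nonneg_fun M (K (\<lambda>x. cabs g x - cabs f x))"
    using is_kernel_positive[OF K] cabs_diff_nonneg[OF le] L2_diff(1)[OF L2_cmod[OF g] L2_cmod[OF f]]
    unfolding positivity_preserving_def by blast
  then show ?thesis
    using linear_operator_diff[OF bounded_operator_linear[OF is_kernelD(1)[OF K]] L2_cmod[OF g] L2_cmod[OF f]]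
    unfolding nonneg_fun_def
    by eventually_elim (simp add: complex_nonneg_Reals_iff)
qed

lemma is_kernel_real:
  assumes K: "is_kernel M K k" and f: "f \<in> L2 M" and real: "\<And>x. Im (f x) = 0"
  shows "AE x in M. Im (K f x) = 0 \<and> Re (K f x) \<le> Re (K (cabs f) x)"
proof -
  let ?d = "\<lambda>x. cabs f x - f x"
  have d: "?d \<in> L2 M"
    by (rule L2_diff(1)[OF L2_cmod[OF f] f])
  have "nonneg_fun M ?d"
    unfolding nonneg_fun_def using real by (auto simp: complex_nonneg_Reals_iff complex_Re_le_cmod)
  then have "nonneg_fun M (K ?d)"
    using is_kernel_positive[OF K] d by (simp add: positivity_preserving_def)
  then show ?thesis
    using linear_operator_diff[OF bounded_operator_linear[OF is_kernelD(1)[OF K]] L2_cmod[OF f] f]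
      is_kernelD(3)[OF K f] unfolding nonneg_fun_def
    by eventually_elim (auto simp: complex_nonneg_Reals_iff)
qed

text \<open>The ratio Re (q w)/|q| attains |w| at the conjugate of \<open>w\<close>, and by
  continuity a dense set of \<open>q\<close> suffices. A countable dense set makes it possible to
  combine a.e. statements about the single \<open>q\<close>.\<close>

lemma cmod_le_dense:
  assumes D: "closure D = UNIV" and le: "\<And>q. q \<in> D \<Longrightarrow> Re (q * w) \<le> cmod q * r"
  shows "cmod w \<le> r"
proof -
  have "closed {q. Re (q * w) \<le> cmod q * r}"
    by (intro closed_Collect_le continuous_intros)
  moreover have "D \<subseteq> {q. Re (q * w) \<le> cmod q * r}"
    using le by auto
  ultimately have "closure D \<subseteq> {q. Re (q * w) \<le> cmod q * r}"
    by (simp add: closure_minimal)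
  then have *: "Re (q * w) \<le> cmod q * r" for q
    using D by auto
  have "Re (cnj w * w) = (cmod w)\<^sup>2"
    unfolding cmod_power2 by (simp add: power2_eq_square)
  with *[of "cnj w"] have "cmod w * cmod w \<le> cmod w * r"
    by (simp add: power2_eq_square)
  moreover have "0 \<le> r"
    using *[of 1] *[of "-1"] by simp
  ultimately show ?thesis
    by (cases "w = 0") auto
qed

text \<open>\<open>is_kernel\<close> gives no integral formula for complex arguments, so |K f| \<le>
  K |f| must come from positivity. For each fixed \<open>q\<close> positivity bounds the real part
  of q K f almost everywhere; letting \<open>q\<close> run through a countable dense set leaves a
  single exceptional null set.\<close>

lemma is_kernel_dominated:
  assumes K: "is_kernel M K k" and f: "f \<in> L2 M"
  shows "AE x in M. cmod (K f x) \<le> Re (K (cabs f) x)"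
proof -
  obtain D :: "complex set" where D: "countable D" "closure D = UNIV"
  proof -
    obtain D :: "complex set" where D: "countable D" "\<And>X. open X \<Longrightarrow> X \<noteq> {} \<Longrightarrow> \<exists>d\<in>D. d \<in> X"
      by (rule countable_dense_setE) blast
    have "closure D = UNIV"
    proof (rule ccontr)
      assume "closure D \<noteq> UNIV"
      then have "\<exists>d\<in>D. d \<in> - closure D"
        by (intro D(2)) auto
      then show False
        using closure_subset by blast
    qed
    with D(1) show thesis by (rule that)
  qed
  note lin = bounded_operator_linear[OF is_kernelD(1)[OF K]]
  have [measurable]: "f \<in> borel_measurable M"
    using f by (simp add: L2_def)
  have "AE x in M. Re (q * K f x) \<le> cmod q * Re (K (cabs f) x)" for q
  proof -
    \<comment> \<open>After multiplication by \<open>q\<close>, split into real and imaginary part.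
      \<open>K\<close> maps real functions to real ones, so the image of \<i> h adds nothing to the
      real part.\<close>
    define g h where "g x = complex_of_real (Re (q * f x))" and "h x = complex_of_real (Im (q * f x))" for x
    have qf: "(\<lambda>x. q * f x) \<in> L2 M"
      by (rule L2_scale[OF f])
    have [measurable]: "g \<in> borel_measurable M" "h \<in> borel_measurable M"
      unfolding g_def h_def by measurable
    have g: "g \<in> L2 M" and h: "h \<in> L2 M"
      by (rule L2_mono(1)[OF qf]; simp add: g_def h_def abs_Re_le_cmod abs_Im_le_cmod del: times_complex.sel)+
    have eq: "(\<lambda>x. q * f x) = (\<lambda>x. g x + \<i> * h x)"
      unfolding g_def h_def by (rule ext) (rule complex_eq)
    have 1: "AE x in M. q * K f x = K g x + K (\<lambda>x. \<i> * h x) x"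
      using linear_operatorD(4)[OF lin f, of q] linear_operatorD(3)[OF lin g L2_scale[OF h, of \<i>]]
      unfolding eq by eventually_elim simp
    have 2: "AE x in M. Re (K (cabs g) x) \<le> Re (K (cabs (\<lambda>x. q * f x)) x)"
      by (rule is_kernel_mono[OF K g qf]) (simp add: g_def abs_Re_le_cmod del: times_complex.sel)
    have eq2: "cabs (\<lambda>x. q * f x) = (\<lambda>x. complex_of_real (cmod q) * cabs f x)"
      by (simp add: norm_mult)
    have 3: "AE x in M. K (cabs (\<lambda>x. q * f x)) x = complex_of_real (cmod q) * K (cabs f) x"
      unfolding eq2 by (rule linear_operatorD(4)[OF lin L2_cmod[OF f]])
    have 4: "AE x in M. Im (K g x) = 0 \<and> Re (K g x) \<le> Re (K (cabs g) x)"
      by (rule is_kernel_real[OF K g]) (simp add: g_def)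
    have 5: "AE x in M. Im (K h x) = 0 \<and> Re (K h x) \<le> Re (K (cabs h) x)"
      by (rule is_kernel_real[OF K h]) (simp add: h_def)
    show ?thesis
      using 1 linear_operatorD(4)[OF lin h, of \<i>] 2 3 4 5
      by eventually_elim (simp only: plus_complex.sel times_complex.sel Re_complex_of_real Im_complex_of_real, simp)
  qed
  then have "AE x in M. \<forall>q\<in>D. Re (q * K f x) \<le> cmod q * Re (K (cabs f) x)"
    using D(1) by (simp add: AE_ball_countable)
  then show ?thesis
    by eventually_elim (rule cmod_le_dense[OF D(2)], blast)
qed

lemma is_kernel_dominated':
  assumes K: "is_kernel M K k" and f: "f \<in> L2 M"
  shows "AE x in M. enorm (K f) x \<le> kapp M k (enorm f) x"
  using is_kernel_dominated[OF assms] is_kernelD(3)[OF assms]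
proof eventually_elim
  case (elim x)
  have "ennreal (cmod (K f x)) \<le> ennreal (Re (K (cabs f) x))"
    by (rule ennreal_leI[OF elim(1)])
  with elim(2) show ?case by simp
qed

lemma is_kernel_gelfand:
  assumes K: "is_kernel M K k" and lim: "(\<lambda>n. root n (op_norm M (K ^^ n))) \<longlonglongrightarrow> L"
  shows "L \<le> spec_radius M K"
proof (rule positive_gelfand[OF is_kernelD(1)[OF K] is_kernel_positive[OF K] _ lim])
  fix f assume f: "f \<in> L2 M"
  show "nonneg_fun M (\<lambda>x. K (cabs f) x - cabs (K f) x)"
    using is_kernel_dominated[OF K f] is_kernelD(3)[OF K f] unfolding nonneg_fun_def
    by eventually_elim (auto simp: complex_nonneg_Reals_iff)
qed

lemma kcomp_kadj: "kcomp M (kadj l) (kadj k) = kadj (kcomp M k l)"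
  by (auto simp: kcomp_def kadj_def mult.commute)

lemma is_kernel_add:
  assumes A: "is_kernel M A k" and B: "is_kernel M B l"
  shows "is_kernel M (\<lambda>f x. A f x + B f x) (\<lambda>p. k p + l p)"
  unfolding is_kernel_def
proof (intro conjI ballI)
  note [measurable] = is_kernelD(2)[OF A] is_kernelD(2)[OF B]
  show "bounded_operator M (\<lambda>f x. A f x + B f x)"
    by (intro bounded_operator_add is_kernelD(1)[OF A] is_kernelD(1)[OF B])
  show "(\<lambda>p. k p + l p) \<in> borel_measurable (M \<Otimes>\<^sub>M M)"
    by measurable
  fix f assume f: "f \<in> L2 M"
  then have [measurable]: "f \<in> borel_measurable M"
    by (simp add: L2_def)
  have "AE x in M. kapp M (\<lambda>p. k p + l p) (enorm f) x = kapp M k (enorm f) x + kapp M l (enorm f) x"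
    by (rule AE_I2) (simp add: kapp_def distrib_right nn_integral_add)
  then show "AE x in M. A (cabs f) x + B (cabs f) x \<in> \<real>\<^sub>\<ge>\<^sub>0 \<and>
      ennreal (Re (A (cabs f) x + B (cabs f) x)) = kapp M (\<lambda>p. k p + l p) (enorm f) x"
    using is_kernelD(3)[OF A f] is_kernelD(3)[OF B f]
    by eventually_elim (auto simp: complex_nonneg_Reals_iff ennreal_plus)
qed

lemma is_kernel_zero: "is_kernel M (\<lambda>f x. 0) (\<lambda>p. 0)"
  unfolding is_kernel_def
  by (auto simp: kapp_def intro!: bounded_operatorI[of _ _ 0] linear_operator_zero)

section \<open>Transposition, composition and norm of kernels over a sigma-finite measure\<close>

context sigma_finite_measure
begin

interpretation pr: pair_sigma_finite M M ..

lemma measurable_kapp [measurable]: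
  assumes [measurable]: "k \<in> borel_measurable (M \<Otimes>\<^sub>M M)" "u \<in> borel_measurable M"
  shows "kapp M k u \<in> borel_measurable M"
  unfolding kapp_def[abs_def] by measurable

lemma measurable_kcomp [measurable]:
  assumes [measurable]: "k \<in> borel_measurable (M \<Otimes>\<^sub>M M)" "l \<in> borel_measurable (M \<Otimes>\<^sub>M M)"
  shows "kcomp M k l \<in> borel_measurable (M \<Otimes>\<^sub>M M)"
  unfolding kcomp_def case_prod_beta by measurable

lemma kform_kadj:
  assumes [measurable]: "k \<in> borel_measurable (M \<Otimes>\<^sub>M M)" "u \<in> borel_measurable M" "v \<in> borel_measurable M"
  shows "kform M (kadj k) u v = kform M k v u"
proof -
  have "kform M (kadj k) u v = (\<integral>\<^sup>+x. \<integral>\<^sup>+y. k (y, x) * v x * u y \<partial>M \<partial>M)"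
    unfolding kform_def kapp_def
    by (intro nn_integral_cong) (subst nn_integral_multc[symmetric], auto simp: ac_simps)
  also have "\<dots> = (\<integral>\<^sup>+y. \<integral>\<^sup>+x. k (y, x) * v x * u y \<partial>M \<partial>M)"
    by (rule pr.Fubini') measurable
  also have "\<dots> = kform M k v u"
    unfolding kform_def kapp_def
    by (intro nn_integral_cong) (subst nn_integral_multc[symmetric], auto simp: ac_simps)
  finally show ?thesis .
qed

lemma knorm_kadj:
  assumes "k \<in> borel_measurable (M \<Otimes>\<^sub>M M)"
  shows "knorm M (kadj k) = knorm M k"
proof -
  have "knorm M (kadj k) = (SUP f\<in>unit_ball M. SUP g\<in>unit_ball M. kform M k (enorm g) (enorm f))"
    unfolding knorm_def using assms
    by (intro SUP_cong refl kform_kadj) (auto simp: unit_ball_def L2_def)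
  also have "\<dots> = knorm M k"
    unfolding knorm_def by (rule SUP_commute)
  finally show ?thesis .
qed

lemma kapp_kcomp:
  assumes [measurable]: "k \<in> borel_measurable (M \<Otimes>\<^sub>M M)" "l \<in> borel_measurable (M \<Otimes>\<^sub>M M)" "u \<in> borel_measurable M"
    and x [measurable]: "x \<in> space M"
  shows "kapp M (kcomp M k l) u x = kapp M k (kapp M l u) x"
proof -
  have "kapp M (kcomp M k l) u x = (\<integral>\<^sup>+z. \<integral>\<^sup>+y. k (x, y) * l (y, z) * u z \<partial>M \<partial>M)"
    unfolding kcomp_def kapp_def case_prod_conv
    by (intro nn_integral_cong nn_integral_multc[symmetric]) measurable
  also have "\<dots> = (\<integral>\<^sup>+y. \<integral>\<^sup>+z. k (x, y) * l (y, z) * u z \<partial>M \<partial>M)"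
    by (rule pr.Fubini') measurable
  also have "\<dots> = kapp M k (kapp M l u) x"
    unfolding kapp_def mult.assoc by (intro nn_integral_cong nn_integral_cmult) measurable
  finally show ?thesis .
qed

lemma is_kernel_comp:
  assumes A: "is_kernel M A k" and B: "is_kernel M B l"
  shows "is_kernel M (A \<circ> B) (kcomp M k l)"
  unfolding is_kernel_def
proof (intro conjI ballI)
  note [measurable] = is_kernelD(2)[OF A] is_kernelD(2)[OF B]
  show "bounded_operator M (A \<circ> B)"
    by (intro bounded_operator_comp is_kernelD(1)[OF A] is_kernelD(1)[OF B])
  show "kcomp M k l \<in> borel_measurable (M \<Otimes>\<^sub>M M)"
    by measurable
  fix f assume f: "f \<in> L2 M"
  then have [measurable]: "f \<in> borel_measurable M"
    by (simp add: L2_def)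
  let ?g = "B (cabs f)"
  have g: "?g \<in> L2 M" "nonneg_fun M ?g"
    using bounded_operator_L2[OF is_kernelD(1)[OF B] L2_cmod[OF f]] is_kernelD(3)[OF B f]
    by (auto simp: nonneg_fun_def elim: eventually_mono)
  have "AE x in M. enorm ?g x = kapp M l (enorm f) x"
    using is_kernel_nonneg_eq[OF B L2_cmod[OF f]] by (simp add: nonneg_fun_def)
  then have kg: "kapp M k (enorm ?g) x = kapp M k (kapp M l (enorm f)) x" for x
    by (rule kapp_cong_AE)
  have "nonneg_fun M (A ?g)"
    using is_kernel_positive[OF A] g by (simp add: positivity_preserving_def)
  then show "AE x in M. (A \<circ> B) (cabs f) x \<in> \<real>\<^sub>\<ge>\<^sub>0 \<and> ennreal (Re ((A \<circ> B) (cabs f) x)) = kapp M (kcomp M k l) (enorm f) x"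
    using is_kernel_nonneg_eq[OF A g] AE_space unfolding nonneg_fun_def
  proof eventually_elim
    case (elim x)
    then obtain r where r: "A ?g x = complex_of_real r" "0 \<le> r"
      by (auto simp: nonneg_Reals_def)
    have "ennreal r = kapp M (kcomp M k l) (enorm f) x"
      using elim r kg[of x] by (simp add: kapp_kcomp)
    then show ?case using r by simp
  qed
qed

lemma kform_le_knorm:
  assumes [measurable]: "k \<in> borel_measurable (M \<Otimes>\<^sub>M M)" and f: "f \<in> L2 M" and g: "g \<in> L2 M"
  shows "kform M k (enorm f) (enorm g) \<le> knorm M k * ennreal (l2_norm M f * l2_norm M g)"
proof -
  have [measurable]: "f \<in> borel_measurable M" "g \<in> borel_measurable M"
    using f g by (auto simp: L2_def)
  show ?thesis
  proof (cases "l2_norm M f = 0 \<or> l2_norm M g = 0")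
    case True
    then have "(AE x in M. enorm f x = 0) \<or> (AE x in M. enorm g x = 0)"
      using l2_norm_eq_0_iff[OF f] l2_norm_eq_0_iff[OF g] by auto
    then have "kform M k (enorm f) (enorm g) = 0"
    proof
      assume "AE x in M. enorm f x = 0"
      then have "kapp M k (enorm f) x = kapp M k (\<lambda>_. 0) x" for x
        by (rule kapp_cong_AE)
      then show ?thesis by (simp add: kform_def) (simp add: kapp_def)
    next
      assume *: "AE x in M. enorm g x = 0"
      have "kform M k (enorm f) (enorm g) = (\<integral>\<^sup>+x. 0 \<partial>M)"
        unfolding kform_def by (rule nn_integral_cong_AE) (use * in \<open>eventually_elim, simp\<close>)
      then show ?thesis by simp
    qed
    then show ?thesis by simp
  next
    case False
    then have pos: "0 < l2_norm M f" "0 < l2_norm M g"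
      using l2_norm_nonneg[of M f] l2_norm_nonneg[of M g] by linarith+
    define f' g' where "f' x = complex_of_real (1 / l2_norm M f) * f x"
      and "g' x = complex_of_real (1 / l2_norm M g) * g x" for x
    have [measurable]: "f' \<in> borel_measurable M" "g' \<in> borel_measurable M"
      unfolding f'_def g'_def by measurable
    have "l2_norm M f' = 1" "l2_norm M g' = 1"
      unfolding f'_def[abs_def] g'_def[abs_def] l2_norm_scale using pos by (simp_all add: norm_divide)
    then have ball: "f' \<in> unit_ball M" "g' \<in> unit_ball M"
      using L2_scale[OF f] L2_scale[OF g] unfolding unit_ball_def f'_def[abs_def] g'_def[abs_def]
      by (simp_all only: mem_Collect_eq order_refl simp_thms)
    have ef: "enorm f = (\<lambda>x. ennreal (l2_norm M f) * enorm f' x)"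
      using pos by (auto simp: f'_def norm_divide ennreal_mult[symmetric])
    have eg: "enorm g = (\<lambda>x. ennreal (l2_norm M g) * enorm g' x)"
      using pos by (auto simp: g'_def norm_divide ennreal_mult[symmetric])
    have kf: "AE x in M. kapp M k (enorm f) x = ennreal (l2_norm M f) * kapp M k (enorm f') x"
      by (rule AE_I2) (simp add: ef kapp_def nn_integral_cmult[symmetric] mult.left_commute)
    have "kform M k (enorm f) (enorm g)
        = (\<integral>\<^sup>+x. ennreal (l2_norm M f) * ennreal (l2_norm M g) * (kapp M k (enorm f') x * enorm g' x) \<partial>M)"
      unfolding kform_def by (rule nn_integral_cong_AE) (use kf in \<open>eventually_elim, simp add: fun_cong[OF eg] ac_simps\<close>)
    also have "\<dots> = ennreal (l2_norm M f) * ennreal (l2_norm M g) * kform M k (enorm f') (enorm g')"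
      unfolding kform_def by (rule nn_integral_cmult) measurable
    also have "\<dots> \<le> ennreal (l2_norm M f) * ennreal (l2_norm M g) * knorm M k"
      by (intro mult_left_mono kform_le_knorm_ball ball) auto
    finally show ?thesis
      using pos by (simp add: ennreal_mult mult.commute)
  qed
qed

lemma kform_is_kernel:
  assumes "is_kernel M K k" "f \<in> L2 M"
  shows "kform M k (enorm f) (enorm g) = (\<integral>\<^sup>+x. enorm (K (cabs f)) x * enorm g x \<partial>M)"
proof -
  have "AE x in M. enorm (K (cabs f)) x = kapp M k (enorm f) x"
    using is_kernel_nonneg_eq[OF assms(1) L2_cmod[OF assms(2)]] by (simp add: nonneg_fun_def)
  then show ?thesis
    unfolding kform_def by (intro nn_integral_cong_AE) (auto elim!: eventually_mono)
qed

text \<open>One direction is Cauchy-Schwarz. For the other, the form is tested on |f| and |K f|: it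
  is at least the squared norm of K f, and one factor cancels.\<close>

lemma knorm_eq_op_norm:
  assumes K: "is_kernel M K k"
  shows "knorm M k = ennreal (op_norm M K)"
proof (rule antisym)
  note bK = is_kernelD(1)[OF K] and [measurable] = is_kernelD(2)[OF K]
  show le: "knorm M k \<le> ennreal (op_norm M K)"
    unfolding knorm_def
  proof (intro SUP_least)
    fix f g assume "f \<in> unit_ball M" "g \<in> unit_ball M"
    then have fg: "f \<in> L2 M" "g \<in> L2 M" "l2_norm M f \<le> 1" "l2_norm M g \<le> 1"
      by (auto simp: unit_ball_def)
    have "l2_norm M (K (cabs f)) * l2_norm M g \<le> (op_norm M K * l2_norm M f) * 1"
      using op_norm_bound[OF bK L2_cmod[OF fg(1)]] fg op_norm_nonneg[OF bK] by (intro mult_mono) auto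
    also have "\<dots> \<le> op_norm M K"
      using fg op_norm_nonneg[OF bK] by (simp add: mult_left_le)
    finally have *: "l2_norm M (K (cabs f)) * l2_norm M g \<le> op_norm M K" .
    have "kform M k (enorm f) (enorm g) \<le> ennreal (l2_norm M (K (cabs f)) * l2_norm M g)"
      unfolding kform_is_kernel[OF K fg(1)]
      by (intro nn_integral_mult_L2 fg bounded_operator_L2[OF bK L2_cmod])
    then show "kform M k (enorm f) (enorm g) \<le> ennreal (op_norm M K)"
      using ennreal_leI[OF *] order_trans by blast
  qed
  \<comment> \<open>Finiteness has to come first, because \<open>enn2real\<close> maps
    \<open>top\<close> to 0.\<close>
  then have fin: "knorm M k < top"
    by (rule le_less_trans) simp
  have "op_norm M K \<le> enn2real (knorm M k)"
  proof (rule op_norm_least')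
    fix f assume f: "f \<in> L2 M"
    have Kf: "K f \<in> L2 M"
      by (rule bounded_operator_L2[OF bK f])
    have "ennreal ((l2_norm M (K f))\<^sup>2) = (\<integral>\<^sup>+x. (enorm (K f) x)\<^sup>2 \<partial>M)"
      by (rule nn_integral_L2[OF Kf, symmetric])
    also have "\<dots> \<le> kform M k (enorm f) (enorm (K f))"
      unfolding kform_def power2_eq_square
      using is_kernel_dominated'[OF K f] by (intro nn_integral_mono_AE) (auto elim!: eventually_mono intro: mult_right_mono)
    also have "\<dots> \<le> knorm M k * ennreal (l2_norm M f * l2_norm M (K f))"
      by (intro kform_le_knorm f Kf) measurable
    also have "\<dots> = ennreal (enn2real (knorm M k) * (l2_norm M f * l2_norm M (K f)))"
      using fin by (simp add: ennreal_mult)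
    finally have "(l2_norm M (K f))\<^sup>2 \<le> enn2real (knorm M k) * (l2_norm M f * l2_norm M (K f))"
      by (subst (asm) ennreal_le_iff) auto
    then have "l2_norm M (K f) * l2_norm M (K f) \<le> (enn2real (knorm M k) * l2_norm M f) * l2_norm M (K f)"
      by (simp add: power2_eq_square mult.assoc)
    then show "l2_norm M (K f) \<le> enn2real (knorm M k) * l2_norm M f"
      using l2_norm_nonneg[of M "K f"] by (cases "l2_norm M (K f) = 0") (auto simp: mult_le_cancel_right)
  qed simp
  then have "ennreal (op_norm M K) \<le> ennreal (enn2real (knorm M k))"
    by (rule ennreal_leI)
  then show "ennreal (op_norm M K) \<le> knorm M k"
    using fin by simp
qed

text \<open>The test function equals its own weighted mean, so it can be distributed over both
  kernels before Hoelder's inequality is applied.\<close>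

lemma kapp_egmean:
  assumes \<alpha>: "\<alpha> \<in> {0..1}"
    and [measurable]: "p \<in> borel_measurable (M \<Otimes>\<^sub>M M)" "q \<in> borel_measurable (M \<Otimes>\<^sub>M M)" "u \<in> borel_measurable M"
    and le: "\<And>z. z \<in> space (M \<Otimes>\<^sub>M M) \<Longrightarrow> c z \<le> egmean \<alpha> (p z) (q z)"
    and x [measurable]: "x \<in> space M"
  shows "kapp M c u x \<le> egmean \<alpha> (kapp M p u x) (kapp M q u x)"
proof -
  have "kapp M c u x \<le> (\<integral>\<^sup>+y. egmean \<alpha> (p (x, y) * u y) (q (x, y) * u y) \<partial>M)"
    unfolding kapp_def egmean_mult[OF \<alpha>] egmean_self[OF \<alpha>]
    by (intro nn_integral_mono mult_right_mono le) (auto simp: space_pair_measure x)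
  also have "\<dots> \<le> egmean \<alpha> (kapp M p u x) (kapp M q u x)"
    unfolding kapp_def by (rule nn_integral_egmean_le[OF \<alpha>]) measurable
  finally show ?thesis .
qed

lemma kform_egmean:
  assumes \<alpha>: "\<alpha> \<in> {0..1}"
    and [measurable]: "p \<in> borel_measurable (M \<Otimes>\<^sub>M M)" "q \<in> borel_measurable (M \<Otimes>\<^sub>M M)"
      "u \<in> borel_measurable M" "v \<in> borel_measurable M"
    and le: "\<And>z. z \<in> space (M \<Otimes>\<^sub>M M) \<Longrightarrow> c z \<le> egmean \<alpha> (p z) (q z)"
  shows "kform M c u v \<le> egmean \<alpha> (kform M p u v) (kform M q u v)"
proof -
  have "kform M c u v \<le> (\<integral>\<^sup>+x. egmean \<alpha> (kapp M p u x * v x) (kapp M q u x * v x) \<partial>M)"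
    unfolding kform_def egmean_mult[OF \<alpha>] egmean_self[OF \<alpha>]
    by (intro nn_integral_mono mult_right_mono kapp_egmean[OF \<alpha>] le) auto
  also have "\<dots> \<le> egmean \<alpha> (kform M p u v) (kform M q u v)"
    unfolding kform_def by (rule nn_integral_egmean_le[OF \<alpha>]) measurable
  finally show ?thesis .
qed

lemma knorm_egmean:
  assumes \<alpha>: "\<alpha> \<in> {0..1}"
    and [measurable]: "p \<in> borel_measurable (M \<Otimes>\<^sub>M M)" "q \<in> borel_measurable (M \<Otimes>\<^sub>M M)"
    and le: "\<And>z. z \<in> space (M \<Otimes>\<^sub>M M) \<Longrightarrow> c z \<le> egmean \<alpha> (p z) (q z)"
  shows "knorm M c \<le> egmean \<alpha> (knorm M p) (knorm M q)"
  unfolding knorm_def[of _ c]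
proof (intro SUP_least)
  fix f g assume fg: "f \<in> unit_ball M" "g \<in> unit_ball M"
  then have [measurable]: "f \<in> borel_measurable M" "g \<in> borel_measurable M"
    by (auto simp: unit_ball_def L2_def)
  have "kform M c (enorm f) (enorm g) \<le> egmean \<alpha> (kform M p (enorm f) (enorm g)) (kform M q (enorm f) (enorm g))"
    by (rule kform_egmean[OF \<alpha> _ _ _ _ le]) measurable
  also have "\<dots> \<le> egmean \<alpha> (knorm M p) (knorm M q)"
    by (intro egmean_mono \<alpha> kform_le_knorm_ball fg)
  finally show "kform M c (enorm f) (enorm g) \<le> egmean \<alpha> (knorm M p) (knorm M q)" .
qed

lemma kcomp_egmean:
  assumes \<alpha>: "\<alpha> \<in> {0..1}"
    and [measurable]: "p \<in> borel_measurable (M \<Otimes>\<^sub>M M)" "q \<in> borel_measurable (M \<Otimes>\<^sub>M M)"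
      "p' \<in> borel_measurable (M \<Otimes>\<^sub>M M)" "q' \<in> borel_measurable (M \<Otimes>\<^sub>M M)"
    and le: "\<And>z. z \<in> space (M \<Otimes>\<^sub>M M) \<Longrightarrow> c z \<le> egmean \<alpha> (p z) (q z)" and le': "\<And>z. z \<in> space (M \<Otimes>\<^sub>M M) \<Longrightarrow> c' z \<le> egmean \<alpha> (p' z) (q' z)"
    and z: "z \<in> space (M \<Otimes>\<^sub>M M)"
  shows "kcomp M c c' z \<le> egmean \<alpha> (kcomp M p p' z) (kcomp M q q' z)"
proof -
  obtain x y where xy: "z = (x, y)" and xyM [measurable]: "x \<in> space M" "y \<in> space M"
    using z by (auto simp: space_pair_measure)
  have "kcomp M c c' z \<le> (\<integral>\<^sup>+w. egmean \<alpha> (p (x, w) * p' (w, y)) (q (x, w) * q' (w, y)) \<partial>M)"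
    unfolding kcomp_def xy case_prod_conv egmean_mult[OF \<alpha>] by (intro nn_integral_mono mult_mono le le')
      (auto simp: space_pair_measure xyM)
  also have "\<dots> \<le> egmean \<alpha> (kcomp M p p' z) (kcomp M q q' z)"
    unfolding kcomp_def xy case_prod_conv by (rule nn_integral_egmean_le[OF \<alpha>]) measurable
  finally show ?thesis .
qed

end

text \<open>\<open>C \<le> P\<^sup>(\<^sup>\<alpha>\<^sup>) \<circ> (Q\<^sup>*)\<^sup>(\<^sup>1\<^sup>-\<^sup>\<alpha>\<^sup>)\<close> on the level of kernels, where \<open>q\<close> is the kernel of \<open>Q\<^sup>*\<close>.\<close>

definition mean_dominated :: "'a measure \<Rightarrow> real \<Rightarrow> 'a l2op \<Rightarrow> 'a l2op \<Rightarrow> 'a l2op \<Rightarrow> bool" where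
  "mean_dominated M \<alpha> C P Q \<longleftrightarrow>
     (\<exists>c p q. is_kernel M C c \<and> is_kernel M P p \<and> is_kernel M Q (kadj q) \<and>
        (\<forall>z\<in>space (M \<Otimes>\<^sub>M M). c z \<le> egmean \<alpha> (p z) (q z)))"

lemma is_kernel_kadj_measurable: "is_kernel M Q (kadj q) \<Longrightarrow> q \<in> borel_measurable (M \<Otimes>\<^sub>M M)"
  using measurable_kadj[OF is_kernelD(2)[of M Q "kadj q"]] by simp

definition kint :: "'a measure \<Rightarrow> ('a \<times> 'a \<Rightarrow> real) \<Rightarrow> 'a l2op" where
  "kint M a f x = (LINT y|M. complex_of_real (a (x, y)) * f y)"

lemma num_radius_bdd:
  assumes A: "bounded_operator M A"
  shows "bdd_above {cmod (l2_inner M (A f) f) | f. f \<in> L2 M \<and> l2_norm M f = 1}"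
    and "0 \<le> num_radius M A" and "num_radius M A \<le> op_norm M A"
proof -
  have le: "cmod (l2_inner M (A f) f) \<le> op_norm M A" if "f \<in> L2 M" "l2_norm M f = 1" for f
    using cmod_l2_inner_le[OF bounded_operator_L2[OF A that(1)] that(1)] op_norm_bound[OF A that(1)] that(2)
    by simp
  show *: "bdd_above {cmod (l2_inner M (A f) f) | f. f \<in> L2 M \<and> l2_norm M f = 1}"
    by (rule bdd_aboveI[of _ "op_norm M A"]) (use le in auto)
  then show "0 \<le> num_radius M A"
    unfolding num_radius_def by (rule Sup0_nonneg)
  show "num_radius M A \<le> op_norm M A"
    unfolding num_radius_def by (rule Sup0_least[OF op_norm_nonneg[OF A]]) (use le in auto)
qed

text \<open>Superadditivity of the mean is Hoelder's inequality on a space of two points.\<close>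

lemma egmean_add:
  assumes \<alpha>: "\<alpha> \<in> {0..1}"
  shows "egmean \<alpha> x y + egmean \<alpha> x' y' \<le> egmean \<alpha> (x + x') (y + y')"
proof -
  let ?N = "count_space (UNIV :: bool set)"
  have sum: "(\<integral>\<^sup>+b. h b \<partial>?N) = h True + h False" for h :: "bool \<Rightarrow> ennreal"
    by (simp add: nn_integral_count_space_finite UNIV_bool add.commute)
  have "(\<integral>\<^sup>+b. egmean \<alpha> (if b then x else x') (if b then y else y') \<partial>?N)
      \<le> egmean \<alpha> (\<integral>\<^sup>+b. (if b then x else x') \<partial>?N) (\<integral>\<^sup>+b. (if b then y else y') \<partial>?N)"
    by (rule nn_integral_egmean_le[OF \<alpha>]) auto
  then show ?thesis
    by (simp add: sum)
qed

lemma mean_dominated_add: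
  assumes \<alpha>: "\<alpha> \<in> {0..1}" and "mean_dominated M \<alpha> C P Q" "mean_dominated M \<alpha> C' P' Q'"
  shows "mean_dominated M \<alpha> (\<lambda>f x. C f x + C' f x) (\<lambda>f x. P f x + P' f x) (\<lambda>f x. Q f x + Q' f x)"
proof -
  obtain c p q where 1: "is_kernel M C c" "is_kernel M P p" "is_kernel M Q (kadj q)"
    "\<And>z. z \<in> space (M \<Otimes>\<^sub>M M) \<Longrightarrow> c z \<le> egmean \<alpha> (p z) (q z)"
    using assms(2) unfolding mean_dominated_def by blast
  obtain c' p' q' where 2: "is_kernel M C' c'" "is_kernel M P' p'" "is_kernel M Q' (kadj q')"
    "\<And>z. z \<in> space (M \<Otimes>\<^sub>M M) \<Longrightarrow> c' z \<le> egmean \<alpha> (p' z) (q' z)"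
    using assms(3) unfolding mean_dominated_def by blast
  have "kadj (\<lambda>z. q z + q' z) = (\<lambda>z. kadj q z + kadj q' z)"
    by (auto simp: kadj_def)
  then have "is_kernel M (\<lambda>f x. Q f x + Q' f x) (kadj (\<lambda>z. q z + q' z))"
    using is_kernel_add[OF 1(3) 2(3)] by simp
  moreover have "c z + c' z \<le> egmean \<alpha> (p z + p' z) (q z + q' z)" if "z \<in> space (M \<Otimes>\<^sub>M M)" for z
    using add_mono[OF 1(4)[OF that] 2(4)[OF that]] egmean_add[OF \<alpha>] by (rule order_trans)
  ultimately show ?thesis
    unfolding mean_dominated_def using is_kernel_add[OF 1(1) 2(1)] is_kernel_add[OF 1(2) 2(2)] by blast
qed

lemma mean_dominated_zero: "mean_dominated M \<alpha> (\<lambda>f x. 0) (\<lambda>f x. 0) (\<lambda>f x. 0)"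
  unfolding mean_dominated_def
  by (intro exI[of _ "\<lambda>_. 0"]) (use is_kernel_zero[of M] in \<open>simp add: kadj_def case_prod_unfold\<close>)

text \<open>Both operators have equal inner products with every function, in particular with their
  own difference. It serves to recover an operator from a kernel of its adjoint.\<close>

lemma is_adjoint_unique:
  assumes "is_adjoint M A B" "is_adjoint M A' B" and A: "linear_operator M A" "linear_operator M A'" and f: "f \<in> L2 M"
  shows "AE x in M. A f x = A' f x"
proof -
  let ?g = "\<lambda>x. A f x - A' f x"
  have Af: "A f \<in> L2 M" "A' f \<in> L2 M"
    using A f by (auto intro: linear_operatorD(1))
  have g: "?g \<in> L2 M"
    by (rule L2_diff(1)[OF Af])
  have "l2_inner M (A f) ?g = l2_inner M (A' f) ?g"
    using assms(1,2) f g unfolding is_adjoint_def by simp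
  then have "l2_inner M ?g ?g = 0"
    using l2_inner_diff_left[OF Af g] by simp
  then have "l2_norm M ?g = 0"
    unfolding l2_inner_self by simp
  then have "AE x in M. ?g x = 0"
    by (simp add: l2_norm_eq_0_iff[OF g])
  then show ?thesis
    by eventually_elim simp
qed

text \<open>The squared norm of B g is the inner product of A (B g) with g; Cauchy-Schwarz and
  cancelling one factor bound B by the norm of A.\<close>

lemma is_adjoint_bounded:
  assumes adj: "is_adjoint M A B" and A: "bounded_operator M A"
  shows "bounded_operator M B"
proof (rule bounded_operatorI)
  show B: "linear_operator M B"
    using adj by (simp add: is_adjoint_def)
  fix g assume g: "g \<in> L2 M"
  then have Bg: "B g \<in> L2 M"
    by (rule linear_operatorD(1)[OF B])
  have "l2_inner M (A (B g)) g = complex_of_real ((l2_norm M (B g))\<^sup>2)"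
    using adj g Bg by (simp add: is_adjoint_def l2_inner_self)
  then have "(l2_norm M (B g))\<^sup>2 = cmod (l2_inner M (A (B g)) g)"
    by (simp only: norm_of_real) simp
  also have "\<dots> \<le> l2_norm M (A (B g)) * l2_norm M g"
    by (rule cmod_l2_inner_le[OF bounded_operator_L2[OF A Bg] g])
  also have "\<dots> \<le> (op_norm M A * l2_norm M (B g)) * l2_norm M g"
    by (intro mult_right_mono op_norm_bound[OF A Bg]) simp
  finally have "l2_norm M (B g) * l2_norm M (B g) \<le> (op_norm M A * l2_norm M g) * l2_norm M (B g)"
    by (simp add: power2_eq_square ac_simps)
  then show "l2_norm M (B g) \<le> op_norm M A * l2_norm M g"
    using l2_norm_nonneg[of M "B g"] op_norm_nonneg[OF A]
    by (cases "l2_norm M (B g) = 0") (auto simp: mult_le_cancel_right)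
qed

lemma has_kernelD:
  "has_kernel M A k \<Longrightarrow> f \<in> L2 M \<Longrightarrow>
    AE x in M. integrable M (\<lambda>y. k (x, y) * f y) \<and> A f x = (LINT y|M. k (x, y) * f y)"
  by (simp add: has_kernel_def)

lemma has_kernel_cong:
  assumes "has_kernel M A k" "linear_operator M B" "\<And>f. f \<in> L2 M \<Longrightarrow> AE x in M. B f x = A f x"
  shows "has_kernel M B k"
  unfolding has_kernel_def
proof (intro conjI ballI)
  fix f assume f: "f \<in> L2 M"
  have "AE x in M. integrable M (\<lambda>y. k (x, y) * f y) \<and> A f x = (CLINT y|M. k (x, y) * f y)"
    using assms(1) f by (simp add: has_kernel_def)
  then show "AE x in M. integrable M (\<lambda>y. k (x, y) * f y) \<and> B f x = (CLINT y|M. k (x, y) * f y)"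
    using assms(3)[OF f] by eventually_elim simp
qed (use assms in \<open>auto simp: has_kernel_def\<close>)

lemma is_kernel_of_has_kernel:
  assumes K: "has_kernel M A (\<lambda>p. complex_of_real (a p))" and b: "bounded_operator M A" and a: "\<And>p. 0 \<le> a p"
  shows "is_kernel M A (\<lambda>p. ennreal (a p))"
  unfolding is_kernel_def
proof (intro conjI ballI)
  have "(\<lambda>p. Re (complex_of_real (a p))) \<in> borel_measurable (M \<Otimes>\<^sub>M M)"
    using K unfolding has_kernel_def by (intro measurable_compose[OF _ borel_measurable_Re]) auto
  then show "(\<lambda>p. ennreal (a p)) \<in> borel_measurable (M \<Otimes>\<^sub>M M)"
    by simp
  fix f assume f: "f \<in> L2 M"
  have "AE x in M. integrable M (\<lambda>y. complex_of_real (a (x, y)) * cabs f y) \<and>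
      A (cabs f) x = (CLINT y|M. complex_of_real (a (x, y)) * cabs f y)"
    by (rule has_kernelD[OF K L2_cmod[OF f]])
  then show "AE x in M. A (cabs f) x \<in> \<real>\<^sub>\<ge>\<^sub>0 \<and> ennreal (Re (A (cabs f) x)) = kapp M (\<lambda>p. ennreal (a p)) (enorm f) x"
  proof eventually_elim
    case (elim x)
    let ?h = "\<lambda>y. a (x, y) * cmod (f y)"
    have "integrable M (\<lambda>y. complex_of_real (?h y))"
      using elim by simp
    then have int: "integrable M ?h"
      using integrable_Re by fastforce
    have "A (cabs f) x = (CLINT y|M. complex_of_real (?h y))"
      using elim by simp
    also have "\<dots> = complex_of_real (LINT y|M. ?h y)"
      by (rule integral_complex_of_real)
    finally have eq: "A (cabs f) x = complex_of_real (LINT y|M. ?h y)" .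
    have "0 \<le> (LINT y|M. ?h y)"
      using a by (intro integral_nonneg_AE AE_I2) simp
    moreover have "ennreal (LINT y|M. ?h y) = kapp M (\<lambda>p. ennreal (a p)) (enorm f) x"
      unfolding kapp_def using nn_integral_eq_integral[OF int] a by (simp add: ennreal_mult)
    ultimately show ?case
      by (simp add: eq)
  qed
qed (rule b)

section \<open>Domination under composition; norm and numerical radius; integral operators and their
  adjoints\<close>

context sigma_finite_measure
begin

interpretation pr: pair_sigma_finite M M ..

text \<open>\<open>q\<close> and \<open>q'\<close> are kernels of adjoints, so their composition in
  this order belongs to the adjoint of Q' Q. This reversal is the source of the second product in
  \<open>rho_bar\<close>.\<close>

lemma mean_dominated_comp:
  assumes \<alpha>: "\<alpha> \<in> {0..1}" and "mean_dominated M \<alpha> C P Q" "mean_dominated M \<alpha> C' P' Q'"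
  shows "mean_dominated M \<alpha> (C \<circ> C') (P \<circ> P') (Q' \<circ> Q)"
proof -
  obtain c p q where 1: "is_kernel M C c" "is_kernel M P p" "is_kernel M Q (kadj q)"
    "\<And>z. z \<in> space (M \<Otimes>\<^sub>M M) \<Longrightarrow> c z \<le> egmean \<alpha> (p z) (q z)"
    using assms(2) unfolding mean_dominated_def by blast
  obtain c' p' q' where 2: "is_kernel M C' c'" "is_kernel M P' p'" "is_kernel M Q' (kadj q')"
    "\<And>z. z \<in> space (M \<Otimes>\<^sub>M M) \<Longrightarrow> c' z \<le> egmean \<alpha> (p' z) (q' z)"
    using assms(3) unfolding mean_dominated_def by blast
  have "is_kernel M (Q' \<circ> Q) (kadj (kcomp M q q'))"
    using is_kernel_comp[OF 2(3) 1(3)] by (simp add: kcomp_kadj)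
  moreover have "kcomp M c c' z \<le> egmean \<alpha> (kcomp M p p' z) (kcomp M q q' z)" if "z \<in> space (M \<Otimes>\<^sub>M M)" for z
    by (rule kcomp_egmean[OF \<alpha> is_kernelD(2)[OF 1(2)] is_kernel_kadj_measurable[OF 1(3)]
          is_kernelD(2)[OF 2(2)] is_kernel_kadj_measurable[OF 2(3)] 1(4) 2(4) that])
  ultimately show ?thesis
    unfolding mean_dominated_def using is_kernel_comp[OF 1(1) 2(1)] is_kernel_comp[OF 1(2) 2(2)] by blast
qed

lemma op_norm_mean_dominated:
  assumes \<alpha>: "\<alpha> \<in> {0..1}" and "mean_dominated M \<alpha> C P Q"
  shows "op_norm M C \<le> gmean \<alpha> (op_norm M P) (op_norm M Q)"
proof -
  obtain c p q where 1: "is_kernel M C c" "is_kernel M P p" "is_kernel M Q (kadj q)"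
    "\<And>z. z \<in> space (M \<Otimes>\<^sub>M M) \<Longrightarrow> c z \<le> egmean \<alpha> (p z) (q z)"
    using assms(2) unfolding mean_dominated_def by blast
  have q: "q \<in> borel_measurable (M \<Otimes>\<^sub>M M)"
    by (rule is_kernel_kadj_measurable[OF 1(3)])
  have "ennreal (op_norm M C) \<le> egmean \<alpha> (knorm M p) (knorm M q)"
    unfolding knorm_eq_op_norm[OF 1(1), symmetric] by (rule knorm_egmean[OF \<alpha> is_kernelD(2)[OF 1(2)] q 1(4)])
  also have "knorm M q = ennreal (op_norm M Q)"
    using knorm_eq_op_norm[OF 1(3)] knorm_kadj[OF q] by simp
  also have "knorm M p = ennreal (op_norm M P)"
    by (rule knorm_eq_op_norm[OF 1(2)])
  finally show ?thesis
    by (simp add: egmean_ennreal op_norm_nonneg is_kernelD(1)[OF 1(2)] is_kernelD(1)[OF 1(3)])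
qed

lemma kform_l2_inner:
  assumes K: "is_kernel M K k" and f: "f \<in> L2 M" and g: "g \<in> L2 M"
  shows "kform M k (enorm f) (enorm g) = ennreal (cmod (l2_inner M (K (cabs f)) (cabs g)))"
proof -
  let ?h = "\<lambda>x. Re (K (cabs f) x) * cmod (g x)"
  have Kf: "K (cabs f) \<in> L2 M"
    by (rule bounded_operator_L2[OF is_kernelD(1)[OF K] L2_cmod[OF f]])
  have [measurable]: "g \<in> borel_measurable M" "K (cabs f) \<in> borel_measurable M"
    using g Kf by (auto simp: L2_def)
  have pos: "AE x in M. K (cabs f) x = complex_of_real (Re (K (cabs f) x)) \<and> 0 \<le> Re (K (cabs f) x)"
    using is_kernelD(3)[OF K f] by eventually_elim (auto simp: nonneg_Reals_def)
  have pos': "AE x in M. 0 \<le> ?h x"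
    using pos by eventually_elim (rule mult_nonneg_nonneg, erule conjunct2, rule norm_ge_zero)
  have eq: "AE x in M. K (cabs f) x * cnj (cabs g x) = complex_of_real (?h x)"
    using pos by eventually_elim (metis complex_cnj_complex_of_real of_real_mult)
  have "integrable M (\<lambda>x. K (cabs f) x * cnj (cabs g x))"
    by (rule integrable_mult_L2[OF Kf L2_cmod[OF g]])
  then have int: "integrable M ?h"
    using integrable_Re by fastforce
  have "l2_inner M (K (cabs f)) (cabs g) = (CLINT x|M. complex_of_real (?h x))"
    unfolding l2_inner_def using eq by (intro integral_cong_AE) auto
  also have "\<dots> = complex_of_real (LINT x|M. ?h x)"
    by (rule integral_complex_of_real)
  finally have "cmod (l2_inner M (K (cabs f)) (cabs g)) = (LINT x|M. ?h x)"
    using integral_nonneg_AE[OF pos'] by (simp only: norm_of_real abs_of_nonneg)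
  moreover have "(\<integral>\<^sup>+x. ennreal (?h x) \<partial>M) = ennreal (LINT x|M. ?h x)"
    by (intro nn_integral_eq_integral int pos')
  moreover have "kform M k (enorm f) (enorm g) = (\<integral>\<^sup>+x. ennreal (?h x) \<partial>M)"
    unfolding kform_def
    by (rule nn_integral_cong_AE) (use is_kernelD(3)[OF K f] in \<open>eventually_elim, simp add: ennreal_mult''\<close>)
  ultimately show ?thesis by simp
qed

text \<open>Only equal arguments of the form matter here, |<C f, f>| is at most the form at (|f|,
  |f|), and at equal arguments transposing \<open>q\<close> changes nothing.\<close>

lemma num_radius_mean_dominated:
  assumes \<alpha>: "\<alpha> \<in> {0..1}" and "mean_dominated M \<alpha> C P Q"
  shows "num_radius M C \<le> gmean \<alpha> (num_radius M P) (num_radius M Q)"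
proof -
  obtain c p q where 1: "is_kernel M C c" "is_kernel M P p" "is_kernel M Q (kadj q)"
    "\<And>z. z \<in> space (M \<Otimes>\<^sub>M M) \<Longrightarrow> c z \<le> egmean \<alpha> (p z) (q z)"
    using assms(2) unfolding mean_dominated_def by blast
  have q: "q \<in> borel_measurable (M \<Otimes>\<^sub>M M)"
    by (rule is_kernel_kadj_measurable[OF 1(3)])
  have upper: "kform M k (enorm f) (enorm f) \<le> ennreal (num_radius M K)"
    if K: "is_kernel M K k" and f: "f \<in> L2 M" "l2_norm M f = 1" for K k f
  proof -
    have "cmod (l2_inner M (K (cabs f)) (cabs f)) \<le> num_radius M K"
      unfolding num_radius_def using f
      by (intro Sup0_upper num_radius_bdd is_kernelD(1)[OF K]) (auto intro!: exI[of _ "cabs f"])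
    then show ?thesis
      unfolding kform_l2_inner[OF K f(1) f(1)] by (rule ennreal_leI)
  qed
  show ?thesis
    unfolding num_radius_def[of _ C]
  proof (rule Sup0_least, simp)
    fix x assume "x \<in> {cmod (l2_inner M (C f) f) | f. f \<in> L2 M \<and> l2_norm M f = 1}"
    then obtain f where f: "f \<in> L2 M" "l2_norm M f = 1" and x: "x = cmod (l2_inner M (C f) f)"
      by blast
    have [measurable]: "f \<in> borel_measurable M"
      using f by (simp add: L2_def)
    have Cf: "C f \<in> L2 M"
      by (rule bounded_operator_L2[OF is_kernelD(1)[OF 1(1)] f(1)])
    have "ennreal x \<le> (\<integral>\<^sup>+x. ennreal (cmod (C f x * cnj (f x))) \<partial>M)"
      unfolding x l2_inner_def by (rule integral_norm_bound_ennreal[OF integrable_mult_L2[OF Cf f(1)]])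
    also have "\<dots> \<le> kform M c (enorm f) (enorm f)"
      unfolding kform_def using is_kernel_dominated'[OF 1(1) f(1)]
      by (intro nn_integral_mono_AE) (auto elim!: eventually_mono simp: norm_mult ennreal_mult intro: mult_right_mono)
    also have "\<dots> \<le> egmean \<alpha> (kform M p (enorm f) (enorm f)) (kform M q (enorm f) (enorm f))"
      by (rule kform_egmean[OF \<alpha> is_kernelD(2)[OF 1(2)] q _ _ 1(4)]) measurable
    also have "\<dots> \<le> egmean \<alpha> (ennreal (num_radius M P)) (ennreal (num_radius M Q))"
    proof (intro egmean_mono \<alpha>)
      show "kform M p (enorm f) (enorm f) \<le> ennreal (num_radius M P)"
        by (rule upper[OF 1(2) f])
      have "kform M q (enorm f) (enorm f) = kform M (kadj q) (enorm f) (enorm f)"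
        by (rule kform_kadj[OF q, symmetric]) measurable
      then show "kform M q (enorm f) (enorm f) \<le> ennreal (num_radius M Q)"
        using upper[OF 1(3) f] by simp
    qed
    finally show "x \<le> gmean \<alpha> (num_radius M P) (num_radius M Q)"
      by (simp add: egmean_ennreal num_radius_bdd(2)[OF is_kernelD(1)[OF 1(2)]] num_radius_bdd(2)[OF is_kernelD(1)[OF 1(3)]])
  qed
qed

lemma SUP_min_of_nat_power2: "(SUP n. (min w (of_nat n))\<^sup>2) = (w::ennreal)\<^sup>2"
proof (rule antisym)
  show "(SUP n. (min w (of_nat n))\<^sup>2) \<le> w\<^sup>2"
    by (intro SUP_least power_mono) auto
  show "w\<^sup>2 \<le> (SUP n. (min w (of_nat n))\<^sup>2)"
  proof (cases w)
    case (real r)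
    obtain n where "r \<le> real n"
      using real_arch_simple by blast
    then have "w \<le> of_nat n"
      using real by (simp add: ennreal_of_nat_eq_real_of_nat ennreal_leI)
    then show ?thesis
      by (intro SUP_upper2[of n]) (auto simp: min_def)
  next
    case top
    have "(SUP n. of_nat n :: ennreal) \<le> (SUP n. (min w (of_nat n))\<^sup>2)"
    proof (rule SUP_mono)
      fix n :: nat
      have "(of_nat n :: ennreal) \<le> (of_nat n)\<^sup>2"
        unfolding of_nat_power[symmetric] of_nat_le_iff by (simp add: power2_eq_square)
      then show "\<exists>m\<in>UNIV. (of_nat n :: ennreal) \<le> (min w (of_nat m))\<^sup>2"
        using top by (intro bexI[of _ n]) auto
    qed
    then have "(SUP n. (min w (of_nat n))\<^sup>2) = top"
      unfolding ennreal_SUP_of_nat_eq_top by (rule top.extremum_uniqueI)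
    then show ?thesis
      by (metis top_greatest)
  qed
qed

text \<open>The quadratic form is tested against truncations of \<open>kapp M k (enorm f)\<close> itself, which are in
  \<open>L\<^sup>2\<close> by \<open>\<sigma>\<close>-finiteness.\<close>

lemma nn_integral_kapp_L2:
  assumes [measurable]: "k \<in> borel_measurable (M \<Otimes>\<^sub>M M)" and C: "knorm M k \<le> ennreal C" "0 \<le> C" and f: "f \<in> L2 M"
  shows "(\<integral>\<^sup>+x. (kapp M k (enorm f) x)\<^sup>2 \<partial>M) \<le> ennreal ((C * l2_norm M f)\<^sup>2)"
proof -
  have [measurable]: "f \<in> borel_measurable M"
    using f by (simp add: L2_def)
  obtain X :: "nat \<Rightarrow> 'a set" where X: "range X \<subseteq> sets M" "(\<Union>i. X i) = space M"
    "\<And>i. emeasure M (X i) \<noteq> \<infinity>" "incseq X"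
    by (rule sigma_finite_incseq) blast
  have [measurable]: "X n \<in> sets M" for n
    using X(1) by auto
  define w where "w = kapp M k (enorm f)"
  have [measurable]: "w \<in> borel_measurable M"
    unfolding w_def by measurable
  define t where "t n x = indicator (X n) x * min (w x) (of_nat n)" for n x
  have [measurable]: "t n \<in> borel_measurable M" for n
    unfolding t_def by measurable
  have tn: "t n x \<le> of_nat n * indicator (X n) x" for n x
    by (auto simp: t_def indicator_def)
  then have tfin: "t n x < top" for n x
    by (rule le_less_trans) (auto simp: indicator_def of_nat_less_top)
  define g where "g n x = complex_of_real (enn2real (t n x))" for n x
  have [measurable]: "g n \<in> borel_measurable M" for n
    unfolding g_def by measurable
  have eg: "enorm (g n) x = t n x" for n x
    using tfin[of n x] by (simp add: g_def)
  have gL: "g n \<in> L2 M" for n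
  proof -
    have "(\<integral>\<^sup>+x. (enorm (g n) x)\<^sup>2 \<partial>M) \<le> (\<integral>\<^sup>+x. (of_nat n)\<^sup>2 * indicator (X n) x \<partial>M)"
      unfolding eg using tn[of n]
      by (intro nn_integral_mono) (auto simp: indicator_def t_def intro: power_mono)
    also have "\<dots> = (of_nat n)\<^sup>2 * emeasure M (X n)"
      by (rule nn_integral_cmult_indicator) measurable
    also have "\<dots> < \<infinity>"
      using X(3)[of n] by (simp add: ennreal_mult_less_top less_top power_less_top_ennreal of_nat_less_top)
    finally show ?thesis
      by (simp add: L2_iff_nn)
  qed
  have le: "(\<integral>\<^sup>+x. (t n x)\<^sup>2 \<partial>M) \<le> ennreal ((C * l2_norm M f)\<^sup>2)" for n
  proof -
    have n2: "ennreal ((l2_norm M (g n))\<^sup>2) = (\<integral>\<^sup>+x. (t n x)\<^sup>2 \<partial>M)"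
      using nn_integral_L2[OF gL[of n]] by (simp add: eg)
    also have "\<dots> \<le> (\<integral>\<^sup>+x. w x * t n x \<partial>M)"
      unfolding power2_eq_square
      by (intro nn_integral_mono mult_right_mono) (auto simp: t_def indicator_def)
    also have "\<dots> = kform M k (enorm f) (enorm (g n))"
      by (simp add: kform_def w_def eg)
    also have "\<dots> \<le> knorm M k * ennreal (l2_norm M f * l2_norm M (g n))"
      by (intro kform_le_knorm f gL) measurable
    also have "\<dots> \<le> ennreal C * ennreal (l2_norm M f * l2_norm M (g n))"
      by (intro mult_right_mono C) simp
    also have "\<dots> = ennreal (C * l2_norm M f * l2_norm M (g n))"
      using C by (simp add: ennreal_mult mult.assoc)
    finally have "(l2_norm M (g n))\<^sup>2 \<le> C * l2_norm M f * l2_norm M (g n)"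
      by (subst (asm) ennreal_le_iff) (use C in auto)
    \<comment> \<open>Cancelling a factor requires a finite norm of \<open>g n\<close>, which is
      what the truncation secures.\<close>
    then have "l2_norm M (g n) * l2_norm M (g n) \<le> (C * l2_norm M f) * l2_norm M (g n)"
      by (simp add: power2_eq_square)
    then have "l2_norm M (g n) \<le> C * l2_norm M f"
      using l2_norm_nonneg[of M "g n"] C
      by (cases "l2_norm M (g n) = 0") (auto simp: mult_le_cancel_right)
    then have "(l2_norm M (g n))\<^sup>2 \<le> (C * l2_norm M f)\<^sup>2"
      by (intro power_mono) auto
    then show ?thesis
      unfolding n2[symmetric] by (rule ennreal_leI)
  qed
  have inc: "incseq (\<lambda>n x. (t n x)\<^sup>2)"
  proof (intro incseq_SucI le_funI power_mono)
    fix n x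
    have "X n \<subseteq> X (Suc n)"
      using X(4) by (simp add: incseq_SucD)
    moreover have "(of_nat n :: ennreal) \<le> of_nat (Suc n)"
      unfolding of_nat_le_iff by simp
    ultimately show "t n x \<le> t (Suc n) x"
      unfolding t_def by (intro mult_mono min.mono) (auto simp: indicator_def)
  qed simp
  have sup: "(SUP n. (t n x)\<^sup>2) = (w x)\<^sup>2" if x: "x \<in> space M" for x
  proof (rule antisym)
    show "(SUP n. (t n x)\<^sup>2) \<le> (w x)\<^sup>2"
      by (intro SUP_least power_mono) (auto simp: t_def indicator_def)
    obtain m where m: "x \<in> X m"
      using x X(2) by blast
    have "(SUP n. (min (w x) (of_nat n))\<^sup>2) \<le> (SUP n. (t n x)\<^sup>2)"
    proof (rule SUP_mono)
      fix n :: nat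
      have "x \<in> X (max m n)"
        using m incseqD[OF X(4), of m "max m n"] by auto
      then have "min (w x) (of_nat n) \<le> t (max m n) x"
        by (simp add: t_def min.coboundedI2)
      then show "\<exists>k\<in>UNIV. (min (w x) (of_nat n))\<^sup>2 \<le> (t k x)\<^sup>2"
        by (intro bexI[of _ "max m n"] power_mono) auto
    qed
    then show "(w x)\<^sup>2 \<le> (SUP n. (t n x)\<^sup>2)"
      by (simp add: SUP_min_of_nat_power2)
  qed
  have "(\<integral>\<^sup>+x. (w x)\<^sup>2 \<partial>M) = (\<integral>\<^sup>+x. (SUP n. (t n x)\<^sup>2) \<partial>M)"
    by (intro nn_integral_cong) (simp add: sup)
  also have "\<dots> = (SUP n. \<integral>\<^sup>+x. (t n x)\<^sup>2 \<partial>M)"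
    by (intro nn_integral_monotone_convergence_SUP inc) measurable
  also have "\<dots> \<le> ennreal ((C * l2_norm M f)\<^sup>2)"
    by (intro SUP_least le)
  finally show ?thesis
    unfolding w_def .
qed

text \<open>A finite form norm already makes the defining integrals converge absolutely almost
  everywhere, by \<open>nn_integral_kapp_L2\<close>. This produces operators for kernels that come
  without one, such as means and truncations.\<close>

lemma kint_has_kernel:
  assumes a [measurable]: "a \<in> borel_measurable (M \<Otimes>\<^sub>M M)" and a0: "\<And>p. 0 \<le> a p"
    and C: "knorm M (\<lambda>p. ennreal (a p)) \<le> ennreal C" "0 \<le> C"
  shows "has_kernel M (kint M a) (\<lambda>p. complex_of_real (a p))" "bounded_operator M (kint M a)"
    "is_kernel M (kint M a) (\<lambda>p. ennreal (a p))"
proof -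
  let ?k = "\<lambda>p. ennreal (a p)"
  have int: "AE x in M. integrable M (\<lambda>y. complex_of_real (a (x, y)) * f y)" if f: "f \<in> L2 M" for f
  proof -
    have [measurable]: "f \<in> borel_measurable M"
      using f by (simp add: L2_def)
    have "(\<integral>\<^sup>+x. (kapp M ?k (enorm f) x)\<^sup>2 \<partial>M) \<le> ennreal ((C * l2_norm M f)\<^sup>2)"
      by (intro nn_integral_kapp_L2 C f) measurable
    then have "(\<integral>\<^sup>+x. (kapp M ?k (enorm f) x)\<^sup>2 \<partial>M) \<noteq> \<infinity>"
      by (auto simp: top_unique)
    then have "AE x in M. (kapp M ?k (enorm f) x)\<^sup>2 \<noteq> \<infinity>"
      by (intro nn_integral_noteq_infinite) measurable
    then show ?thesis
      using AE_space
    proof eventually_elim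
      case (elim x)
      note [measurable] = elim(2)
      have "kapp M ?k (enorm f) x < top"
        using elim(1) by (simp add: power_eq_top_ennreal less_top)
      moreover have "kapp M ?k (enorm f) x = (\<integral>\<^sup>+y. ennreal (cmod (complex_of_real (a (x, y)) * f y)) \<partial>M)"
        unfolding kapp_def using a0 by (simp add: norm_mult ennreal_mult)
      ultimately show ?case
        by (simp add: integrable_iff_bounded)
    qed
  qed
  have bound: "kint M a f \<in> L2 M \<and> l2_norm M (kint M a f) \<le> C * l2_norm M f" if f: "f \<in> L2 M" for f
  proof -
    have [measurable]: "f \<in> borel_measurable M"
      using f by (simp add: L2_def)
    have m: "kint M a f \<in> borel_measurable M"
      unfolding kint_def[abs_def] by measurable
    have "AE x in M. enorm (kint M a f) x \<le> kapp M ?k (enorm f) x"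
      using int[OF f]
    proof eventually_elim
      case (elim x)
      have "enorm (kint M a f) x \<le> (\<integral>\<^sup>+y. ennreal (cmod (complex_of_real (a (x, y)) * f y)) \<partial>M)"
        unfolding kint_def by (rule integral_norm_bound_ennreal[OF elim])
      then show ?case
        unfolding kapp_def using a0 by (simp add: norm_mult ennreal_mult)
    qed
    then have "(\<integral>\<^sup>+x. (enorm (kint M a f) x)\<^sup>2 \<partial>M) \<le> (\<integral>\<^sup>+x. (kapp M ?k (enorm f) x)\<^sup>2 \<partial>M)"
      by (intro nn_integral_mono_AE) (auto elim!: eventually_mono intro: power_mono)
    also have "\<dots> \<le> ennreal ((C * l2_norm M f)\<^sup>2)"
      by (intro nn_integral_kapp_L2 C f) measurable
    finally have le: "(\<integral>\<^sup>+x. (enorm (kint M a f) x)\<^sup>2 \<partial>M) \<le> ennreal ((C * l2_norm M f)\<^sup>2)" .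
    then have L: "kint M a f \<in> L2 M"
      unfolding L2_iff_nn using m by (auto intro: le_less_trans)
    have "(l2_norm M (kint M a f))\<^sup>2 \<le> (C * l2_norm M f)\<^sup>2"
      using le unfolding nn_integral_L2[OF L] by simp
    then show ?thesis
      using L C by (auto intro: power2_le_imp_le)
  qed
  have lin: "linear_operator M (kint M a)"
    unfolding linear_operator_def l2_eq_def
  proof (intro conjI ballI allI impI)
    fix f assume f: "f \<in> L2 M"
    show "kint M a f \<in> L2 M"
      using bound[OF f] by simp
    fix c
    show "AE x in M. kint M a (\<lambda>x. c * f x) x = c * kint M a f x"
      by (rule AE_I2) (simp add: kint_def mult.left_commute)
  next
    fix f g assume f: "f \<in> L2 M" and g: "g \<in> L2 M"
    have [measurable]: "f \<in> borel_measurable M" "g \<in> borel_measurable M"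
      using f g by (auto simp: L2_def)
    show "AE x in M. kint M a (\<lambda>x. f x + g x) x = kint M a f x + kint M a g x"
      using int[OF f] int[OF g] by eventually_elim (simp add: kint_def distrib_left)
    show "AE x in M. kint M a f x = kint M a g x" if "AE x in M. f x = g x"
    proof (rule AE_I2)
      fix x assume [measurable]: "x \<in> space M"
      show "kint M a f x = kint M a g x"
        unfolding kint_def by (rule integral_cong_AE) (measurable, use that in \<open>eventually_elim, simp\<close>)
    qed
  qed
  show "bounded_operator M (kint M a)"
    by (rule bounded_operatorI[OF lin]) (use bound in blast)
  moreover show "has_kernel M (kint M a) (\<lambda>p. complex_of_real (a p))"
    unfolding has_kernel_def using lin int by (simp add: kint_def)
  ultimately show "is_kernel M (kint M a) ?k"
    by (intro is_kernel_of_has_kernel a0)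
qed

text \<open>Fubini's theorem, with absolute integrability of the triple product on the product space
  supplied by finiteness of the form. The kernel is real, so its transpose needs no
  conjugation.\<close>

lemma is_adjoint_kernels:
  assumes A: "has_kernel M A (\<lambda>p. complex_of_real (a p))" "bounded_operator M A"
    and B: "has_kernel M B (\<lambda>p. complex_of_real (kadj a p))"
    and a [measurable]: "a \<in> borel_measurable (M \<Otimes>\<^sub>M M)" and a0: "\<And>p. 0 \<le> a p"
  shows "is_adjoint M A B"
  unfolding is_adjoint_def
proof (intro conjI ballI)
  show "linear_operator M B"
    using B by (simp add: has_kernel_def)
  fix f g assume f: "f \<in> L2 M" and g: "g \<in> L2 M"
  have [measurable]: "f \<in> borel_measurable M" "g \<in> borel_measurable M"
    using f g by (auto simp: L2_def)
  note K = is_kernel_of_has_kernel[OF A a0]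
  let ?h = "\<lambda>x y. complex_of_real (a (x, y)) * f y * cnj (g x)"
  have [measurable]: "(\<lambda>x. cnj (g x)) \<in> borel_measurable M"
    by (intro measurable_compose[OF _ borel_measurable_continuous_onI[of cnj]]) (auto intro!: continuous_intros)
  have m [measurable]: "case_prod ?h \<in> borel_measurable (M \<Otimes>\<^sub>M M)"
    unfolding case_prod_beta by measurable
  have "(\<integral>\<^sup>+z. ennreal (cmod (case_prod ?h z)) \<partial>(M \<Otimes>\<^sub>M M)) = (\<integral>\<^sup>+x. \<integral>\<^sup>+y. ennreal (cmod (?h x y)) \<partial>M \<partial>M)"
    by (subst nn_integral_fst[symmetric]) auto
  also have "\<dots> = kform M (\<lambda>p. ennreal (a p)) (enorm f) (enorm g)"
    unfolding kform_def kapp_def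
    by (intro nn_integral_cong, subst nn_integral_multc[symmetric])
       (use a0 in \<open>auto simp: norm_mult ennreal_mult intro!: nn_integral_cong\<close>)
  also have "\<dots> < \<infinity>"
    using kform_le_knorm[OF is_kernelD(2)[OF K] f g] unfolding knorm_eq_op_norm[OF K]
    by (rule le_less_trans) (simp add: ennreal_mult_less_top)
  finally have int: "integrable (M \<Otimes>\<^sub>M M) (case_prod ?h)"
    by (simp add: integrable_iff_bounded m)
  have "l2_inner M (A f) g = (CLINT x|M. CLINT y|M. ?h x y)"
    unfolding l2_inner_def
  proof (rule integral_cong_AE)
    have "A f \<in> L2 M"
      by (rule bounded_operator_L2[OF A(2) f])
    then have [measurable]: "A f \<in> borel_measurable M"
      by (simp add: L2_def)
    show "(\<lambda>x. A f x * cnj (g x)) \<in> borel_measurable M"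
      by measurable
    show "(\<lambda>x. CLINT y|M. ?h x y) \<in> borel_measurable M"
      by measurable
    show "AE x in M. A f x * cnj (g x) = (CLINT y|M. ?h x y)"
      using has_kernelD[OF A(1) f] by eventually_elim simp
  qed
  also have "\<dots> = (CLINT y|M. CLINT x|M. ?h x y)"
    by (rule pr.Fubini_integral[OF int, symmetric])
  also have "\<dots> = l2_inner M f (B g)"
    unfolding l2_inner_def
  proof (rule integral_cong_AE)
    have "B g \<in> L2 M"
      using B g by (auto simp: has_kernel_def intro: linear_operatorD(1))
    then have [measurable]: "B g \<in> borel_measurable M"
      by (simp add: L2_def)
    have [measurable]: "(\<lambda>x. cnj (B g x)) \<in> borel_measurable M"
      by (intro measurable_compose[OF _ borel_measurable_continuous_onI[of cnj]]) (auto intro!: continuous_intros)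
    show "(\<lambda>x. f x * cnj (B g x)) \<in> borel_measurable M"
      by measurable
    show "(\<lambda>y. CLINT x|M. ?h x y) \<in> borel_measurable M"
      by measurable
    show "AE y in M. (CLINT x|M. ?h x y) = f y * cnj (B g y)"
      using has_kernelD[OF B g]
    proof eventually_elim
      case (elim y)
      have "(CLINT x|M. ?h x y) = (CLINT x|M. f y * cnj (complex_of_real (a (x, y)) * g x))"
        by (intro Bochner_Integration.integral_cong) (auto simp: ac_simps)
      also have "\<dots> = f y * cnj (CLINT x|M. complex_of_real (a (x, y)) * g x)"
        by (simp only: integral_mult_right_zero Bochner_Integration.integral_cnj)
      finally show ?case
        using elim by simp
    qed
  qed
  finally show "l2_inner M (A f) g = l2_inner M f (B g)" .
qed

end

section \<open>Measure of noncompactness of kernel operators\<close>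

lemma noncompact_bounds_add:
  assumes A: "bounded_operator M A" and B: "bounded_operator M B"
    and d: "d \<in> noncompact_bounds M A" and e: "e \<in> noncompact_bounds M B"
  shows "d + e \<in> noncompact_bounds M (\<lambda>f x. A f x + B f x)"
proof -
  obtain N where d0: "d > 0" and N: "finite N" "N \<subseteq> L2 M"
    "\<And>f. f \<in> L2 M \<Longrightarrow> l2_norm M f \<le> 1 \<Longrightarrow> \<exists>g\<in>N. l2_norm M (\<lambda>x. A f x - g x) \<le> d"
    using d unfolding noncompact_bounds_def by blast
  obtain N' where e0: "e > 0" and N': "finite N'" "N' \<subseteq> L2 M"
    "\<And>f. f \<in> L2 M \<Longrightarrow> l2_norm M f \<le> 1 \<Longrightarrow> \<exists>g\<in>N'. l2_norm M (\<lambda>x. B f x - g x) \<le> e"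
    using e unfolding noncompact_bounds_def by blast
  define Q where "Q = (\<lambda>(g, h) x. g x + h x) ` (N \<times> N')"
  have "finite Q"
    using N N' by (simp add: Q_def)
  moreover have "Q \<subseteq> L2 M"
    unfolding Q_def using N(2) N'(2) by (auto intro!: L2_add(1))
  moreover have "\<exists>q\<in>Q. l2_norm M (\<lambda>x. A f x + B f x - q x) \<le> d + e" if f: "f \<in> L2 M" "l2_norm M f \<le> 1" for f
  proof -
    obtain g where g: "g \<in> N" "l2_norm M (\<lambda>x. A f x - g x) \<le> d"
      using N(3)[OF f] by blast
    obtain h where h: "h \<in> N'" "l2_norm M (\<lambda>x. B f x - h x) \<le> e"
      using N'(3)[OF f] by blast
    have "l2_norm M (\<lambda>x. (A f x - g x) + (B f x - h x)) \<le> d + e"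
      using L2_add(2)[OF L2_diff(1)[OF bounded_operator_L2[OF A f(1)], of g] L2_diff(1)[OF bounded_operator_L2[OF B f(1)], of h]]
        g h N(2) N'(2) by fastforce
    then have "l2_norm M (\<lambda>x. A f x + B f x - (\<lambda>x. g x + h x) x) \<le> d + e"
      by (simp add: algebra_simps)
    moreover have "(\<lambda>x. g x + h x) \<in> Q"
      unfolding Q_def using g h by (intro image_eqI[of _ _ "(g, h)"]) auto
    ultimately show ?thesis
      by (rule bexI[where x = "\<lambda>x. g x + h x"])
  qed
  ultimately show ?thesis
    unfolding noncompact_bounds_def using d0 e0 by auto
qed

lemma noncompact_bounds_scale:
  assumes A: "bounded_operator M A" and c: "0 < c" and d: "d \<in> noncompact_bounds M A"
  shows "c * d \<in> noncompact_bounds M (\<lambda>f x. complex_of_real c * A f x)"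
proof -
  obtain N where d0: "d > 0" and N: "finite N" "N \<subseteq> L2 M"
    "\<And>f. f \<in> L2 M \<Longrightarrow> l2_norm M f \<le> 1 \<Longrightarrow> \<exists>g\<in>N. l2_norm M (\<lambda>x. A f x - g x) \<le> d"
    using d unfolding noncompact_bounds_def by blast
  define Q where "Q = (\<lambda>g x. complex_of_real c * g x) ` N"
  have "finite Q" "Q \<subseteq> L2 M"
    using N by (auto simp: Q_def intro: L2_scale)
  moreover have "\<exists>q\<in>Q. l2_norm M (\<lambda>x. complex_of_real c * A f x - q x) \<le> c * d" if f: "f \<in> L2 M" "l2_norm M f \<le> 1" for f
  proof -
    obtain g where g: "g \<in> N" "l2_norm M (\<lambda>x. A f x - g x) \<le> d"
      using N(3)[OF f] by blast
    have "l2_norm M (\<lambda>x. complex_of_real c * A f x - complex_of_real c * g x) \<le> c * d"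
      using g c l2_norm_scale[of M "complex_of_real c" "\<lambda>x. A f x - g x"] by (simp add: right_diff_distrib)
    then show ?thesis
      using g(1) by (auto simp: Q_def)
  qed
  ultimately show ?thesis
    unfolding noncompact_bounds_def using c d0 by auto
qed

text \<open>Total boundedness of the image of the unit ball, attached to the kernel rather than the
  operator so that induction over measurable sets and functions can run on kernels.\<close>

definition compact_kernel :: "'a measure \<Rightarrow> ('a \<times> 'a \<Rightarrow> ennreal) \<Rightarrow> bool" where
  "compact_kernel M h \<longleftrightarrow> (\<exists>H. is_kernel M H h \<and> {0<..} \<subseteq> noncompact_bounds M H)"

lemma noncompact_bounds_perturb:
  assumes C: "bounded_operator M C" and H: "bounded_operator M H"
    and d: "op_norm M (\<lambda>f x. C f x - H f x) < d" and e: "e \<in> noncompact_bounds M H"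
  shows "d + e \<in> noncompact_bounds M C"
proof -
  have "d + e \<in> noncompact_bounds M (\<lambda>f x. (C f x - H f x) + H f x)"
    by (intro noncompact_bounds_add noncompact_bounds_op_norm bounded_operator_diff C H d e)
  then show ?thesis by simp
qed

lemma compact_kernel_add:
  assumes "compact_kernel M h" "compact_kernel M k"
  shows "compact_kernel M (\<lambda>z. h z + k z)"
proof -
  obtain H K where H: "is_kernel M H h" "{0<..} \<subseteq> noncompact_bounds M H"
    and K: "is_kernel M K k" "{0<..} \<subseteq> noncompact_bounds M K"
    using assms unfolding compact_kernel_def by blast
  have "e \<in> noncompact_bounds M (\<lambda>f x. H f x + K f x)" if "0 < e" for e
  proof -
    have "e / 2 + e / 2 \<in> noncompact_bounds M (\<lambda>f x. H f x + K f x)"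
      using that H(2) K(2)
      by (intro noncompact_bounds_add is_kernelD(1)[OF H(1)] is_kernelD(1)[OF K(1)]) auto
    then show ?thesis by simp
  qed
  then show ?thesis
    unfolding compact_kernel_def using is_kernel_add[OF H(1) K(1)] by blast
qed

text \<open>The difference is expressed additively because subtraction in \<open>ennreal\<close> is
  truncated. The images under \<open>A\<close> being finite almost everywhere, the contribution of
  \<open>d\<close> is finite too and the summands cancel.\<close>

lemma is_kernel_diff:
  assumes A: "is_kernel M A (\<lambda>z. k z + d z)" and B: "is_kernel M B k"
    and d [measurable]: "d \<in> borel_measurable (M \<Otimes>\<^sub>M M)"
  shows "is_kernel M (\<lambda>f x. A f x - B f x) d"
  unfolding is_kernel_def
proof (intro conjI ballI)
  note [measurable] = is_kernelD(2)[OF B]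
  show "bounded_operator M (\<lambda>f x. A f x - B f x)"
    by (intro bounded_operator_diff is_kernelD(1)[OF A] is_kernelD(1)[OF B])
  fix f assume f: "f \<in> L2 M"
  then have [measurable]: "f \<in> borel_measurable M"
    by (simp add: L2_def)
  have "AE x in M. kapp M (\<lambda>z. k z + d z) (enorm f) x = kapp M k (enorm f) x + kapp M d (enorm f) x"
    by (rule AE_I2) (simp add: kapp_def distrib_right nn_integral_add)
  then show "AE x in M. A (cabs f) x - B (cabs f) x \<in> \<real>\<^sub>\<ge>\<^sub>0 \<and>
      ennreal (Re (A (cabs f) x - B (cabs f) x)) = kapp M d (enorm f) x"
    using is_kernelD(3)[OF A f] is_kernelD(3)[OF B f]
  proof eventually_elim
    case (elim x)
    obtain a b where ab: "A (cabs f) x = complex_of_real a" "0 \<le> a" "B (cabs f) x = complex_of_real b" "0 \<le> b"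
      using elim by (auto simp: nonneg_Reals_def)
    have eq: "ennreal a = ennreal b + kapp M d (enorm f) x"
      using elim ab by simp
    then obtain r where r: "kapp M d (enorm f) x = ennreal r" "0 \<le> r"
      by (cases "kapp M d (enorm f) x") auto
    have "ennreal a = ennreal (b + r)"
      using eq r ab by (simp add: ennreal_plus)
    then have "a = b + r"
      using ab r by (subst (asm) ennreal_inj) auto
    then show ?case
      using ab r by (auto simp: complex_nonneg_Reals_iff)
  qed
qed simp

text \<open>Negating a net covers the negated operator. This provides the complement step of the
  Dynkin argument in \<open>compact_kernel_set\<close>.\<close>

lemma compact_kernel_diff:
  assumes "compact_kernel M (\<lambda>z. k z + d z)" "compact_kernel M k" and d: "d \<in> borel_measurable (M \<Otimes>\<^sub>M M)"
  shows "compact_kernel M d"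
proof -
  obtain H K where H: "is_kernel M H (\<lambda>z. k z + d z)" "{0<..} \<subseteq> noncompact_bounds M H"
    and K: "is_kernel M K k" "{0<..} \<subseteq> noncompact_bounds M K"
    using assms unfolding compact_kernel_def by blast
  have "e \<in> noncompact_bounds M (\<lambda>f x. H f x - K f x)" if "0 < e" for e
  proof -
    have "e / 2 \<in> noncompact_bounds M K"
      using that K by auto
    then obtain N where N: "finite N" "N \<subseteq> L2 M"
      "\<And>f. f \<in> L2 M \<Longrightarrow> l2_norm M f \<le> 1 \<Longrightarrow> \<exists>g\<in>N. l2_norm M (\<lambda>x. K f x - g x) \<le> e / 2"
      unfolding noncompact_bounds_def by blast
    have "e / 2 \<in> noncompact_bounds M (\<lambda>f x. - K f x)"
      unfolding noncompact_bounds_def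
    proof (intro CollectI conjI exI[of _ "(\<lambda>g x. - g x) ` N"] ballI impI)
      fix f assume "f \<in> L2 M" "l2_norm M f \<le> 1"
      then obtain g where g: "g \<in> N" "l2_norm M (\<lambda>x. K f x - g x) \<le> e / 2"
        using N(3) by blast
      then have "l2_norm M (\<lambda>x. - K f x - - g x) \<le> e / 2"
        using l2_norm_uminus[of M "\<lambda>x. K f x - g x"] by simp
      then show "\<exists>g\<in>(\<lambda>g x. - g x) ` N. l2_norm M (\<lambda>x. - K f x - g x) \<le> e / 2"
        using g(1) by auto
    qed (use that N in \<open>auto intro: L2_uminus\<close>)
    moreover have "bounded_operator M (\<lambda>f x. - K f x)"
      using bounded_operator_scale[OF is_kernelD(1)[OF K(1)], of "-1"] by simp
    moreover have "e / 2 \<in> noncompact_bounds M H"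
      using that H by auto
    ultimately have "e / 2 + e / 2 \<in> noncompact_bounds M (\<lambda>f x. H f x + - K f x)"
      by (intro noncompact_bounds_add is_kernelD(1)[OF H(1)])
    then show ?thesis by simp
  qed
  then show ?thesis
    unfolding compact_kernel_def using is_kernel_diff[OF H(1) K(1) d] by blast
qed

lemma is_kernel_scale:
  assumes A: "is_kernel M A k" and c: "0 \<le> c"
  shows "is_kernel M (\<lambda>f x. complex_of_real c * A f x) (\<lambda>z. ennreal c * k z)"
  unfolding is_kernel_def
proof (intro conjI ballI)
  note [measurable] = is_kernelD(2)[OF A]
  show "bounded_operator M (\<lambda>f x. complex_of_real c * A f x)"
    by (intro bounded_operator_scale is_kernelD(1)[OF A])
  show "(\<lambda>z. ennreal c * k z) \<in> borel_measurable (M \<Otimes>\<^sub>M M)"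
    by measurable
  fix f assume f: "f \<in> L2 M"
  then have [measurable]: "f \<in> borel_measurable M"
    by (simp add: L2_def)
  have "AE x in M. kapp M (\<lambda>z. ennreal c * k z) (enorm f) x = ennreal c * kapp M k (enorm f) x"
    by (rule AE_I2) (simp add: kapp_def nn_integral_cmult[symmetric] mult.assoc)
  then show "AE x in M. complex_of_real c * A (cabs f) x \<in> \<real>\<^sub>\<ge>\<^sub>0 \<and>
      ennreal (Re (complex_of_real c * A (cabs f) x)) = kapp M (\<lambda>z. ennreal c * k z) (enorm f) x"
    using is_kernelD(3)[OF A f]
    by eventually_elim (use c in \<open>auto simp: complex_nonneg_Reals_iff ennreal_mult\<close>)
qed

lemma compact_kernel_scale:
  assumes "compact_kernel M k" and c: "0 < c"
  shows "compact_kernel M (\<lambda>z. ennreal c * k z)"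
proof -
  obtain K where K: "is_kernel M K k" "{0<..} \<subseteq> noncompact_bounds M K"
    using assms unfolding compact_kernel_def by blast
  have "e \<in> noncompact_bounds M (\<lambda>f x. complex_of_real c * K f x)" if "0 < e" for e
  proof -
    have "e / c \<in> noncompact_bounds M K"
      using K(2) that c by auto
    then have "c * (e / c) \<in> noncompact_bounds M (\<lambda>f x. complex_of_real c * K f x)"
      by (intro noncompact_bounds_scale is_kernelD(1)[OF K(1)] c)
    then show ?thesis using c by simp
  qed
  then show ?thesis
    unfolding compact_kernel_def using is_kernel_scale[OF K(1), of c] c by fastforce
qed

lemma compact_kernel_0: "compact_kernel M (\<lambda>z. 0)"
proof -
  have "{0<..} \<subseteq> noncompact_bounds M (\<lambda>f x. 0)"
    unfolding noncompact_bounds_def by (auto intro!: exI[of _ "{\<lambda>x. 0}"])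
  then show ?thesis
    unfolding compact_kernel_def using is_kernel_zero by blast
qed

section \<open>Compactness of bounded kernels supported on sets of finite measure\<close>

context sigma_finite_measure
begin

interpretation pr: pair_sigma_finite M M ..

text \<open>Cauchy-Schwarz on the product space against |g(x)| |f(y)|, whose norm there is at most
  1.\<close>

lemma knorm_le_hilbert_schmidt_norm:
  assumes [measurable]: "k \<in> borel_measurable (M \<Otimes>\<^sub>M M)" and le: "(\<integral>\<^sup>+z. (k z)\<^sup>2 \<partial>(M \<Otimes>\<^sub>M M)) \<le> ennreal (C\<^sup>2)" and C: "0 \<le> C"
  shows "knorm M k \<le> ennreal C"
  unfolding knorm_def
proof (intro SUP_least)
  fix f g assume "f \<in> unit_ball M" "g \<in> unit_ball M"
  then have fg: "f \<in> L2 M" "g \<in> L2 M" "l2_norm M f \<le> 1" "l2_norm M g \<le> 1"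
    by (auto simp: unit_ball_def)
  have [measurable]: "f \<in> borel_measurable M" "g \<in> borel_measurable M"
    using fg by (auto simp: L2_def)
  let ?w = "\<lambda>z. enorm f (snd z) * enorm g (fst z)"
  have "kform M k (enorm f) (enorm g) = (\<integral>\<^sup>+x. \<integral>\<^sup>+y. k (x, y) * ?w (x, y) \<partial>M \<partial>M)"
    unfolding kform_def kapp_def
    by (intro nn_integral_cong, subst nn_integral_multc[symmetric]) (auto simp: ac_simps)
  also have "\<dots> = (\<integral>\<^sup>+z. k z * ?w z \<partial>(M \<Otimes>\<^sub>M M))"
    by (rule nn_integral_fst) measurable
  finally have eq: "kform M k (enorm f) (enorm g) = (\<integral>\<^sup>+z. k z * ?w z \<partial>(M \<Otimes>\<^sub>M M))" .
  have "(\<integral>\<^sup>+z. (?w z)\<^sup>2 \<partial>(M \<Otimes>\<^sub>M M)) = (\<integral>\<^sup>+x. \<integral>\<^sup>+y. (?w (x, y))\<^sup>2 \<partial>M \<partial>M)"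
    by (rule nn_integral_fst[symmetric]) measurable
  also have "\<dots> = (\<integral>\<^sup>+x. (\<integral>\<^sup>+y. (enorm f y)\<^sup>2 \<partial>M) * (enorm g x)\<^sup>2 \<partial>M)"
    by (intro nn_integral_cong) (simp add: power_mult_distrib nn_integral_multc)
  also have "\<dots> = ennreal ((l2_norm M f)\<^sup>2) * ennreal ((l2_norm M g)\<^sup>2)"
    unfolding nn_integral_L2[OF fg(1)] using nn_integral_L2[OF fg(2)] by (simp add: nn_integral_cmult)
  also have "\<dots> \<le> 1 * 1"
    using fg by (intro mult_mono) (auto simp: ennreal_le_1 power_le_one)
  finally have w: "(\<integral>\<^sup>+z. (?w z)\<^sup>2 \<partial>(M \<Otimes>\<^sub>M M)) \<le> 1" by simp
  have "(kform M k (enorm f) (enorm g))\<^sup>2 \<le> (\<integral>\<^sup>+z. (k z)\<^sup>2 \<partial>(M \<Otimes>\<^sub>M M)) * (\<integral>\<^sup>+z. (?w z)\<^sup>2 \<partial>(M \<Otimes>\<^sub>M M))"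
    unfolding eq by (rule Cauchy_Schwarz_nn_integral) measurable
  also have "\<dots> \<le> ennreal (C\<^sup>2) * 1"
    by (intro mult_mono le w) auto
  also have "\<dots> = (ennreal C)\<^sup>2"
    using C by (simp add: ennreal_power)
  finally show "kform M k (enorm f) (enorm g) \<le> ennreal C"
    by (rule ennreal_power2_le_imp_le)
qed

lemma kernel_operator_exists:
  assumes [measurable]: "h \<in> borel_measurable (M \<Otimes>\<^sub>M M)" and fin: "\<And>z. h z < top" and C: "knorm M h \<le> ennreal C" "0 \<le> C"
  shows "\<exists>H. is_kernel M H h"
proof -
  have eq: "(\<lambda>z. ennreal (enn2real (h z))) = h"
    using fin by simp
  have "is_kernel M (kint M (\<lambda>z. enn2real (h z))) (\<lambda>z. ennreal (enn2real (h z)))"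
    by (rule kint_has_kernel(3)[OF _ _ _ C(2)]) (use C(1) in \<open>simp_all add: eq\<close>)
  then show ?thesis
    unfolding eq by blast
qed

text \<open>Domination by a constant on a set of finite measure upgrades pointwise convergence to
  convergence in Hilbert-Schmidt norm, hence in operator norm, and norm limits of compact operators
  are compact.\<close>

lemma compact_kernel_limit:
  assumes [measurable]: "h \<in> borel_measurable (M \<Otimes>\<^sub>M M)" "E \<in> sets (M \<Otimes>\<^sub>M M)"
    and E: "emeasure (M \<Otimes>\<^sub>M M) E < top"
    and hk: "\<And>n. compact_kernel M (k n)" "\<And>n z. k n z \<le> h z" "\<And>z. h z \<le> ennreal B * indicator E z"
    and lim: "\<And>z. (\<lambda>n. k n z) \<longlonglongrightarrow> h z"
  shows "compact_kernel M h"
proof -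
  have [measurable]: "k n \<in> borel_measurable (M \<Otimes>\<^sub>M M)" for n
    using hk(1)[of n] is_kernelD(2) unfolding compact_kernel_def by blast
  have fin: "h z < top" for z
    using hk(3)[of z] by (rule le_less_trans) (simp add: indicator_def)
  define w where "w z = (ennreal B)\<^sup>2 * indicator E z" for z
  have [measurable]: "w \<in> borel_measurable (M \<Otimes>\<^sub>M M)"
    unfolding w_def by measurable
  have hw: "(h z)\<^sup>2 \<le> w z" for z
    using power_mono[OF hk(3)[of z], of 2] by (auto simp: w_def indicator_def split: if_splits)
  have wfin: "(\<integral>\<^sup>+z. w z \<partial>(M \<Otimes>\<^sub>M M)) < \<infinity>"
    unfolding w_def using E by (simp add: nn_integral_cmult_indicator ennreal_mult_less_top power_less_top_ennreal)
  have HS: "knorm M d \<le> ennreal (sqrt (enn2real (\<integral>\<^sup>+z. (d z)\<^sup>2 \<partial>(M \<Otimes>\<^sub>M M))))"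
    if [measurable]: "d \<in> borel_measurable (M \<Otimes>\<^sub>M M)" and dh: "\<And>z. d z \<le> h z" for d
  proof (rule knorm_le_hilbert_schmidt_norm)
    have "(\<integral>\<^sup>+z. (d z)\<^sup>2 \<partial>(M \<Otimes>\<^sub>M M)) \<le> (\<integral>\<^sup>+z. w z \<partial>(M \<Otimes>\<^sub>M M))"
      using power_mono[OF dh, of _ 2] hw by (intro nn_integral_mono) (meson order_trans zero_le)
    then have "(\<integral>\<^sup>+z. (d z)\<^sup>2 \<partial>(M \<Otimes>\<^sub>M M)) < top"
      using wfin by (simp add: le_less_trans)
    then show "(\<integral>\<^sup>+z. (d z)\<^sup>2 \<partial>(M \<Otimes>\<^sub>M M)) \<le> ennreal ((sqrt (enn2real (\<integral>\<^sup>+z. (d z)\<^sup>2 \<partial>(M \<Otimes>\<^sub>M M))))\<^sup>2)"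
      by simp
  qed simp_all
  obtain H where H: "is_kernel M H h"
    using kernel_operator_exists[OF _ fin HS[of h]] by auto
  have "e \<in> noncompact_bounds M H" if e: "0 < e" for e
  proof -
    define d where "d n z = h z - k n z" for n z
    have [measurable]: "d n \<in> borel_measurable (M \<Otimes>\<^sub>M M)" for n
      unfolding d_def by measurable
    have dh: "d n z \<le> h z" for n z
      unfolding d_def by (rule diff_le_self_ennreal)
    have d0: "(\<lambda>n. d n z) \<longlonglongrightarrow> 0" for z
      using tendsto_diff_ennreal[OF tendsto_const lim[of z], of "h z"] fin[of z] by (simp add: d_def)
    have "(\<lambda>n. \<integral>\<^sup>+z. (d n z)\<^sup>2 \<partial>(M \<Otimes>\<^sub>M M)) \<longlonglongrightarrow> (\<integral>\<^sup>+z. 0 \<partial>(M \<Otimes>\<^sub>M M))"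
    proof (rule nn_integral_dominated_convergence[OF _ _ _ _ wfin])
      show "AE z in M \<Otimes>\<^sub>M M. (d j z)\<^sup>2 \<le> w z" for j
        using power_mono[OF dh, of j _ 2] hw by (intro AE_I2) (meson order_trans zero_le)
      show "AE z in M \<Otimes>\<^sub>M M. (\<lambda>i. (d i z)\<^sup>2) \<longlonglongrightarrow> 0"
        unfolding power2_eq_square using tendsto_mult_ennreal[OF d0 d0] by (intro AE_I2) simp
    qed measurable
    then have "(\<lambda>n. \<integral>\<^sup>+z. (d n z)\<^sup>2 \<partial>(M \<Otimes>\<^sub>M M)) \<longlonglongrightarrow> 0"
      by simp
    moreover have "(0::ennreal) < ennreal ((e / 4)\<^sup>2)"
      using e by simp
    ultimately have "\<forall>\<^sub>F n in sequentially. (\<integral>\<^sup>+z. (d n z)\<^sup>2 \<partial>(M \<Otimes>\<^sub>M M)) < ennreal ((e / 4)\<^sup>2)"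
      by (rule order_tendstoD)
    then obtain n where n: "(\<integral>\<^sup>+z. (d n z)\<^sup>2 \<partial>(M \<Otimes>\<^sub>M M)) < ennreal ((e / 4)\<^sup>2)"
      by (auto simp: eventually_sequentially)
    have kn: "knorm M (d n) \<le> ennreal (e / 4)"
      by (rule knorm_le_hilbert_schmidt_norm) (use n e in auto)
    obtain K where K: "is_kernel M K (k n)" "{0<..} \<subseteq> noncompact_bounds M K"
      using hk(1)[of n] unfolding compact_kernel_def by blast
    have "(\<lambda>z. k n z + d n z) = h"
      unfolding d_def using hk(2)[of n] by (auto simp: add_diff_inverse_ennreal)
    then have HK: "is_kernel M (\<lambda>f x. H f x - K f x) (d n)"
      using is_kernel_diff[OF _ K(1), of H "d n"] H by simp
    have "op_norm M (\<lambda>f x. H f x - K f x) \<le> e / 4"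
      using kn e unfolding knorm_eq_op_norm[OF HK] by simp
    then have "op_norm M (\<lambda>f x. H f x - K f x) < e / 2"
      using e by simp
    then have "e / 2 + e / 2 \<in> noncompact_bounds M H"
      using K(2) e
      by (intro noncompact_bounds_perturb[OF is_kernelD(1)[OF H] is_kernelD(1)[OF K(1)]]) auto
    then show ?thesis by simp
  qed
  then show ?thesis
    unfolding compact_kernel_def using H by blast
qed

text \<open>The operator has rank one: it multiplies the indicator of \<open>P\<close> by the inner
  product with the indicator of \<open>Q\<close>. On the unit ball the coefficient stays in a
  compact disc, and a finite net of the disc gives a net of functions.\<close>

lemma compact_kernel_rectangle:
  assumes P [measurable]: "P \<in> sets M" "Q \<in> sets M" and fin: "emeasure M P < top" "emeasure M Q < top"
  shows "compact_kernel M (indicator (P \<times> Q))"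
proof -
  define p q where "p = sqrt (measure M P)" and "q = sqrt (measure M Q)"
  have pq: "emeasure M P = ennreal (p\<^sup>2)" "emeasure M Q = ennreal (q\<^sup>2)" "0 \<le> p" "0 \<le> q"
    using fin by (auto simp: p_def q_def emeasure_eq_ennreal_measure less_top[symmetric])
  define a :: "'a \<times> 'a \<Rightarrow> real" where "a = indicator (P \<times> Q)"
  have [measurable]: "a \<in> borel_measurable (M \<Otimes>\<^sub>M M)"
    unfolding a_def by measurable
  have ae: "(\<lambda>z. ennreal (a z)) = indicator (P \<times> Q)"
    by (auto simp: a_def indicator_def)
  have "(\<integral>\<^sup>+z. (indicator (P \<times> Q) z)\<^sup>2 \<partial>(M \<Otimes>\<^sub>M M)) = (\<integral>\<^sup>+z. indicator (P \<times> Q) z \<partial>(M \<Otimes>\<^sub>M M))"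
    by (intro nn_integral_cong) (auto simp: indicator_def)
  also have "\<dots> = emeasure M P * emeasure M Q"
    by (simp add: emeasure_pair_measure_Times)
  also have "\<dots> = ennreal ((p * q)\<^sup>2)"
    using pq by (simp add: ennreal_mult[symmetric] power_mult_distrib)
  finally have "knorm M (indicator (P \<times> Q)) \<le> ennreal (p * q)"
    by (intro knorm_le_hilbert_schmidt_norm) (use pq in auto)
  then have K: "is_kernel M (kint M a) (indicator (P \<times> Q))"
    using kint_has_kernel(3)[of a "p * q"] pq unfolding ae by (simp add: a_def)
  have iP: "(\<lambda>x. c * indicator P x) \<in> L2 M" "l2_norm M (\<lambda>x. c * indicator P x) = cmod c * p" for c
  proof -
    have int: "(\<integral>\<^sup>+x. (enorm (indicator P) x)\<^sup>2 \<partial>M) = ennreal (p\<^sup>2)"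
    proof -
      have "(\<integral>\<^sup>+x. (enorm (indicator P) x)\<^sup>2 \<partial>M) = (\<integral>\<^sup>+x. indicator P x \<partial>M)"
        by (intro nn_integral_cong) (auto simp: indicator_def)
      then show ?thesis using pq by simp
    qed
    then have L: "(indicator P :: 'a \<Rightarrow> complex) \<in> L2 M"
      by (simp add: L2_iff_nn)
    then show "(\<lambda>x. c * indicator P x) \<in> L2 M"
      by (rule L2_scale)
    have "(l2_norm M (indicator P :: 'a \<Rightarrow> complex))\<^sup>2 = p\<^sup>2"
      using nn_integral_L2[OF L] int by simp
    then show "l2_norm M (\<lambda>x. c * indicator P x) = cmod c * p"
      using pq by (simp add: l2_norm_scale power2_eq_iff_nonneg)
  qed
  have iQ: "(indicator Q :: 'a \<Rightarrow> complex) \<in> L2 M" "l2_norm M (indicator Q :: 'a \<Rightarrow> complex) = q"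
  proof -
    have int: "(\<integral>\<^sup>+x. (enorm (indicator Q) x)\<^sup>2 \<partial>M) = ennreal (q\<^sup>2)"
    proof -
      have "(\<integral>\<^sup>+x. (enorm (indicator Q) x)\<^sup>2 \<partial>M) = (\<integral>\<^sup>+x. indicator Q x \<partial>M)"
        by (intro nn_integral_cong) (auto simp: indicator_def)
      then show ?thesis using pq by simp
    qed
    then show L: "(indicator Q :: 'a \<Rightarrow> complex) \<in> L2 M"
      by (simp add: L2_iff_nn)
    have "(l2_norm M (indicator Q :: 'a \<Rightarrow> complex))\<^sup>2 = q\<^sup>2"
      using nn_integral_L2[OF L] int by simp
    then show "l2_norm M (indicator Q :: 'a \<Rightarrow> complex) = q"
      using pq by (simp add: power2_eq_iff_nonneg)
  qed
  have form: "kint M a f = (\<lambda>x. l2_inner M f (indicator Q) * indicator P x)" for f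
  proof
    fix x
    have "kint M a f x = (CLINT y|M. indicator P x * (f y * cnj (indicator Q y)))"
      unfolding kint_def a_def by (intro Bochner_Integration.integral_cong) (auto simp: indicator_def)
    then show "kint M a f x = l2_inner M f (indicator Q) * indicator P x"
      by (simp add: l2_inner_def)
  qed
  have "e \<in> noncompact_bounds M (kint M a)" if e: "0 < e" for e
  proof -
    \<comment> \<open>The divisor is 1 + p because \<open>P\<close> may be a null set.\<close>
    have "0 < e / (1 + p)"
      using e pq by simp
    moreover have "compact (cball (0::complex) q)"
      by simp
    ultimately obtain D where D: "finite D" "cball (0::complex) q \<subseteq> (\<Union>c\<in>D. ball c (e / (1 + p)))"
      unfolding compact_eq_totally_bounded by blast
    have "\<exists>g\<in>(\<lambda>c x. c * indicator P x) ` D. l2_norm M (\<lambda>x. kint M a f x - g x) \<le> e"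
      if f: "f \<in> L2 M" "l2_norm M f \<le> 1" for f
    proof -
      let ?t = "l2_inner M f (indicator Q)"
      have "cmod ?t \<le> l2_norm M f * q"
        using cmod_l2_inner_le[OF f(1) iQ(1)] by (simp add: iQ(2))
      also have "\<dots> \<le> 1 * q"
        using f pq by (intro mult_right_mono) auto
      finally have "?t \<in> cball 0 q" by simp
      then obtain c where c: "c \<in> D" "dist c ?t < e / (1 + p)"
        using D(2) by auto
      have "l2_norm M (\<lambda>x. kint M a f x - c * indicator P x) = l2_norm M (\<lambda>x. (?t - c) * indicator P x)"
        by (simp add: form left_diff_distrib)
      also have "\<dots> = cmod (?t - c) * p"
        by (rule iP(2))
      also have "\<dots> \<le> e / (1 + p) * p"
        using c(2) pq by (intro mult_right_mono) (auto simp: dist_norm norm_minus_commute)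
      also have "\<dots> \<le> e"
        using e pq by (simp add: field_simps)
      finally show ?thesis
        using c(1) by auto
    qed
    then show ?thesis
      unfolding noncompact_bounds_def using e D(1) iP(1)
      by (auto intro!: exI[of _ "(\<lambda>c x. c * indicator P x) ` D"])
  qed
  then show ?thesis
    unfolding compact_kernel_def using K by blast
qed

text \<open>Rectangles are an intersection-stable generator. The sets with compact cut-off to
  \<open>X\<close> times \<open>X\<close> are closed under complements by subtraction of kernels and
  under countable disjoint unions by \<open>compact_kernel_limit\<close>.\<close>

lemma compact_kernel_set:
  assumes X [measurable]: "X \<in> sets M" and fin: "emeasure M X < top" and S: "S \<in> sets (M \<Otimes>\<^sub>M M)"
  shows "compact_kernel M (indicator (S \<inter> X \<times> X))"
proof -
  let ?E = "X \<times> X"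
  have EN [measurable]: "?E \<in> sets (M \<Otimes>\<^sub>M M)"
    by measurable
  have Efin: "emeasure (M \<Otimes>\<^sub>M M) ?E < top"
    using fin by (simp add: emeasure_pair_measure_Times ennreal_mult_less_top)
  have Esub: "?E \<subseteq> space (M \<Otimes>\<^sub>M M)"
    using sets.sets_into_space[OF EN] .
  note sets_N = sets_pair_measure[of M M]
  have "S \<in> sigma_sets (space M \<times> space M) {a \<times> b | a b. a \<in> sets M \<and> b \<in> sets M}"
    using S by (simp add: sets_N)
  with Int_stable_pair_measure_generator pair_measure_closed show ?thesis
  proof (induct rule: sigma_sets_induct_disjoint)
    case (basic A)
    then obtain P Q where A: "A = P \<times> Q" and [measurable]: "P \<in> sets M" "Q \<in> sets M"
      by auto
    have "A \<inter> ?E = (P \<inter> X) \<times> (Q \<inter> X)"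
      using A by auto
    moreover have "emeasure M (P \<inter> X) < top" "emeasure M (Q \<inter> X) < top"
      using emeasure_mono[of "P \<inter> X" X M] emeasure_mono[of "Q \<inter> X" X M] fin by (auto intro: le_less_trans)
    ultimately show ?case
      using compact_kernel_rectangle[of "P \<inter> X" "Q \<inter> X"] by simp
  next
    case empty
    show ?case
      using compact_kernel_0 by (simp add: indicator_def[abs_def])
  next
    case (compl A)
    have [measurable]: "A \<in> sets (M \<Otimes>\<^sub>M M)"
      using compl(1) by (simp add: sets_N)
    have "(indicator ?E :: 'a \<times> 'a \<Rightarrow> ennreal) = (\<lambda>z. indicator (A \<inter> ?E) z + indicator ((space M \<times> space M - A) \<inter> ?E) z)"
      using Esub by (auto simp: indicator_def space_pair_measure fun_eq_iff)
    moreover have "compact_kernel M (indicator ?E)"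
      by (intro compact_kernel_rectangle X fin)
    moreover have "(indicator ((space M \<times> space M - A) \<inter> ?E) :: _ \<Rightarrow> ennreal) \<in> borel_measurable (M \<Otimes>\<^sub>M M)"
      unfolding space_pair_measure[symmetric] by measurable
    ultimately show ?case
      using compact_kernel_diff[OF _ compl(2)] by simp
  next
    case (union A)
    have A [measurable]: "A i \<in> sets (M \<Otimes>\<^sub>M M)" for i
      using union(2) by (auto simp: sets_N)
    let ?k = "\<lambda>n z. indicator ((\<Union>i<n. A i) \<inter> ?E) z :: ennreal"
    have kn: "compact_kernel M (?k n)" for n
    proof (induction n)
      case 0
      show ?case
        using compact_kernel_0 by (simp add: indicator_def[abs_def])
    next
      case (Suc n)
      have "A n \<inter> A i = {}" if "i < n" for i
        using union(1) that by (auto simp: disjoint_family_on_def)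
      then have "?k (Suc n) = (\<lambda>z. ?k n z + indicator (A n \<inter> ?E) z)"
        by (auto simp: indicator_def fun_eq_iff lessThan_Suc)
      with compact_kernel_add[OF Suc union(3)[of n]] show ?case
        by simp
    qed
    show ?case
    proof (rule compact_kernel_limit[OF _ EN Efin kn])
      show "(indicator ((\<Union>i. A i) \<inter> ?E) :: _ \<Rightarrow> ennreal) \<in> borel_measurable (M \<Otimes>\<^sub>M M)"
        by measurable
      show "?k n z \<le> indicator ((\<Union>i. A i) \<inter> ?E) z" for n z
        by (auto simp: indicator_def)
      show "indicator ((\<Union>i. A i) \<inter> ?E) z \<le> ennreal 1 * indicator ?E z" for z
        by (auto simp: indicator_def)
      show "(\<lambda>n. ?k n z) \<longlonglongrightarrow> indicator ((\<Union>i. A i) \<inter> ?E) z" for z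
      proof (cases "z \<in> (\<Union>i. A i) \<inter> ?E")
        case True
        then obtain i where "z \<in> A i" by blast
        then have "\<forall>\<^sub>F n in sequentially. ?k n z = 1"
          using True by (intro eventually_sequentiallyI[of "Suc i"]) (auto simp: indicator_def)
        then show ?thesis
          using True by (simp add: tendsto_eventually)
      next
        case False
        then have "?k n z = 0" for n
          by (auto simp: indicator_def)
        with False show ?thesis by simp
      qed
    qed
  qed
qed

end

context sigma_finite_measure
begin

interpretation pr: pair_sigma_finite M M ..

text \<open>Induction over the construction of measurable functions from indicators; increasing
  limits are covered by \<open>compact_kernel_limit\<close>. The bound is generalized because it
  changes on passing to the factor of a scalar multiple.\<close>

lemma compact_kernel_bounded:
  assumes X [measurable]: "X \<in> sets M" and fin: "emeasure M X < top"
    and h: "h \<in> borel_measurable (M \<Otimes>\<^sub>M M)" and B: "\<And>z. z \<in> space (M \<Otimes>\<^sub>M M) \<Longrightarrow> h z \<le> ennreal B"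
  shows "compact_kernel M (\<lambda>z. h z * indicator (X \<times> X) z)"
proof -
  let ?E = "X \<times> X"
  have EN [measurable]: "?E \<in> sets (M \<Otimes>\<^sub>M M)"
    by measurable
  have Efin: "emeasure (M \<Otimes>\<^sub>M M) ?E < top"
    using fin by (simp add: emeasure_pair_measure_Times ennreal_mult_less_top)
  have Esub: "z \<in> ?E \<Longrightarrow> z \<in> space (M \<Otimes>\<^sub>M M)" for z
    using sets.sets_into_space[OF EN] by blast
  from h have "(\<forall>z\<in>space (M \<Otimes>\<^sub>M M). h z \<le> ennreal B) \<longrightarrow> compact_kernel M (\<lambda>z. h z * indicator ?E z)" for B
  proof (induction arbitrary: B rule: borel_measurable_induct)
    case (cong f g)
    have "(\<lambda>z. f z * indicator ?E z) = (\<lambda>z. g z * indicator ?E z)"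
      using cong(3) Esub by (auto simp: indicator_def fun_eq_iff)
    with cong(3,4) show ?case by metis
  next
    case (set A)
    have "(\<lambda>z. indicator A z * indicator ?E z) = (indicator (A \<inter> ?E) :: _ \<Rightarrow> ennreal)"
      by (auto simp: indicator_def)
    then show ?case
      using compact_kernel_set[OF X fin set] by simp
  next
    case (mult u c)
    show ?case
    proof (cases "c = 0")
      case True
      then show ?thesis by (simp add: compact_kernel_0)
    next
      case False
      then obtain r where r: "c = ennreal r" "0 < r"
        using mult(1) by (cases c) (auto simp: less_le)
      show ?thesis
      proof
        assume le: "\<forall>z\<in>space (M \<Otimes>\<^sub>M M). c * u z \<le> ennreal B"
        have "u z \<le> ennreal (B / r)" if z: "z \<in> space (M \<Otimes>\<^sub>M M)" for z
        proof -
          obtain s where s: "u z = ennreal s" "0 \<le> s"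
            using mult(3)[OF z] by (cases "u z") auto
          have "ennreal (r * s) \<le> ennreal B"
            using le[rule_format, OF z] r(2) s(2) unfolding r(1) s(1) by (simp add: ennreal_mult)
          then show ?thesis
          \<comment> \<open>\<open>ennreal\<close> maps negative reals to 0, so \<open>B\<close> can
            be compared as a real number only when r s is positive.\<close>
          proof (cases "s = 0")
            case False
            then have "0 < r * s"
              using r s by simp
            then have "r * s \<le> B"
              using \<open>ennreal (r * s) \<le> ennreal B\<close> by (auto simp: ennreal_le_iff2)
            then have "s \<le> B / r"
              using r by (simp add: field_simps)
            then show ?thesis
              unfolding s(1) by (rule ennreal_leI)
          qed (simp add: s)
        qed
        then have "compact_kernel M (\<lambda>z. ennreal r * (u z * indicator ?E z))"
          using mult(4)[of "B / r"] r by (intro compact_kernel_scale) auto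
        then show "compact_kernel M (\<lambda>z. c * u z * indicator ?E z)"
          by (simp add: r mult.assoc)
      qed
    qed
  next
    case (add u v)
    show ?case
    proof
      assume le: "\<forall>z\<in>space (M \<Otimes>\<^sub>M M). v z + u z \<le> ennreal B"
      have "v z \<le> ennreal B \<and> u z \<le> ennreal B" if "z \<in> space (M \<Otimes>\<^sub>M M)" for z
        using le that by (meson add_increasing add_increasing2 order_refl order_trans zero_le)
      then have "compact_kernel M (\<lambda>z. v z * indicator ?E z + u z * indicator ?E z)"
        using add.IH(1)[of B] add.IH(2)[of B] by (intro compact_kernel_add) auto
      then show "compact_kernel M (\<lambda>z. (v z + u z) * indicator ?E z)"
        by (simp add: distrib_right)
    qed
  next
    case (seq U)
    note [measurable] = seq(1)
    show ?case
    proof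
      assume le: "\<forall>z\<in>space (M \<Otimes>\<^sub>M M). (SUP i. U i) z \<le> ennreal B"
      have Ui: "U i z \<le> (SUP i. U i) z" for i z
        by (simp add: SUP_apply) (rule SUP_upper, simp)
      have k: "compact_kernel M (\<lambda>z. U i z * indicator ?E z)" for i
        using seq.IH(1)[of i B] le Ui[of i] order_trans by blast
      show "compact_kernel M (\<lambda>z. (SUP i. U i) z * indicator ?E z)"
      proof (rule compact_kernel_limit[OF _ EN Efin k])
        show "(\<lambda>z. (SUP i. U i) z * indicator ?E z) \<in> borel_measurable (M \<Otimes>\<^sub>M M)"
          unfolding SUP_apply by measurable
        show "U n z * indicator ?E z \<le> (SUP i. U i) z * indicator ?E z" for n z
          by (intro mult_right_mono Ui) simp
        show "(SUP i. U i) z * indicator ?E z \<le> ennreal B * indicator ?E z" for z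
          using le Esub[of z] by (auto simp: indicator_def)
        show "(\<lambda>n. U n z * indicator ?E z) \<longlonglongrightarrow> (SUP i. U i) z * indicator ?E z" for z
        proof (cases "z \<in> ?E")
          case True
          have "incseq (\<lambda>n. U n z)"
            using seq.hyps(3) unfolding incseq_def le_fun_def by blast
          then have "(\<lambda>n. U n z) \<longlonglongrightarrow> (SUP i. U i z)"
            by (rule LIMSEQ_SUP)
          with True show ?thesis by (simp add: SUP_apply image_image)
        qed simp
      qed
    qed
  qed
  then show ?thesis
    using B by blast
qed

section \<open>Cutting kernels off to sets that shrink to a null set\<close>

lemma is_kernel_cong:
  assumes K: "is_kernel M K k" and l: "l \<in> borel_measurable (M \<Otimes>\<^sub>M M)"
    and eq: "\<And>z. z \<in> space (M \<Otimes>\<^sub>M M) \<Longrightarrow> k z = l z"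
  shows "is_kernel M K l"
  unfolding is_kernel_def
proof (intro conjI ballI is_kernelD(1)[OF K] l)
  fix f assume "f \<in> L2 M"
  from is_kernelD(3)[OF K this] AE_space
  show "AE x in M. K (cabs f) x \<in> \<real>\<^sub>\<ge>\<^sub>0 \<and> ennreal (Re (K (cabs f) x)) = kapp M l (enorm f) x"
  proof eventually_elim
    case (elim x)
    have "kapp M k (enorm f) x = kapp M l (enorm f) x"
      unfolding kapp_def using elim(2) by (intro nn_integral_cong) (simp add: eq space_pair_measure)
    with elim(1) show ?case by simp
  qed
qed

text \<open>The indicators of an exhausting sequence of sets of finite measure lie in
  \<open>L2 M\<close>, and their images under \<open>K\<close> are finite almost everywhere.\<close>

lemma is_kernel_finite_AE:
  assumes K: "is_kernel M K k"
  shows "AE x in M. AE y in M. k (x, y) < top"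
proof -
  note [measurable] = is_kernelD(2)[OF K]
  obtain X :: "nat \<Rightarrow> 'a set" where X: "range X \<subseteq> sets M" "(\<Union>i. X i) = space M" "\<And>i. emeasure M (X i) \<noteq> \<infinity>"
    by (rule sigma_finite) blast
  have [measurable]: "X n \<in> sets M" for n
    using X(1) by auto
  have "AE x in M. AE y in M. y \<in> X n \<longrightarrow> k (x, y) < top" for n
  proof -
    let ?f = "indicator (X n) :: 'a \<Rightarrow> complex"
    have "(\<integral>\<^sup>+x. (enorm ?f x)\<^sup>2 \<partial>M) = (\<integral>\<^sup>+x. indicator (X n) x \<partial>M)"
      by (intro nn_integral_cong) (auto simp: indicator_def)
    then have f: "?f \<in> L2 M"
      using X(3)[of n] by (simp add: L2_iff_nn less_top)
    have "AE x in M. kapp M k (enorm ?f) x \<noteq> \<infinity>"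
      using is_kernelD(3)[OF K f] by eventually_elim (metis ennreal_neq_top infinity_ennreal_def)
    then show ?thesis
      using AE_space
    proof eventually_elim
      case (elim x)
      note [measurable] = elim(2)
      have "AE y in M. k (x, y) * enorm ?f y \<noteq> \<infinity>"
        using elim(1) unfolding kapp_def by (intro nn_integral_noteq_infinite) measurable
      then show ?case
        by eventually_elim (auto simp: indicator_def less_top)
    qed
  qed
  then have "AE x in M. \<forall>n. AE y in M. y \<in> X n \<longrightarrow> k (x, y) < top"
    by (simp add: AE_all_countable)
  then show ?thesis
  proof eventually_elim
    case (elim x)
    then have "AE y in M. \<forall>n. y \<in> X n \<longrightarrow> k (x, y) < top"
      by (rule iffD2[OF AE_all_countable])
    then show ?case
      using AE_space by eventually_elim (use X(2) in blast)
  qed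
qed

text \<open>Let \<open>N\<close> be a finite \<open>d\<close>-net of the image of the unit ball under \<open>A\<close>, \<open>u = \<Sum>g\<in>N. |g|\<close>, and let
  \<open>B\<close> have the kernel of \<open>A\<close> cut off to \<open>D n\<close>. For \<open>f \<ge> 0\<close> in the unit ball some \<open>h \<in> N\<close> satisfies
  \<open>B f \<le> |A f - h| + min (B f) u\<close>, and \<open>\<parallel>min (B f) u\<parallel>\<^sup>2 \<le> \<langle>B f, u\<rangle> = \<langle>f, B\<^sup>* u\<rangle>\<close> is small uniformly in
  \<open>f\<close> because \<open>B\<^sup>* u\<close> tends to zero by dominated convergence.\<close>

lemma knorm_restrict_le:
  assumes K: "is_kernel M A a" and Dm [measurable]: "\<And>n. D n \<in> sets (M \<Otimes>\<^sub>M M)"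
    and D0: "AE x in M. AE y in M. \<forall>\<^sub>F n in sequentially. (x, y) \<notin> D n"
    and d: "d \<in> noncompact_bounds M A" and e: "d < e"
  shows "\<forall>\<^sub>F n in sequentially. knorm M (\<lambda>z. a z * indicator (D n) z) \<le> ennreal e"
proof -
  note [measurable] = is_kernelD(2)[OF K] and bA = is_kernelD(1)[OF K]
  obtain N where d0: "d > 0" and N: "finite N" "N \<subseteq> L2 M"
    "\<And>f. f \<in> L2 M \<Longrightarrow> l2_norm M f \<le> 1 \<Longrightarrow> \<exists>g\<in>N. l2_norm M (\<lambda>x. A f x - g x) \<le> d"
    using d unfolding noncompact_bounds_def by blast
  define u where "u x = (\<Sum>g\<in>N. cabs g x)" for x
  have uL: "u \<in> L2 M"
    unfolding u_def by (rule conjunct1[OF L2_sum]) (use N(2) in auto)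
  then have [measurable]: "u \<in> borel_measurable M"
    by (simp add: L2_def)
  have ug: "enorm g x \<le> enorm u x" if "g \<in> N" for g x
  proof -
    have "cmod (g x) \<le> (\<Sum>g\<in>N. cmod (g x))"
      using N(1) that by (intro member_le_sum) auto
    also have "\<dots> = cmod (u x)"
      unfolding u_def of_real_sum[symmetric] norm_of_real by (simp add: sum_nonneg)
    finally show ?thesis by (rule ennreal_leI)
  qed
  define b where "b n z = a z * indicator (D n) z" for n z
  have [measurable]: "b n \<in> borel_measurable (M \<Otimes>\<^sub>M M)" for n
    unfolding b_def by measurable
  have ba: "b n z \<le> a z" for n z
    by (auto simp: b_def indicator_def)
  define H where "H = kapp M (kadj a) (enorm u)"
  define h where "h n = kapp M (kadj (b n)) (enorm u)" for n
  have [measurable]: "H \<in> borel_measurable M" "h n \<in> borel_measurable M" for n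
    unfolding H_def h_def by measurable
  have hH: "h n y \<le> H y" for n y
    unfolding h_def H_def by (rule kapp_mono) (auto simp: kadj_def ba)
  have "knorm M (kadj a) \<le> ennreal (op_norm M A)"
    unfolding knorm_kadj[OF is_kernelD(2)[OF K]] knorm_eq_op_norm[OF K] ..
  then have "(\<integral>\<^sup>+y. (H y)\<^sup>2 \<partial>M) \<le> ennreal ((op_norm M A * l2_norm M u)\<^sup>2)"
    unfolding H_def by (intro nn_integral_kapp_L2 op_norm_nonneg bA uL) measurable
  then have Hfin: "(\<integral>\<^sup>+y. (H y)\<^sup>2 \<partial>M) < \<infinity>"
    by (rule le_less_trans) simp
  then have "AE y in M. (H y)\<^sup>2 \<noteq> \<infinity>"
    by (intro nn_integral_noteq_infinite) auto
  \<comment> \<open>The transposed kernel is integrated over the first variable, so the two a.e.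
    quantifiers have to change places.\<close>
  moreover have "AE y in M. AE x in M. \<forall>\<^sub>F n in sequentially. (x, y) \<notin> D n"
  proof (rule iffD1[OF pr.AE_commute D0])
    show "{z \<in> space (M \<Otimes>\<^sub>M M). \<forall>\<^sub>F n in sequentially. (fst z, snd z) \<notin> D n} \<in> sets (M \<Otimes>\<^sub>M M)"
      unfolding eventually_sequentially prod.collapse by measurable
  qed
  ultimately have h0: "AE y in M. (\<lambda>n. (h n y)\<^sup>2) \<longlonglongrightarrow> 0"
    using AE_space
  proof eventually_elim
    case (elim y)
    note [measurable] = elim(3)
    have Hy: "(\<integral>\<^sup>+x. a (x, y) * enorm u x \<partial>M) < \<infinity>"
      using elim(1) by (simp add: H_def kapp_def power_eq_top_ennreal less_top)
    have "(\<lambda>n. \<integral>\<^sup>+x. b n (x, y) * enorm u x \<partial>M) \<longlonglongrightarrow> (\<integral>\<^sup>+x. 0 \<partial>M)"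
    proof (rule nn_integral_dominated_convergence[OF _ _ _ _ Hy])
      show "AE x in M. b j (x, y) * enorm u x \<le> a (x, y) * enorm u x" for j
        by (intro AE_I2 mult_right_mono ba) simp
      show "AE x in M. (\<lambda>i. b i (x, y) * enorm u x) \<longlonglongrightarrow> 0"
        using elim(2)
      proof eventually_elim
        case (elim x)
        then have "\<forall>\<^sub>F n in sequentially. b n (x, y) * enorm u x = 0"
          by eventually_elim (simp add: b_def)
        then show ?case by (rule tendsto_eventually)
      qed
    qed measurable
    then have "(\<lambda>n. h n y) \<longlonglongrightarrow> 0"
      by (simp add: h_def kapp_def)
    then show ?case
      unfolding power2_eq_square using tendsto_mult_ennreal[of "\<lambda>n. h n y" 0 sequentially "\<lambda>n. h n y" 0] by simp
  qed
  have "(\<lambda>n. \<integral>\<^sup>+y. (h n y)\<^sup>2 \<partial>M) \<longlonglongrightarrow> (\<integral>\<^sup>+y. 0 \<partial>M)"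
    by (rule nn_integral_dominated_convergence[OF _ _ _ _ Hfin h0])
       (auto intro!: AE_I2 power_mono hH)
  then have "(\<lambda>n. \<integral>\<^sup>+y. (h n y)\<^sup>2 \<partial>M) \<longlonglongrightarrow> 0"
    by simp
  \<comment> \<open>Two applications of Cauchy-Schwarz lie between this integral and
    \<open>J\<close>: the square of \<open>J\<close> is at most \<open>I\<close>, and the square of
    \<open>I\<close> is at most the integral. The fourth power thus leaves J \<le> e - d.\<close>
  moreover have "(0::ennreal) < ennreal ((e - d) ^ 4)"
    using e by simp
  ultimately have "\<forall>\<^sub>F n in sequentially. (\<integral>\<^sup>+y. (h n y)\<^sup>2 \<partial>M) < ennreal ((e - d) ^ 4)"
    by (rule order_tendstoD)
  then show ?thesis
  proof eventually_elim
    case (elim n)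
    show ?case
      unfolding knorm_def
    proof (intro SUP_least)
      fix f g assume "f \<in> unit_ball M" "g \<in> unit_ball M"
      then have fg: "f \<in> L2 M" "g \<in> L2 M" "l2_norm M f \<le> 1" "l2_norm M g \<le> 1"
        by (auto simp: unit_ball_def)
      have [measurable]: "f \<in> borel_measurable M" "g \<in> borel_measurable M"
        using fg by (auto simp: L2_def)
      have AfL: "A (cabs f) \<in> L2 M"
        by (rule bounded_operator_L2[OF bA L2_cmod[OF fg(1)]])
      obtain w where w: "w \<in> N" "l2_norm M (\<lambda>x. A (cabs f) x - w x) \<le> d"
        using N(3)[OF L2_cmod[OF fg(1)]] fg(3) by auto
      have wL: "w \<in> L2 M"
        using w N by auto
      define r where "r x = A (cabs f) x - w x" for x
      have rL: "r \<in> L2 M"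
        unfolding r_def by (rule L2_diff(1)[OF AfL wL])
      then have [measurable]: "r \<in> borel_measurable M"
        by (simp add: L2_def)
      define F where "F = kapp M (b n) (enorm f)"
      have [measurable]: "F \<in> borel_measurable M"
        unfolding F_def by measurable
      have "AE x in M. F x \<le> enorm r x + min (F x) (enorm u x)"
      proof -
        have "AE x in M. enorm (A (cabs f)) x = kapp M a (enorm f) x"
          using is_kernel_nonneg_eq[OF K L2_cmod[OF fg(1)]] by (simp add: nonneg_fun_def)
        then show ?thesis
        proof eventually_elim
          case (elim x)
          have "F x \<le> kapp M a (enorm f) x"
            unfolding F_def by (rule kapp_mono[OF ba])
          also have "\<dots> = enorm (A (cabs f)) x"
            using elim by simp
          also have "\<dots> \<le> ennreal (cmod (r x) + cmod (w x))"
            using norm_triangle_ineq[of "r x" "w x"] by (intro ennreal_leI) (simp add: r_def)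
          also have "\<dots> = enorm r x + enorm w x"
            by simp
          also have "\<dots> \<le> enorm r x + enorm u x"
            by (intro add_left_mono ug w)
          finally have "F x \<le> enorm r x + enorm u x" .
          then show ?case
            by (auto simp: min_def intro: add_increasing)
        qed
      qed
      then have "kform M (b n) (enorm f) (enorm g)
          \<le> (\<integral>\<^sup>+x. enorm r x * enorm g x + min (F x) (enorm u x) * enorm g x \<partial>M)"
        unfolding kform_def F_def[symmetric] distrib_right[symmetric]
        by (intro nn_integral_mono_AE) (auto elim!: eventually_mono intro: mult_right_mono)
      also have "\<dots> = (\<integral>\<^sup>+x. enorm r x * enorm g x \<partial>M) + (\<integral>\<^sup>+x. min (F x) (enorm u x) * enorm g x \<partial>M)"
        by (rule nn_integral_add) measurable
      also have "\<dots> \<le> ennreal d + ennreal (e - d)"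
      proof (rule add_mono)
        have "l2_norm M r * l2_norm M g \<le> d * 1"
          using w(2) fg d0 unfolding r_def[abs_def] by (intro mult_mono) auto
        then show "(\<integral>\<^sup>+x. enorm r x * enorm g x \<partial>M) \<le> ennreal d"
          using nn_integral_mult_L2[OF rL fg(2)] by (auto intro: order_trans ennreal_leI)
        define J where "J = (\<integral>\<^sup>+x. min (F x) (enorm u x) * enorm g x \<partial>M)"
        define I where "I = (\<integral>\<^sup>+x. F x * enorm u x \<partial>M)"
        have "J\<^sup>2 \<le> (\<integral>\<^sup>+x. (min (F x) (enorm u x))\<^sup>2 \<partial>M) * (\<integral>\<^sup>+x. (enorm g x)\<^sup>2 \<partial>M)"
          unfolding J_def by (rule Cauchy_Schwarz_nn_integral) measurable
        also have "\<dots> \<le> I * 1"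
        proof (rule mult_mono)
          show "(\<integral>\<^sup>+x. (min (F x) (enorm u x))\<^sup>2 \<partial>M) \<le> I"
            unfolding I_def power2_eq_square by (intro nn_integral_mono mult_mono) auto
          show "(\<integral>\<^sup>+x. (enorm g x)\<^sup>2 \<partial>M) \<le> 1"
            unfolding nn_integral_L2[OF fg(2)] using fg(4) by (simp add: ennreal_le_1 power_le_one)
        qed auto
        finally have J: "J\<^sup>2 \<le> I" by simp
        have "I = kform M (b n) (enorm f) (enorm u)"
          by (simp add: I_def kform_def F_def)
        also have "\<dots> = kform M (kadj (b n)) (enorm u) (enorm f)"
          by (rule kform_kadj[symmetric]) measurable
        also have "\<dots> = (\<integral>\<^sup>+x. h n x * enorm f x \<partial>M)"
          by (simp add: kform_def h_def)
        finally have "I\<^sup>2 \<le> (\<integral>\<^sup>+x. (h n x)\<^sup>2 \<partial>M) * (\<integral>\<^sup>+x. (enorm f x)\<^sup>2 \<partial>M)"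
          using Cauchy_Schwarz_nn_integral[of "h n" M "enorm f"] by simp
        also have "\<dots> \<le> ennreal ((e - d) ^ 4) * 1"
        proof (rule mult_mono)
          show "(\<integral>\<^sup>+x. (enorm f x)\<^sup>2 \<partial>M) \<le> 1"
            unfolding nn_integral_L2[OF fg(1)] using fg(3) by (simp add: ennreal_le_1 power_le_one)
        qed (use elim in auto)
        also have "\<dots> = ((ennreal (e - d))\<^sup>2)\<^sup>2"
          using e by (simp add: ennreal_power flip: power_mult)
        finally have "I \<le> (ennreal (e - d))\<^sup>2"
          by (rule ennreal_power2_le_imp_le)
        with J have "J\<^sup>2 \<le> (ennreal (e - d))\<^sup>2"
          by (rule order_trans)
        then show "J \<le> ennreal (e - d)"
          by (rule ennreal_power2_le_imp_le)
      qed
      also have "\<dots> = ennreal e"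
        using d0 e by (simp flip: ennreal_plus)
      finally show "kform M (\<lambda>z. a z * indicator (D n) z) (enorm f) (enorm g) \<le> ennreal e"
        by (simp only: b_def[abs_def])
    qed
  qed
qed

lemma meas_noncompact_mean_dominated:
  assumes \<alpha>: "\<alpha> \<in> {0..1}" and "mean_dominated M \<alpha> C P Q"
  shows "meas_noncompact M C \<le> gmean \<alpha> (meas_noncompact M P) (meas_noncompact M Q)"
proof -
  obtain c p q where 1: "is_kernel M C c" "is_kernel M P p" "is_kernel M Q (kadj q)"
    "\<And>z. z \<in> space (M \<Otimes>\<^sub>M M) \<Longrightarrow> c z \<le> egmean \<alpha> (p z) (q z)"
    using assms(2) unfolding mean_dominated_def by blast
  note bC = is_kernelD(1)[OF 1(1)] and bP = is_kernelD(1)[OF 1(2)] and bQ = is_kernelD(1)[OF 1(3)]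
  note qm = is_kernel_kadj_measurable[OF 1(3)]
  note [measurable] = is_kernelD(2)[OF 1(1)] is_kernelD(2)[OF 1(2)] qm
  obtain X :: "nat \<Rightarrow> 'a set" where X: "range X \<subseteq> sets M" "(\<Union>i. X i) = space M"
    "\<And>i. emeasure M (X i) \<noteq> \<infinity>" "incseq X"
    by (rule sigma_finite_incseq) blast
  have [measurable]: "X n \<in> sets M" for n
    using X(1) by auto
  define G where "G n = {z \<in> space (M \<Otimes>\<^sub>M M). c z \<le> of_nat n} \<inter> X n \<times> X n" for n
  have Gm [measurable]: "G n \<in> sets (M \<Otimes>\<^sub>M M)" for n
    unfolding G_def by measurable
  define D where "D n = space (M \<Otimes>\<^sub>M M) - G n" for n
  have Dm [measurable]: "D n \<in> sets (M \<Otimes>\<^sub>M M)" for n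
    unfolding D_def by measurable
  \<comment> \<open>The kernel of \<open>Q\<close> is the transpose of \<open>q\<close>, so cutting
    \<open>q\<close> off to \<open>D n\<close> amounts to cutting the kernel of \<open>Q\<close> off
    to the reflected set.\<close>
  define D' where "D' n = {z \<in> space (M \<Otimes>\<^sub>M M). (snd z, fst z) \<in> D n}" for n
  have D'm [measurable]: "D' n \<in> sets (M \<Otimes>\<^sub>M M)" for n
  proof -
    have "D' n = (\<lambda>z. (snd z, fst z)) -` D n \<inter> space (M \<Otimes>\<^sub>M M)"
      by (auto simp: D'_def)
    moreover have "(\<lambda>z. (snd z, fst z)) \<in> (M \<Otimes>\<^sub>M M) \<rightarrow>\<^sub>M (M \<Otimes>\<^sub>M M)"
      by measurable
    ultimately show ?thesis
      using measurable_sets[OF _ Dm] by simp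
  qed
  have AE1: "AE x in M. AE y in M. \<forall>\<^sub>F n in sequentially. (x, y) \<notin> D n"
    using is_kernel_finite_AE[OF 1(1)] AE_space
  proof eventually_elim
    case (elim x)
    show ?case
      using elim(1) AE_space
    proof eventually_elim
      case (elim y)
      obtain r where r: "c (x, y) = ennreal r" "0 \<le> r"
        using elim(1) by (cases "c (x, y)") auto
      obtain k where k: "r \<le> real k"
        using real_arch_simple by blast
      obtain i j where ij: "x \<in> X i" "y \<in> X j"
        using elim(2) \<open>x \<in> space M\<close> X(2) by blast
      have "(x, y) \<in> G n" if n: "n \<ge> max k (max i j)" for n
      proof -
        have "c (x, y) \<le> of_nat n"
          using r k n by (simp add: ennreal_of_nat_eq_real_of_nat ennreal_leI)
        moreover have "x \<in> X n" "y \<in> X n"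
          using ij incseqD[OF X(4), of i n] incseqD[OF X(4), of j n] n by auto
        ultimately show ?thesis
          using elim(2) \<open>x \<in> space M\<close> by (simp add: G_def space_pair_measure)
      qed
      then show ?case
        by (intro eventually_sequentiallyI[of "max k (max i j)"]) (auto simp: D_def)
    qed
  qed
  have "AE y in M. AE x in M. \<forall>\<^sub>F n in sequentially. (x, y) \<notin> D n"
  proof (rule iffD1[OF pr.AE_commute AE1])
    show "{z \<in> space (M \<Otimes>\<^sub>M M). \<forall>\<^sub>F n in sequentially. (fst z, snd z) \<notin> D n} \<in> sets (M \<Otimes>\<^sub>M M)"
      unfolding eventually_sequentially prod.collapse by measurable
  qed
  then have AE2: "AE x in M. AE y in M. \<forall>\<^sub>F n in sequentially. (x, y) \<notin> D' n"
    by (auto simp: D'_def elim!: eventually_mono)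
  show ?thesis
  proof (rule le_gmean_limit[OF _ meas_noncompact_nonneg[OF bP] meas_noncompact_nonneg[OF bQ] \<alpha>])
    fix d e assume d: "meas_noncompact M P < d" and e: "meas_noncompact M Q < e"
    \<comment> \<open>The intermediate radius leaves room for two strict inequalities: it admits a
      finite net, being above the measure of noncompactness, and \<open>knorm_restrict_le\<close>
      then yields the larger bound \<open>d\<close>.\<close>
    obtain d' where d': "meas_noncompact M P < d'" "d' < d"
      using dense[OF d] by blast
    obtain e' where e': "meas_noncompact M Q < e'" "e' < e"
      using dense[OF e] by blast
    have de: "0 \<le> d" "0 \<le> e"
      using d e meas_noncompact_nonneg[OF bP] meas_noncompact_nonneg[OF bQ] by auto
    have "\<forall>\<^sub>F n in sequentially. knorm M (\<lambda>z. p z * indicator (D n) z) \<le> ennreal d"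
      by (rule knorm_restrict_le[OF 1(2) Dm AE1 meas_noncompact_less[OF bP d'(1)] d'(2)])
    moreover have "\<forall>\<^sub>F n in sequentially. knorm M (\<lambda>z. kadj q z * indicator (D' n) z) \<le> ennreal e"
      by (rule knorm_restrict_le[OF 1(3) D'm AE2 meas_noncompact_less[OF bQ e'(1)] e'(2)])
    ultimately have "\<forall>\<^sub>F n in sequentially. knorm M (\<lambda>z. p z * indicator (D n) z) \<le> ennreal d \<and>
        knorm M (\<lambda>z. kadj q z * indicator (D' n) z) \<le> ennreal e"
      by (rule eventually_conj)
    then obtain n where n: "knorm M (\<lambda>z. p z * indicator (D n) z) \<le> ennreal d"
      "knorm M (\<lambda>z. kadj q z * indicator (D' n) z) \<le> ennreal e"
      by (auto simp: eventually_sequentially)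
    have "kadj (\<lambda>z. q z * indicator (D n) z) z = kadj q z * indicator (D' n) z" for z
      by (cases z) (auto simp: kadj_def D'_def D_def indicator_def space_pair_measure)
    then have "(\<lambda>z. kadj q z * indicator (D' n) z) = kadj (\<lambda>z. q z * indicator (D n) z)"
      by auto
    with n(2) have nq: "knorm M (\<lambda>z. q z * indicator (D n) z) \<le> ennreal e"
      by (simp add: knorm_kadj)
    have "compact_kernel M (\<lambda>z. (c z * indicator (G n) z) * indicator (X n \<times> X n) z)"
    proof (rule compact_kernel_bounded[where B = "real n"])
      show "emeasure M (X n) < top"
        using X(3)[of n] by (simp add: less_top)
      show "c z * indicator (G n) z \<le> ennreal (real n)" for z
        by (auto simp: G_def indicator_def ennreal_of_nat_eq_real_of_nat)
    qed measurable
    moreover have "(\<lambda>z. (c z * indicator (G n) z) * indicator (X n \<times> X n) z) = (\<lambda>z. c z * indicator (G n) z)"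
      by (auto simp: G_def indicator_def fun_eq_iff)
    ultimately obtain H where H: "is_kernel M H (\<lambda>z. c z * indicator (G n) z)" "{0<..} \<subseteq> noncompact_bounds M H"
      unfolding compact_kernel_def by auto
    have split: "is_kernel M C (\<lambda>z. c z * indicator (G n) z + c z * indicator (D n) z)"
    proof (rule is_kernel_cong[OF 1(1)])
      fix z assume "z \<in> space (M \<Otimes>\<^sub>M M)"
      then show "c z = c z * indicator (G n) z + c z * indicator (D n) z"
        by (auto simp: D_def indicator_def)
    qed measurable
    have CH: "is_kernel M (\<lambda>f x. C f x - H f x) (\<lambda>z. c z * indicator (D n) z)"
      by (rule is_kernel_diff[OF split H(1)]) measurable
    have "knorm M (\<lambda>z. c z * indicator (D n) z)
        \<le> egmean \<alpha> (knorm M (\<lambda>z. p z * indicator (D n) z)) (knorm M (\<lambda>z. q z * indicator (D n) z))"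
    \<comment> \<open>An indicator is its own weighted mean, so cutting all three kernels off to the
      same set keeps the domination.\<close>
    proof (rule knorm_egmean[OF \<alpha>])
      fix z assume "z \<in> space (M \<Otimes>\<^sub>M M)"
      then show "c z * indicator (D n) z \<le> egmean \<alpha> (p z * indicator (D n) z) (q z * indicator (D n) z)"
        unfolding egmean_mult[OF \<alpha>] egmean_self[OF \<alpha>] by (intro mult_right_mono 1(4)) auto
    qed measurable
    also have "\<dots> \<le> egmean \<alpha> (ennreal d) (ennreal e)"
      by (intro egmean_mono \<alpha> n nq)
    finally have "op_norm M (\<lambda>f x. C f x - H f x) \<le> gmean \<alpha> d e"
      using de by (simp add: knorm_eq_op_norm[OF CH] egmean_ennreal)
    then have "(gmean \<alpha> d e + s) + s \<in> noncompact_bounds M C" if "0 < s" for s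
      using that H(2) by (intro noncompact_bounds_perturb[OF bC is_kernelD(1)[OF H(1)]]) auto
    then have le: "meas_noncompact M C \<le> (gmean \<alpha> d e + s) + s" if "0 < s" for s
      using that by (intro meas_noncompact_upper) auto
    show "meas_noncompact M C \<le> gmean \<alpha> d e"
    proof (rule field_le_epsilon)
      fix s :: real assume "0 < s"
      then show "meas_noncompact M C \<le> gmean \<alpha> d e + s"
        using le[of "s / 2"] by simp
    qed
  qed
qed

end

section \<open>Sums and products of sets of operators\<close>

definition mean_dominated_set ::
  "'a measure \<Rightarrow> real \<Rightarrow> 'a l2op set \<Rightarrow> 'a l2op set \<Rightarrow> 'a l2op set \<Rightarrow> bool" where
  "mean_dominated_set M \<alpha> \<Sigma> \<Gamma> \<Theta> \<longleftrightarrow> (\<forall>C\<in>\<Sigma>. \<exists>P\<in>\<Gamma>. \<exists>Q\<in>\<Theta>. mean_dominated M \<alpha> C P Q)"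

lemma mean_dominated_set_plus:
  assumes \<alpha>: "\<alpha> \<in> {0..1}" and "mean_dominated_set M \<alpha> \<Sigma> \<Gamma> \<Theta>" "mean_dominated_set M \<alpha> \<Sigma>' \<Gamma>' \<Theta>'"
  shows "mean_dominated_set M \<alpha> (op_set_plus \<Sigma> \<Sigma>') (op_set_plus \<Gamma> \<Gamma>') (op_set_plus \<Theta> \<Theta>')"
  unfolding mean_dominated_set_def
proof
  fix X assume "X \<in> op_set_plus \<Sigma> \<Sigma>'"
  then obtain C C' where C: "C \<in> \<Sigma>" "C' \<in> \<Sigma>'" "X = (\<lambda>f x. C f x + C' f x)"
    unfolding op_set_plus_def by blast
  obtain P Q where PQ: "P \<in> \<Gamma>" "Q \<in> \<Theta>" "mean_dominated M \<alpha> C P Q"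
    using assms(2) C(1) unfolding mean_dominated_set_def by blast
  obtain P' Q' where PQ': "P' \<in> \<Gamma>'" "Q' \<in> \<Theta>'" "mean_dominated M \<alpha> C' P' Q'"
    using assms(3) C(2) unfolding mean_dominated_set_def by blast
  have "(\<lambda>f x. P f x + P' f x) \<in> op_set_plus \<Gamma> \<Gamma>'" "(\<lambda>f x. Q f x + Q' f x) \<in> op_set_plus \<Theta> \<Theta>'"
    unfolding op_set_plus_def using PQ PQ' by blast+
  then show "\<exists>P\<in>op_set_plus \<Gamma> \<Gamma>'. \<exists>Q\<in>op_set_plus \<Theta> \<Theta>'. mean_dominated M \<alpha> X P Q"
    using mean_dominated_add[OF \<alpha> PQ(3) PQ'(3)] C(3) by blast
qed

lemma mean_dominated_set_sum_list:
  assumes \<alpha>: "\<alpha> \<in> {0..1}" and "\<And>j. j \<in> set js \<Longrightarrow> mean_dominated_set M \<alpha> (\<Phi> j) (\<Gamma> j) (\<Theta> j)"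
  shows "mean_dominated_set M \<alpha> (op_set_sum_list (map \<Phi> js)) (op_set_sum_list (map \<Gamma> js)) (op_set_sum_list (map \<Theta> js))"
  using assms(2)
proof (induction js)
  case Nil
  then show ?case
    using mean_dominated_zero by (simp add: op_set_sum_list_def mean_dominated_set_def)
next
  case (Cons j js)
  then show ?case
    using mean_dominated_set_plus[OF \<alpha>, of M "\<Phi> j" "\<Gamma> j" "\<Theta> j"] by (simp add: op_set_sum_list_def)
qed

context sigma_finite_measure
begin

lemma mean_dominated_set_times:
  assumes \<alpha>: "\<alpha> \<in> {0..1}" and "mean_dominated_set M \<alpha> \<Sigma> \<Gamma> \<Theta>" "mean_dominated_set M \<alpha> \<Sigma>' \<Gamma>' \<Theta>'"
  shows "mean_dominated_set M \<alpha> (op_set_times \<Sigma> \<Sigma>') (op_set_times \<Gamma> \<Gamma>') (op_set_times \<Theta>' \<Theta>)"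
  unfolding mean_dominated_set_def
proof
  fix X assume "X \<in> op_set_times \<Sigma> \<Sigma>'"
  then obtain C C' where C: "C \<in> \<Sigma>" "C' \<in> \<Sigma>'" "X = C \<circ> C'"
    unfolding op_set_times_def by blast
  obtain P Q where PQ: "P \<in> \<Gamma>" "Q \<in> \<Theta>" "mean_dominated M \<alpha> C P Q"
    using assms(2) C(1) unfolding mean_dominated_set_def by blast
  obtain P' Q' where PQ': "P' \<in> \<Gamma>'" "Q' \<in> \<Theta>'" "mean_dominated M \<alpha> C' P' Q'"
    using assms(3) C(2) unfolding mean_dominated_set_def by blast
  have "P \<circ> P' \<in> op_set_times \<Gamma> \<Gamma>'" "Q' \<circ> Q \<in> op_set_times \<Theta>' \<Theta>"
    unfolding op_set_times_def using PQ PQ' by blast+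
  then show "\<exists>P\<in>op_set_times \<Gamma> \<Gamma>'. \<exists>Q\<in>op_set_times \<Theta>' \<Theta>. mean_dominated M \<alpha> X P Q"
    using mean_dominated_comp[OF \<alpha> PQ(3) PQ'(3)] C(3) by blast
qed

text \<open>The list must be nonempty because the empty product is \<open>id\<close>, which need not
  have a kernel. The reversal in the last argument accumulates from
  \<open>mean_dominated_set_times\<close>.\<close>

lemma mean_dominated_set_prod_list:
  assumes \<alpha>: "\<alpha> \<in> {0..1}" and "xs \<noteq> []" and "\<And>i. i \<in> set xs \<Longrightarrow> mean_dominated_set M \<alpha> (\<Phi> i) (\<Gamma> i) (\<Theta> i)"
  shows "mean_dominated_set M \<alpha> (op_set_prod_list (map \<Phi> xs)) (op_set_prod_list (map \<Gamma> xs))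
    (op_set_prod_list (map \<Theta> (rev xs)))"
  using assms(2,3)
proof (induction xs rule: list_nonempty_induct)
  case (single x)
  then show ?case
    by (simp add: op_set_prod_list_Cons op_set_prod_list_Nil)
next
  case (cons x xs)
  then show ?case
    using mean_dominated_set_times[OF \<alpha>, of "\<Phi> x" "\<Gamma> x" "\<Theta> x"]
    by (simp add: op_set_prod_list_Cons op_set_prod_list_Nil op_set_prod_list_append)
qed

text \<open>With all factors equal, reversing the product changes nothing; a list of units makes the
  product rule applicable.\<close>

lemma mean_dominated_set_power:
  assumes \<alpha>: "\<alpha> \<in> {0..1}" and "mean_dominated_set M \<alpha> \<Sigma> \<Gamma> \<Theta>" and "0 < n"
  shows "mean_dominated_set M \<alpha> (op_set_power \<Sigma> n) (op_set_power \<Gamma> n) (op_set_power \<Theta> n)"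
  using mean_dominated_set_prod_list[OF \<alpha>, of "replicate n ()" "\<lambda>_. \<Sigma>" "\<lambda>_. \<Gamma>" "\<lambda>_. \<Theta>"] assms(2,3)
  by (simp add: op_set_power_def map_replicate)

lemma mean_dominated_funpow:
  assumes \<alpha>: "\<alpha> \<in> {0..1}" and "mean_dominated M \<alpha> C P Q" and "0 < n"
  shows "mean_dominated M \<alpha> (C ^^ n) (P ^^ n) (Q ^^ n)"
  using mean_dominated_set_power[OF \<alpha>, of "{C}" "{P}" "{Q}" n] assms
  by (simp add: mean_dominated_set_def op_set_power_singleton)

lemma mean_dominated_bounded:
  assumes "mean_dominated M \<alpha> C P Q"
  shows "bounded_operator M C" "bounded_operator M P" "bounded_operator M Q"
  using assms is_kernelD(1) unfolding mean_dominated_def by blast+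

lemma lim_root_mean_dominated:
  assumes \<alpha>: "\<alpha> \<in> {0..1}" and \<phi>: "submultiplicative M \<phi>"
    and le: "\<And>C P Q. mean_dominated M \<alpha> C P Q \<Longrightarrow> \<phi> C \<le> gmean \<alpha> (\<phi> P) (\<phi> Q)"
    and dom: "mean_dominated M \<alpha> C P Q"
  shows "lim (\<lambda>n. root n (\<phi> (C ^^ n))) \<le> gmean \<alpha> (lim (\<lambda>n. root n (\<phi> (P ^^ n)))) (lim (\<lambda>n. root n (\<phi> (Q ^^ n))))"
proof -
  note b = mean_dominated_bounded[OF dom]
  have eq: "Sup0 (\<phi> ` op_set_power {A} n) = \<phi> (A ^^ n)" if "bounded_operator M A" for A n
    using \<phi> bounded_operator_funpow[OF that, of n]
    by (simp add: op_set_power_singleton Sup0_singleton submultiplicative_def)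
  have "lim (\<lambda>n. root n (Sup0 (\<phi> ` op_set_power {C} n)))
    \<le> gmean \<alpha> (lim (\<lambda>n. root n (Sup0 (\<phi> ` op_set_power {P} n)))) (lim (\<lambda>n. root n (Sup0 (\<phi> ` op_set_power {Q} n))))"
    by (rule lim_gmean[OF \<alpha> \<phi> bounded_set_singleton[OF b(1)] bounded_set_singleton[OF b(2)] bounded_set_singleton[OF b(3)]])
       (simp add: op_set_power_singleton le mean_dominated_funpow[OF \<alpha> dom])
  then show ?thesis
    by (simp add: eq b)
qed

text \<open>Only \<open>P\<close> and \<open>Q\<close> need the growth of their powers bounded by
  the spectral radius, which \<open>is_kernel_gelfand\<close> provides; for \<open>C\<close> the
  Neumann bound is enough.\<close>

lemma spec_radius_mean_dominated:
  assumes \<alpha>: "\<alpha> \<in> {0..1}" and dom: "mean_dominated M \<alpha> C P Q"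
  shows "spec_radius M C \<le> gmean \<alpha> (spec_radius M P) (spec_radius M Q)"
proof -
  note b = mean_dominated_bounded[OF dom]
  let ?L = "\<lambda>A. lim (\<lambda>n. root n (op_norm M (A ^^ n)))"
  have lim: "(\<lambda>n. root n (op_norm M (A ^^ n))) \<longlonglongrightarrow> ?L A" if "bounded_operator M A" for A
    using convergent_root_funpow[OF submultiplicative_op_norm that] by (simp add: convergent_LIMSEQ_iff)
  obtain p q where pq: "is_kernel M P p" "is_kernel M Q q"
    using dom unfolding mean_dominated_def by blast
  have "spec_radius M C \<le> ?L C"
    by (rule spec_radius_le(1)[OF b(1) lim[OF b(1)]])
  also have "\<dots> \<le> gmean \<alpha> (?L P) (?L Q)"
    by (rule lim_root_mean_dominated[OF \<alpha> submultiplicative_op_norm op_norm_mean_dominated[OF \<alpha>] dom])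
  also have "\<dots> \<le> gmean \<alpha> (spec_radius M P) (spec_radius M Q)"
    by (intro gmean_mono \<alpha> gelfand_limit_nonneg[OF b(2) lim[OF b(2)]] gelfand_limit_nonneg[OF b(3) lim[OF b(3)]]
        is_kernel_gelfand[OF pq(1) lim[OF b(2)]] is_kernel_gelfand[OF pq(2) lim[OF b(3)]])
  finally show ?thesis .
qed

lemma ess_spec_radius_mean_dominated:
  assumes \<alpha>: "\<alpha> \<in> {0..1}" and dom: "mean_dominated M \<alpha> C P Q"
  shows "ess_spec_radius M C \<le> gmean \<alpha> (ess_spec_radius M P) (ess_spec_radius M Q)"
  unfolding ess_spec_radius_def
  by (rule lim_root_mean_dominated[OF \<alpha> submultiplicative_meas_noncompact meas_noncompact_mean_dominated[OF \<alpha>] dom])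

end

section \<open>The seven radii of sets of operators\<close>

lemma ess_spec_radius_bounds:
  assumes A: "bounded_operator M A"
  shows "0 \<le> ess_spec_radius M A \<and> ess_spec_radius M A \<le> op_norm M A"
proof -
  have lim: "(\<lambda>n. root n (meas_noncompact M (A ^^ n))) \<longlonglongrightarrow> ess_spec_radius M A"
    using convergent_root_funpow[OF submultiplicative_meas_noncompact A]
    by (simp add: convergent_LIMSEQ_iff ess_spec_radius_def)
  have "root n (meas_noncompact M (A ^^ n)) \<le> op_norm M A" if n1: "n \<ge> 1" for n
  proof -
    obtain k where n: "n = Suc k"
      using n1 by (cases n) auto
    have "root n (meas_noncompact M (A ^^ n)) \<le> root n (op_norm M A ^ n)"
      unfolding n using meas_noncompact_le_op_norm[OF bounded_operator_funpow[OF A, of "Suc k"]]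
        op_norm_funpow_le[OF A, of k]
      by (intro real_root_le_mono) linarith+
    then show ?thesis
      using n1 op_norm_nonneg[OF A] by (simp add: real_root_power_cancel)
  qed
  then have "ess_spec_radius M A \<le> op_norm M A"
    by (intro LIMSEQ_le_const2[OF lim]) auto
  moreover have "0 \<le> root n (meas_noncompact M (A ^^ n))" for n
    by (intro real_root_ge_zero meas_noncompact_nonneg bounded_operator_funpow A)
  then have "0 \<le> ess_spec_radius M A"
    by (intro LIMSEQ_le_const[OF lim]) auto
  ultimately show ?thesis by blast
qed

definition radii :: "'a measure \<Rightarrow> ('a l2op set \<Rightarrow> real) set" where
  "radii M = {gen_spec_radius M, joint_spec_radius M, gen_ess_spec_radius M,
     joint_ess_spec_radius M, set_norm M, set_meas_noncompact M, set_num_radius M}"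

lemma radii_nonneg:
  assumes \<rho>: "\<rho> \<in> radii M" and \<Sigma>: "bounded_set M \<Sigma>"
  shows "0 \<le> \<rho> \<Sigma>"
proof -
  have sup: "0 \<le> Sup0 (\<phi> ` \<Phi>)" if "bounded_set M \<Phi>" "\<And>A. bounded_operator M A \<Longrightarrow> \<phi> A \<le> op_norm M A" for \<phi> \<Phi>
    by (rule Sup0_nonneg[OF bdd_above_image_op_norm[OF that]])
  have ls: "0 \<le> real_of_ereal (limsup (\<lambda>n. ereal (root n (Sup0 (\<phi> ` op_set_power \<Sigma> n)))))"
    if "\<And>A. bounded_operator M A \<Longrightarrow> \<phi> A \<le> op_norm M A" for \<phi>
  proof (intro real_of_ereal_pos order_trans[OF _ Liminf_le_Limsup] Liminf_bounded always_eventually allI)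
    show "0 \<le> ereal (root n (Sup0 (\<phi> ` op_set_power \<Sigma> n)))" for n
      using sup[OF bounded_set_power[OF \<Sigma>] that] by (simp add: real_root_ge_zero)
  qed simp
  have li: "0 \<le> lim (\<lambda>n. root n (Sup0 (\<phi> ` op_set_power \<Sigma> n)))" if \<phi>: "submultiplicative M \<phi>" for \<phi>
  proof (rule LIMSEQ_le_const)
    show "(\<lambda>n. root n (Sup0 (\<phi> ` op_set_power \<Sigma> n))) \<longlonglongrightarrow> lim (\<lambda>n. root n (Sup0 (\<phi> ` op_set_power \<Sigma> n)))"
      using convergent_joint[OF \<phi> \<Sigma>] by (simp add: convergent_LIMSEQ_iff)
  qed (use Sup0_op_set_power(2)[OF \<phi> \<Sigma>] in \<open>auto intro: real_root_ge_zero\<close>)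
  from \<rho> consider "\<rho> = gen_spec_radius M" | "\<rho> = joint_spec_radius M" | "\<rho> = gen_ess_spec_radius M"
    | "\<rho> = joint_ess_spec_radius M" | "\<rho> = set_norm M" | "\<rho> = set_meas_noncompact M" | "\<rho> = set_num_radius M"
    by (auto simp: radii_def)
  then show ?thesis
  proof cases
    case 1
    show ?thesis
      unfolding 1 gen_spec_radius_def by (rule ls[OF spec_radius_nonneg_le_op_norm(2)])
  next
    case 2
    show ?thesis
      unfolding 2 joint_spec_radius_def by (rule li[OF submultiplicative_op_norm])
  next
    case 3
    show ?thesis
      unfolding 3 gen_ess_spec_radius_def by (rule ls[OF conjunct2[OF ess_spec_radius_bounds]])
  next
    case 4
    show ?thesis
      unfolding 4 joint_ess_spec_radius_def by (rule li[OF submultiplicative_meas_noncompact])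
  next
    case 5
    show ?thesis
      unfolding 5 set_norm_def by (rule sup[OF \<Sigma> order_refl])
  next
    case 6
    show ?thesis
      unfolding 6 set_meas_noncompact_def by (rule sup[OF \<Sigma> meas_noncompact_le_op_norm])
  next
    case 7
    show ?thesis
      unfolding 7 set_num_radius_def by (rule sup[OF \<Sigma> num_radius_bdd(3)])
  qed
qed

context sigma_finite_measure
begin

text \<open>The four spectral radii compare all positive powers of the sets, by \<open>pow\<close>;
  norm, measure of noncompactness and numerical radius compare the sets themselves, by
  \<open>sup\<close>.\<close>

lemma radii_mean_dominated_set:
  assumes \<alpha>: "\<alpha> \<in> {0..1}" and \<rho>: "\<rho> \<in> radii M" and dom: "mean_dominated_set M \<alpha> \<Sigma> \<Gamma> \<Theta>"
    and b: "bounded_set M \<Sigma>" "bounded_set M \<Gamma>" "bounded_set M \<Theta>"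
  shows "\<rho> \<Sigma> \<le> gmean \<alpha> (\<rho> \<Gamma>) (\<rho> \<Theta>)"
proof -
  have pow: "\<exists>P\<in>op_set_power \<Gamma> n. \<exists>Q\<in>op_set_power \<Theta> n. \<phi> C \<le> gmean \<alpha> (\<phi> P) (\<phi> Q)"
    if "0 < n" "C \<in> op_set_power \<Sigma> n" and le: "\<And>C P Q. mean_dominated M \<alpha> C P Q \<Longrightarrow> \<phi> C \<le> gmean \<alpha> (\<phi> P) (\<phi> Q)"
    for n C \<phi>
    using mean_dominated_set_power[OF \<alpha> dom that(1)] that(2) le unfolding mean_dominated_set_def by meson
  have sup: "Sup0 (\<phi> ` \<Sigma>) \<le> gmean \<alpha> (Sup0 (\<phi> ` \<Gamma>)) (Sup0 (\<phi> ` \<Theta>))"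
    if \<phi>: "\<And>A. bounded_operator M A \<Longrightarrow> 0 \<le> \<phi> A \<and> \<phi> A \<le> op_norm M A"
      and le: "\<And>C P Q. mean_dominated M \<alpha> C P Q \<Longrightarrow> \<phi> C \<le> gmean \<alpha> (\<phi> P) (\<phi> Q)" for \<phi>
  proof (rule Sup0_gmean[OF \<alpha>])
    show "bdd_above (\<phi> ` \<Gamma>)" "bdd_above (\<phi> ` \<Theta>)"
      using \<phi> by (auto intro: bdd_above_image_op_norm[OF b(2)] bdd_above_image_op_norm[OF b(3)])
    show "0 \<le> \<phi> A" if "A \<in> \<Gamma> \<union> \<Theta>" for A
      using \<phi> that bounded_setD[OF b(2)] bounded_setD[OF b(3)] by blast
    show "\<exists>P\<in>\<Gamma>. \<exists>Q\<in>\<Theta>. \<phi> C \<le> gmean \<alpha> (\<phi> P) (\<phi> Q)" if "C \<in> \<Sigma>" for C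
      using dom le that unfolding mean_dominated_set_def by meson
  qed
  note W = num_radius_mean_dominated[OF \<alpha>] and G = meas_noncompact_mean_dominated[OF \<alpha>]
    and N = op_norm_mean_dominated[OF \<alpha>] and R = spec_radius_mean_dominated[OF \<alpha>]
    and E = ess_spec_radius_mean_dominated[OF \<alpha>]
  from \<rho> consider "\<rho> = gen_spec_radius M" | "\<rho> = joint_spec_radius M" | "\<rho> = gen_ess_spec_radius M"
    | "\<rho> = joint_ess_spec_radius M" | "\<rho> = set_norm M" | "\<rho> = set_meas_noncompact M" | "\<rho> = set_num_radius M"
    by (auto simp: radii_def)
  then show ?thesis
  proof cases
    case 1
    show ?thesis
      unfolding 1 gen_spec_radius_def
      by (rule limsup_root_gmean[OF \<alpha> _ b pow[OF _ _ R]]) (simp_all add: spec_radius_nonneg_le_op_norm)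
  next
    case 2
    show ?thesis
      unfolding 2 joint_spec_radius_def by (rule lim_gmean[OF \<alpha> submultiplicative_op_norm b pow[OF _ _ N]])
  next
    case 3
    show ?thesis
      unfolding 3 gen_ess_spec_radius_def
      by (rule limsup_root_gmean[OF \<alpha> ess_spec_radius_bounds b pow[OF _ _ E]])
  next
    case 4
    show ?thesis
      unfolding 4 joint_ess_spec_radius_def
      by (rule lim_gmean[OF \<alpha> submultiplicative_meas_noncompact b pow[OF _ _ G]])
  next
    case 5
    show ?thesis
      unfolding 5 set_norm_def by (rule sup[OF _ N]) (simp_all add: op_norm_nonneg)
  next
    case 6
    show ?thesis
      unfolding 6 set_meas_noncompact_def
      by (rule sup[OF _ G]) (simp_all add: meas_noncompact_nonneg meas_noncompact_le_op_norm)
  next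
    case 7
    show ?thesis
      unfolding 7 set_num_radius_def by (rule sup[OF _ W]) (simp_all add: num_radius_bdd)
  qed
qed

section \<open>Weighted means of operators and the sets \<open>S_set\<close>\<close>

lemma has_kernel_bounded:
  assumes K: "has_kernel M A (\<lambda>p. complex_of_real (a p))" and a: "a \<in> borel_measurable (M \<Otimes>\<^sub>M M)" "\<And>p. 0 \<le> a p"
    and C: "knorm M (\<lambda>p. ennreal (a p)) \<le> ennreal C" "0 \<le> C"
  shows "bounded_operator M A" "op_norm M A \<le> C"
proof -
  have A: "linear_operator M A"
    using K by (simp add: has_kernel_def)
  note k = kint_has_kernel[OF a C]
  have le: "op_norm M (kint M a) \<le> C"
    using C knorm_eq_op_norm[OF k(3)] by simp
  have b: "l2_norm M (A f) \<le> C * l2_norm M f" if f: "f \<in> L2 M" for f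
  proof -
    \<comment> \<open>\<open>S_set\<close> admits every operator with the prescribed kernel. Each
      agrees almost everywhere with the integral operator, from which it inherits the bound.\<close>
    have "AE x in M. A f x = kint M a f x"
      using has_kernelD[OF K f] has_kernelD[OF k(1) f] by eventually_elim simp
    then have "l2_norm M (A f) = l2_norm M (kint M a f)"
      using linear_operatorD(1)[OF A f] bounded_operator_L2[OF k(2) f]
      by (intro l2_norm_cong_AE) (auto simp: L2_def)
    also have "\<dots> \<le> op_norm M (kint M a) * l2_norm M f"
      by (rule op_norm_bound[OF k(2) f])
    also have "\<dots> \<le> C * l2_norm M f"
      by (intro mult_right_mono le) simp
    finally show ?thesis .
  qed
  show "bounded_operator M A"
    by (rule bounded_operatorI[OF A b])
  show "op_norm M A \<le> C"
    by (rule op_norm_least'[OF C(2) b])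
qed

text \<open>\<open>b\<close> is the kernel of \<open>B\<^sup>*\<close>.\<close>

definition kernel_pair :: "'a l2op \<Rightarrow> 'a l2op \<Rightarrow> ('a \<times> 'a \<Rightarrow> real) \<Rightarrow> ('a \<times> 'a \<Rightarrow> real) \<Rightarrow> bool" where
  "kernel_pair A B a b \<longleftrightarrow> bounded_operator M A \<and> bounded_operator M B \<and> (\<forall>p. 0 \<le> a p) \<and> (\<forall>p. 0 \<le> b p) \<and>
     a \<in> borel_measurable (M \<Otimes>\<^sub>M M) \<and> b \<in> borel_measurable (M \<Otimes>\<^sub>M M) \<and>
     has_kernel M A (\<lambda>p. complex_of_real (a p)) \<and> has_kernel M B (\<lambda>p. complex_of_real (kadj b p))"

lemma kernel_pair_swap: "kernel_pair A B a b \<Longrightarrow> kernel_pair B A (kadj b) (kadj a)"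
  unfolding kernel_pair_def by (auto intro: measurable_kadj)

lemma kernel_pair_knorm:
  assumes "kernel_pair A B a b"
  shows "knorm M (\<lambda>p. ennreal (a p)) = ennreal (op_norm M A)" "knorm M (\<lambda>p. ennreal (b p)) = ennreal (op_norm M B)"
    "is_kernel M A (\<lambda>p. ennreal (a p))" "is_kernel M B (kadj (\<lambda>p. ennreal (b p)))"
proof -
  show A: "is_kernel M A (\<lambda>p. ennreal (a p))"
    using assms unfolding kernel_pair_def by (intro is_kernel_of_has_kernel) auto
  have "is_kernel M B (\<lambda>p. ennreal (kadj b p))"
    using assms unfolding kernel_pair_def by (intro is_kernel_of_has_kernel) (auto simp: kadj_def)
  moreover have "(\<lambda>p. ennreal (kadj b p)) = kadj (\<lambda>p. ennreal (b p))"
    by (auto simp: kadj_def)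
  ultimately show B: "is_kernel M B (kadj (\<lambda>p. ennreal (b p)))"
    by simp
  show "knorm M (\<lambda>p. ennreal (a p)) = ennreal (op_norm M A)"
    by (rule knorm_eq_op_norm[OF A])
  show "knorm M (\<lambda>p. ennreal (b p)) = ennreal (op_norm M B)"
    using knorm_eq_op_norm[OF B] knorm_kadj[OF is_kernel_kadj_measurable[OF B]] by simp
qed

lemma measurable_gmean:
  assumes [measurable]: "a \<in> borel_measurable N" "b \<in> borel_measurable N"
  shows "(\<lambda>p. gmean \<alpha> (a p) (b p)) \<in> borel_measurable N"
  unfolding gmean_def kpow_def by measurable

lemma kernel_pair_gmean_knorm:
  assumes \<alpha>: "\<alpha> \<in> {0..1}" and ab: "kernel_pair A B a b"
  shows "knorm M (\<lambda>p. ennreal (gmean \<alpha> (a p) (b p))) \<le> ennreal (gmean \<alpha> (op_norm M A) (op_norm M B))"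
proof -
  note k = kernel_pair_knorm[OF ab]
  have "knorm M (\<lambda>p. ennreal (gmean \<alpha> (a p) (b p))) \<le> egmean \<alpha> (ennreal (op_norm M A)) (ennreal (op_norm M B))"
    unfolding k(1,2)[symmetric]
    by (rule knorm_egmean[OF \<alpha>]) (use ab in \<open>auto simp: kernel_pair_def egmean_ennreal\<close>)
  then show ?thesis
    using ab by (simp add: kernel_pair_def egmean_ennreal op_norm_nonneg)
qed

text \<open>Membership hands over a kernel of the adjoint of \<open>B\<close>, not of
  \<open>B\<close>. The integral operator with the transposed kernel has the same adjoint, so it
  coincides with \<open>B\<close>, which thereby receives a kernel.\<close>

lemma S_set_elemD:
  assumes \<alpha>: "\<alpha> \<in> {0..1}" and \<Psi>: "bounded_set M \<Psi>" and C: "C \<in> S_set M \<alpha> \<Psi>"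
  obtains A B a b where "A \<in> \<Psi>" "B \<in> \<Psi>" "kernel_pair A B a b"
    "has_kernel M C (\<lambda>p. complex_of_real (gmean \<alpha> (a p) (b p)))"
proof -
  obtain A B B' where AB: "A \<in> \<Psi>" "B \<in> \<Psi>" "is_adjoint M B B'" "is_weighted_mean M \<alpha> A B' C"
    using C unfolding S_set_def by blast
  obtain a b where a0: "\<And>p. 0 \<le> a p" and b0: "\<And>p. 0 \<le> b p"
    and A: "has_kernel M A (\<lambda>p. complex_of_real (a p))" and B': "has_kernel M B' (\<lambda>p. complex_of_real (b p))"
    and Ck: "has_kernel M C (\<lambda>p. complex_of_real (gmean \<alpha> (a p) (b p)))"
    using AB(4) unfolding is_weighted_mean_def gmean_def by blast
  have meas: "k \<in> borel_measurable (M \<Otimes>\<^sub>M M)" if "has_kernel M K (\<lambda>p. complex_of_real (k p))" for K k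
  proof -
    have "(\<lambda>p. Re (complex_of_real (k p))) \<in> borel_measurable (M \<Otimes>\<^sub>M M)"
      using that unfolding has_kernel_def by (intro measurable_compose[OF _ borel_measurable_Re]) auto
    then show ?thesis by simp
  qed
  note am = meas[OF A] and bm = meas[OF B']
  have bA: "bounded_operator M A" and bB: "bounded_operator M B"
    using bounded_setD[OF \<Psi>] AB by auto
  have bB': "bounded_operator M B'"
    by (rule is_adjoint_bounded[OF AB(3) bB])
  have kb: "knorm M (\<lambda>p. ennreal (kadj b p)) = ennreal (op_norm M B')"
  proof -
    have "(\<lambda>p. ennreal (kadj b p)) = kadj (\<lambda>p. ennreal (b p))"
      by (auto simp: kadj_def)
    then show ?thesis
      using knorm_eq_op_norm[OF is_kernel_of_has_kernel[OF B' bB' b0]] bm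
      by (simp add: knorm_kadj)
  qed
  have kb0: "0 \<le> kadj b p" for p
    using b0 by (simp add: kadj_def case_prod_beta)
  note T = kint_has_kernel[OF measurable_kadj[OF bm] kb0 eq_refl[OF kb] op_norm_nonneg[OF bB']]
  have "is_adjoint M (kint M (kadj b)) B'"
    by (rule is_adjoint_kernels[OF T(1,2) _ measurable_kadj[OF bm] kb0]) (simp add: B')
  then have "AE x in M. B f x = kint M (kadj b) f x" if "f \<in> L2 M" for f
    by (rule is_adjoint_unique[OF AB(3) _ bounded_operator_linear[OF bB] bounded_operator_linear[OF T(2)] that])
  then have "has_kernel M B (\<lambda>p. complex_of_real (kadj b p))"
    by (rule has_kernel_cong[OF T(1) bounded_operator_linear[OF bB]])
  then have "kernel_pair A B a b"
    unfolding kernel_pair_def using a0 b0 A am bm bA bB by blast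
  with AB(1,2) show thesis
    using Ck by (rule that)
qed

text \<open>Membership requires an adjoint and an operator with the mean kernel as actual maps; both
  are realized as integral operators, whose form norms are finite by
  \<open>kernel_pair_knorm\<close> and Hoelder's inequality.\<close>

lemma S_set_elemI:
  assumes \<alpha>: "\<alpha> \<in> {0..1}" and AB: "A \<in> \<Psi>" "B \<in> \<Psi>" and ab: "kernel_pair A B a b"
  shows "kint M (\<lambda>p. gmean \<alpha> (a p) (b p)) \<in> S_set M \<alpha> \<Psi>"
    and "is_kernel M (kint M (\<lambda>p. gmean \<alpha> (a p) (b p))) (\<lambda>p. ennreal (gmean \<alpha> (a p) (b p)))"
proof -
  have a: "\<And>p. 0 \<le> a p" "a \<in> borel_measurable (M \<Otimes>\<^sub>M M)" and b: "\<And>p. 0 \<le> b p" "b \<in> borel_measurable (M \<Otimes>\<^sub>M M)"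
    and A: "has_kernel M A (\<lambda>p. complex_of_real (a p))" and B: "has_kernel M B (\<lambda>p. complex_of_real (kadj b p))"
    and bB: "bounded_operator M B"
    using ab unfolding kernel_pair_def by auto
  note k = kint_has_kernel[OF measurable_gmean[OF a(2) b(2)] gmean_nonneg kernel_pair_gmean_knorm[OF \<alpha> ab] gmean_nonneg]
  show "is_kernel M (kint M (\<lambda>p. gmean \<alpha> (a p) (b p))) (\<lambda>p. ennreal (gmean \<alpha> (a p) (b p)))"
    by (rule k(3))
  note T = kint_has_kernel[OF b(2,1) eq_refl[OF kernel_pair_knorm(2)[OF ab]] op_norm_nonneg[OF bB]]
  have kb0: "0 \<le> kadj b p" for p
    using b by (simp add: kadj_def case_prod_beta)
  have "is_adjoint M B (kint M b)"
    by (rule is_adjoint_kernels[OF B bB _ measurable_kadj[OF b(2)] kb0]) (simp add: T(1))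
  moreover have "is_weighted_mean M \<alpha> A (kint M b) (kint M (\<lambda>p. gmean \<alpha> (a p) (b p)))"
    unfolding is_weighted_mean_def
    by (rule exI[of _ a], rule exI[of _ b]) (use a b A T(1) k(1) in \<open>auto simp: gmean_def\<close>)
  ultimately show "kint M (\<lambda>p. gmean \<alpha> (a p) (b p)) \<in> S_set M \<alpha> \<Psi>"
    unfolding S_set_def using AB by blast
qed

lemma S_set_is_kernel:
  assumes \<alpha>: "\<alpha> \<in> {0..1}" and ab: "kernel_pair A B a b"
    and C: "has_kernel M C (\<lambda>p. complex_of_real (gmean \<alpha> (a p) (b p)))"
  shows "is_kernel M C (\<lambda>p. ennreal (gmean \<alpha> (a p) (b p)))" "op_norm M C \<le> gmean \<alpha> (op_norm M A) (op_norm M B)"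
proof -
  have m: "(\<lambda>p. gmean \<alpha> (a p) (b p)) \<in> borel_measurable (M \<Otimes>\<^sub>M M)"
    using ab by (auto simp: kernel_pair_def intro: measurable_gmean)
  note b = has_kernel_bounded[OF C m gmean_nonneg kernel_pair_gmean_knorm[OF \<alpha> ab] gmean_nonneg]
  show "is_kernel M C (\<lambda>p. ennreal (gmean \<alpha> (a p) (b p)))"
    by (rule is_kernel_of_has_kernel[OF C b(1) gmean_nonneg])
  show "op_norm M C \<le> gmean \<alpha> (op_norm M A) (op_norm M B)"
    by (rule b(2))
qed

lemma bounded_set_S_set:
  assumes \<alpha>: "\<alpha> \<in> {0..1}" and \<Psi>: "bounded_set M \<Psi>"
  shows "bounded_set M (S_set M \<alpha> \<Psi>)"
proof -
  obtain K where K: "\<And>A. A \<in> \<Psi> \<Longrightarrow> bounded_operator M A \<and> op_norm M A \<le> K"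
    using \<Psi> unfolding bounded_set_def by blast
  have "bounded_operator M C \<and> op_norm M C \<le> K" if C: "C \<in> S_set M \<alpha> \<Psi>" for C
  proof -
    obtain A B a b where AB: "A \<in> \<Psi>" "B \<in> \<Psi>" and ab: "kernel_pair A B a b"
      and Ck: "has_kernel M C (\<lambda>p. complex_of_real (gmean \<alpha> (a p) (b p)))"
      by (rule S_set_elemD[OF \<alpha> \<Psi> C])
    note k = S_set_is_kernel[OF \<alpha> ab Ck]
    have nn: "0 \<le> op_norm M A" "0 \<le> op_norm M B" "op_norm M A \<le> K" "op_norm M B \<le> K"
      using K[OF AB(1)] K[OF AB(2)] op_norm_nonneg by auto
    have "op_norm M C \<le> gmean \<alpha> K K"
      using k(2) gmean_mono[OF \<alpha> nn(1,3,2,4)] by (rule order_trans)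
    then show ?thesis
      using is_kernelD(1)[OF k(1)] gmean_self[OF \<alpha>, of K] nn by auto
  qed
  then show ?thesis
    unfolding bounded_set_def by blast
qed

lemma mean_dominated_set_S_set:
  assumes \<alpha>: "\<alpha> \<in> {0..1}" and \<Psi>: "bounded_set M \<Psi>"
  shows "mean_dominated_set M \<alpha> (S_set M \<alpha> \<Psi>) \<Psi> \<Psi>"
  unfolding mean_dominated_set_def
proof
  fix C assume C: "C \<in> S_set M \<alpha> \<Psi>"
  obtain A B a b where AB: "A \<in> \<Psi>" "B \<in> \<Psi>" and ab: "kernel_pair A B a b"
    and Ck: "has_kernel M C (\<lambda>p. complex_of_real (gmean \<alpha> (a p) (b p)))"
    by (rule S_set_elemD[OF \<alpha> \<Psi> C])
  have "mean_dominated M \<alpha> C A B"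
    unfolding mean_dominated_def
  proof (intro exI conjI ballI)
    show "is_kernel M C (\<lambda>p. ennreal (gmean \<alpha> (a p) (b p)))"
      by (rule S_set_is_kernel(1)[OF \<alpha> ab Ck])
    show "is_kernel M A (\<lambda>p. ennreal (a p))" "is_kernel M B (kadj (\<lambda>p. ennreal (b p)))"
      by (rule kernel_pair_knorm[OF ab])+
    fix z
    have "0 \<le> a z" "0 \<le> b z"
      using ab unfolding kernel_pair_def by blast+
    then show "ennreal (gmean \<alpha> (a z) (b z)) \<le> egmean \<alpha> (ennreal (a z)) (ennreal (b z))"
      by (simp add: egmean_ennreal)
  qed
  with AB show "\<exists>P\<in>\<Psi>. \<exists>Q\<in>\<Psi>. mean_dominated M \<alpha> C P Q"
    by blast
qed

text \<open>\<open>A\<^sup>(\<^sup>\<beta>\<^sup>) \<circ> (B\<^sup>*)\<^sup>(\<^sup>1\<^sup>-\<^sup>\<beta>\<^sup>) = U\<^sup>(\<^sup>t\<^sup>) \<circ> (V\<^sup>*)\<^sup>(\<^sup>1\<^sup>-\<^sup>t\<^sup>)\<close> for \<open>U = A\<^sup>(\<^sup>\<alpha>\<^sup>) \<circ> (B\<^sup>*)\<^sup>(\<^sup>1\<^sup>-\<^sup>\<alpha>\<^sup>)\<close> and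
  \<open>V = B\<^sup>(\<^sup>\<alpha>\<^sup>) \<circ> (A\<^sup>*)\<^sup>(\<^sup>1\<^sup>-\<^sup>\<alpha>\<^sup>)\<close>, so monotonicity reduces to the first inequality applied to
  \<open>S\<^sub>\<alpha>(\<Psi>)\<close> in place of \<open>\<Psi>\<close>.\<close>

lemma mean_dominated_set_S_set_S_set:
  assumes \<alpha>: "\<alpha> \<in> {0..1}" and t: "t \<in> {0..1}" and \<Psi>: "bounded_set M \<Psi>"
    and \<beta>: "\<beta> = t * \<alpha> + (1 - t) * (1 - \<alpha>)"
  shows "mean_dominated_set M t (S_set M \<beta> \<Psi>) (S_set M \<alpha> \<Psi>) (S_set M \<alpha> \<Psi>)"
  unfolding mean_dominated_set_def
proof
  have \<beta>01: "\<beta> \<in> {0..1}"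
  proof -
    have "t * \<alpha> + (1 - t) * (1 - \<alpha>) \<le> t * 1 + (1 - t) * 1"
      using \<alpha> t by (intro add_mono mult_left_mono) auto
    moreover have "0 \<le> t * \<alpha> + (1 - t) * (1 - \<alpha>)"
      using \<alpha> t by (intro add_nonneg_nonneg mult_nonneg_nonneg) auto
    ultimately show ?thesis
      by (simp add: \<beta>)
  qed
  fix C assume C: "C \<in> S_set M \<beta> \<Psi>"
  obtain A B a b where AB: "A \<in> \<Psi>" "B \<in> \<Psi>" and ab: "kernel_pair A B a b"
    and Ck: "has_kernel M C (\<lambda>p. complex_of_real (gmean \<beta> (a p) (b p)))"
    by (rule S_set_elemD[OF \<beta>01 \<Psi> C])
  note U = S_set_elemI[OF \<alpha> AB ab]
  note V = S_set_elemI[OF \<alpha> AB(2,1) kernel_pair_swap[OF ab]]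
  have "mean_dominated M t C (kint M (\<lambda>p. gmean \<alpha> (a p) (b p))) (kint M (\<lambda>p. gmean \<alpha> (kadj b p) (kadj a p)))"
    unfolding mean_dominated_def
  proof (intro exI conjI ballI)
    show "is_kernel M C (\<lambda>p. ennreal (gmean \<beta> (a p) (b p)))"
      by (rule S_set_is_kernel(1)[OF \<beta>01 ab Ck])
    show "is_kernel M (kint M (\<lambda>p. gmean \<alpha> (a p) (b p))) (\<lambda>p. ennreal (gmean \<alpha> (a p) (b p)))"
      by (rule U(2))
    have "kadj (\<lambda>p. ennreal (gmean \<alpha> (b p) (a p))) = (\<lambda>p. ennreal (gmean \<alpha> (kadj b p) (kadj a p)))"
      by (auto simp: kadj_def)
    then show "is_kernel M (kint M (\<lambda>p. gmean \<alpha> (kadj b p) (kadj a p))) (kadj (\<lambda>p. ennreal (gmean \<alpha> (b p) (a p))))"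
      using V(2) by simp
    fix z
    have "0 \<le> a z" "0 \<le> b z"
      using ab unfolding kernel_pair_def by blast+
    then show "ennreal (gmean \<beta> (a z) (b z)) \<le> egmean t (ennreal (gmean \<alpha> (a z) (b z))) (ennreal (gmean \<alpha> (b z) (a z)))"
      using gmean_gmean[OF \<alpha> t, of "a z" "b z"] by (simp add: egmean_ennreal \<beta>)
  qed
  with U(1) V(1) show "\<exists>P\<in>S_set M \<alpha> \<Psi>. \<exists>Q\<in>S_set M \<alpha> \<Psi>. mean_dominated M t C P Q"
    by blast
qed

text \<open>Stated for arbitrary dominated families because it serves twice: with
  \<open>S_set M \<alpha>\<close> of the given sets against the sets themselves, and with two
  different \<open>S_set\<close> families against each other.\<close>

lemma sqrt_radii_prod_of_sums_le:
  assumes \<alpha>: "\<alpha> \<in> {0..1}" and \<rho>: "\<rho> \<in> radii M" and n: "n \<ge> 1"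
    and dom: "\<And>i j. i \<in> {1..n} \<Longrightarrow> j \<in> {1..m} \<Longrightarrow> mean_dominated_set M \<alpha> (\<Phi> i j) (\<Psi> i j) (\<Psi> i j)"
    and b: "\<And>i j. i \<in> {1..n} \<Longrightarrow> j \<in> {1..m} \<Longrightarrow> bounded_set M (\<Phi> i j)"
      "\<And>i j. i \<in> {1..n} \<Longrightarrow> j \<in> {1..m} \<Longrightarrow> bounded_set M (\<Psi> i j)"
  shows "sqrt (\<rho> (prod_of_sums n m \<Phi>)) * sqrt (\<rho> (prod_of_sums_rev n m \<Phi>))
    \<le> sqrt (\<rho> (prod_of_sums n m \<Psi>)) * sqrt (\<rho> (prod_of_sums_rev n m \<Psi>))"
proof -
  let ?s = "\<lambda>\<Phi> i. op_set_sum_list (map (\<Phi> i) [1..<Suc m])"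
  have sum: "mean_dominated_set M \<alpha> (?s \<Phi> i) (?s \<Psi> i) (?s \<Psi> i)" if "i \<in> {1..n}" for i
    using dom[OF that] by (intro mean_dominated_set_sum_list[OF \<alpha>]) auto
  have bs: "bounded_set M (?s \<Phi> i)" "bounded_set M (?s \<Psi> i)" if "i \<in> {1..n}" for i
    by (rule bounded_set_sum_list; use b(1)[OF that] b(2)[OF that] in \<open>auto simp del: upt_Suc\<close>)+
  have bp: "bounded_set M (prod_of_sums n m \<Phi>)" "bounded_set M (prod_of_sums_rev n m \<Phi>)"
    "bounded_set M (prod_of_sums n m \<Psi>)" "bounded_set M (prod_of_sums_rev n m \<Psi>)"
    unfolding prod_of_sums_def prod_of_sums_rev_def
    by (rule bounded_set_prod_list; use bs in \<open>auto simp del: upt_Suc\<close>)+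
  have ne: "[1..<Suc n] \<noteq> []"
    using n by simp
  have "mean_dominated_set M \<alpha> (prod_of_sums n m \<Phi>) (prod_of_sums n m \<Psi>) (prod_of_sums_rev n m \<Psi>)"
    unfolding prod_of_sums_def prod_of_sums_rev_def
    by (rule mean_dominated_set_prod_list[OF \<alpha> ne sum]) auto
  then have 1: "\<rho> (prod_of_sums n m \<Phi>) \<le> gmean \<alpha> (\<rho> (prod_of_sums n m \<Psi>)) (\<rho> (prod_of_sums_rev n m \<Psi>))"
    by (intro radii_mean_dominated_set[OF \<alpha> \<rho>] bp)
  have "mean_dominated_set M \<alpha> (op_set_prod_list (map (?s \<Phi>) (rev [1..<Suc n]))) (op_set_prod_list (map (?s \<Psi>) (rev [1..<Suc n])))
      (op_set_prod_list (map (?s \<Psi>) (rev (rev [1..<Suc n]))))"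
    by (rule mean_dominated_set_prod_list[OF \<alpha> _ sum]) (use n in auto)
  then have "mean_dominated_set M \<alpha> (prod_of_sums_rev n m \<Phi>) (prod_of_sums_rev n m \<Psi>) (prod_of_sums n m \<Psi>)"
    unfolding prod_of_sums_def prod_of_sums_rev_def rev_rev_ident .
  then have 2: "\<rho> (prod_of_sums_rev n m \<Phi>) \<le> gmean \<alpha> (\<rho> (prod_of_sums_rev n m \<Psi>)) (\<rho> (prod_of_sums n m \<Psi>))"
    by (intro radii_mean_dominated_set[OF \<alpha> \<rho>] bp)
  let ?x = "\<rho> (prod_of_sums n m \<Psi>)" and ?y = "\<rho> (prod_of_sums_rev n m \<Psi>)"
  have nn: "0 \<le> ?x" "0 \<le> ?y" "0 \<le> \<rho> (prod_of_sums_rev n m \<Phi>)"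
    by (intro radii_nonneg[OF \<rho>] bp)+
  have "\<rho> (prod_of_sums n m \<Phi>) * \<rho> (prod_of_sums_rev n m \<Phi>) \<le> gmean \<alpha> ?x ?y * gmean \<alpha> ?y ?x"
    by (intro mult_mono 1 2 gmean_nonneg nn)
  also have "\<dots> = ?x * ?y"
    by (rule gmean_swap_mult[OF \<alpha> nn(1,2)])
  finally show ?thesis
    by (simp add: real_sqrt_mult[symmetric])
qed

end

theorem theorem3p10:
  fixes M :: "'a measure"
    and n m :: nat
    and \<Psi> :: "nat \<Rightarrow> nat \<Rightarrow> 'a l2op set"
    and \<rho> :: "'a l2op set \<Rightarrow> real"
  assumes "sigma_finite_measure M"
    and "space M \<noteq> {}"
    and "n \<ge> 1" and "m \<ge> 1"
    and "\<And>i j A. i \<in> {1..n} \<Longrightarrow> j \<in> {1..m} \<Longrightarrow> A \<in> \<Psi> i j \<Longrightarrow> positive_kernel_operator M A"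
    and "\<And>i j. i \<in> {1..n} \<Longrightarrow> j \<in> {1..m} \<Longrightarrow> bounded_operators M (\<Psi> i j)"
    and "\<rho> \<in> {gen_spec_radius M, joint_spec_radius M, gen_ess_spec_radius M,
              joint_ess_spec_radius M, set_norm M, set_meas_noncompact M, set_num_radius M}"
  shows "(\<forall>\<alpha>\<in>{0..1}. rho_bar M \<rho> n m \<Psi> \<alpha>
            \<le> sqrt (\<rho> (prod_of_sums n m \<Psi>)) * sqrt (\<rho> (prod_of_sums_rev n m \<Psi>)))
       \<and> antimono_on {0..1/2} (rho_bar M \<rho> n m \<Psi>)
       \<and> mono_on {1/2..1} (rho_bar M \<rho> n m \<Psi>)"
proof -
  interpret sigma_finite_measure M
    by fact
  have \<rho>: "\<rho> \<in> radii M"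
    using assms(7) by (simp add: radii_def)
  have b: "bounded_set M (\<Psi> i j)" if "i \<in> {1..n}" "j \<in> {1..m}" for i j
  proof (rule bounded_setI[OF _ assms(6)[OF that]])
    fix A assume "A \<in> \<Psi> i j"
    then show "linear_operator M A"
      using assms(5)[OF that] by (auto simp: positive_kernel_operator_def has_kernel_def)
  qed
  have step: "rho_bar M \<rho> n m \<Psi> \<beta> \<le> rho_bar M \<rho> n m \<Psi> \<alpha>"
    if \<alpha>: "\<alpha> \<in> {0..1}" and t: "t \<in> {0..1}" and \<beta>: "\<beta> \<in> {0..1}" "\<beta> = t * \<alpha> + (1 - t) * (1 - \<alpha>)" for \<alpha> \<beta> t
    unfolding rho_bar_def using \<alpha> t \<beta> b
    by (intro sqrt_radii_prod_of_sums_le[OF t \<rho> assms(3)] mean_dominated_set_S_set_S_set bounded_set_S_set) auto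
  show ?thesis
  proof (intro conjI ballI monotone_onI)
    fix \<alpha> :: real assume \<alpha>: "\<alpha> \<in> {0..1}"
    show "rho_bar M \<rho> n m \<Psi> \<alpha> \<le> sqrt (\<rho> (prod_of_sums n m \<Psi>)) * sqrt (\<rho> (prod_of_sums_rev n m \<Psi>))"
      unfolding rho_bar_def using b
      by (intro sqrt_radii_prod_of_sums_le[OF \<alpha> \<rho> assms(3)] mean_dominated_set_S_set[OF \<alpha>] bounded_set_S_set[OF \<alpha>])
  next
    fix \<alpha> \<beta> :: real assume ab: "\<alpha> \<in> {0..1/2}" "\<beta> \<in> {0..1/2}" "\<alpha> \<le> \<beta>"
    show "rho_bar M \<rho> n m \<Psi> \<beta> \<le> rho_bar M \<rho> n m \<Psi> \<alpha>"
    proof (cases "\<alpha> = 1 / 2")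
      case True
      then have "\<beta> = \<alpha>" using ab by simp
      then show ?thesis by simp
    next
      case False
      then have pos: "0 < 1 - 2 * \<alpha>" using ab by auto
      \<comment> \<open>\<beta> lies between \<alpha> and 1 - \<alpha>, and \<open>t\<close> is its
        position: 1 at \<alpha>, 0 at 1 - \<alpha>. For \<alpha> = 1/2 the interval degenerates,
        hence the case distinction.\<close>
      define t where "t = (1 - \<alpha> - \<beta>) / (1 - 2 * \<alpha>)"
      have "t * (1 - 2 * \<alpha>) = 1 - \<alpha> - \<beta>"
        using pos by (simp add: t_def)
      then have "\<beta> = t * \<alpha> + (1 - t) * (1 - \<alpha>)"
        by (simp add: algebra_simps)
      moreover have "t \<in> {0..1}"
        using ab pos by (auto simp: t_def field_simps)
      ultimately show ?thesis
        using ab by (intro step[of \<alpha> t]) auto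
    qed
  next
    fix \<alpha> \<beta> :: real assume ab: "\<alpha> \<in> {1/2..1}" "\<beta> \<in> {1/2..1}" "\<alpha> \<le> \<beta>"
    show "rho_bar M \<rho> n m \<Psi> \<alpha> \<le> rho_bar M \<rho> n m \<Psi> \<beta>"
    proof (cases "\<beta> = 1 / 2")
      case True
      then have "\<beta> = \<alpha>" using ab by simp
      then show ?thesis by simp
    next
      case False
      then have pos: "0 < 2 * \<beta> - 1" using ab by auto
      \<comment> \<open>Here \<alpha> lies between 1 - \<beta> and \<beta>, so the same solution
        applies with the two parameters exchanged.\<close>
      define t where "t = (\<alpha> + \<beta> - 1) / (2 * \<beta> - 1)"
      have "t * (2 * \<beta> - 1) = \<alpha> + \<beta> - 1"
        using pos by (simp add: t_def)
      then have "\<alpha> = t * \<beta> + (1 - t) * (1 - \<beta>)"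
        by (simp add: algebra_simps)
      moreover have "t \<in> {0..1}"
        using ab pos by (auto simp: t_def field_simps)
      ultimately show ?thesis
        using ab by (intro step[of \<beta> t]) auto
    qed
  qed
qed

end
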